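(* The theory $\mathrm{RCA}_0^{\Omega}$ proves the equivalences $$(\exists^{2})\leftrightarrow \Pi^0_1\text{-TRANS}\leftrightarrow \mathrm{IVT}^{*}\leftrightarrow \mathrm{UIVT}.$$
   Context: BASE THEORY. Finite types: $0$ (natural numbers), $\sigma\to\tau$, and $\sigma^{*}$ (finite sequences of objects of type $\sigma$); $1=0\to 0$, $2=1\to 0$, $3=2\to 0$. Superscripts indicate types; tuples are coded as single objects where convenient. Equality $=_0$ is primitive; for $\tau=\tau_1\to\dots\to\tau_k\to 0$, $x=_\tau y$ means $(\forall z_1\dots z_k)(xz_1\dots z_k=_0 yz_1\dots z_k)$. $\mathrm{RCA}_0^{\omega}$ is Kohlenbach's higher-order base theory: classical arithmetic in all finite types with combinators, zero, successor, the recursor $R_0$ (primitive recursion with type $0$ values), quantifier-free induction, extensionality $x=_\rho y\to\varphi(x)=_\tau\varphi(y)$ for all $\varphi^{\rho\to\tau}$, and $\mathrm{QF\text{-}AC}^{1,0}$, where $\mathrm{QF\text{-}AC}^{\sigma,\tau}$ is $(\forall x^\sigma)(\exists y^\tau)A_0(x,y)\to(\exists F^{\sigma\to\tau})(\forall x)A_0(x,F(x))$ for quantifier-free $A_0$. $\mathrm{RCA}_0^{\Omega}$ extends $\mathrm{RCA}_0^{\omega}$ (with the types $\sigma^*$) by a predicate $\mathrm{st}$ ("is standard") for each type. A formula is internal if it does not contain $\mathrm{st}$; $(\forall^{\mathrm{st}}x)A$ is $(\forall x)(\mathrm{st}(x)\to A)$, $(\exists^{\mathrm{st}}x)A$ is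 $(\exists x)(\mathrm{st}(x)\wedge A)$; $N\in\Omega$ means $\neg\mathrm{st}(N^0)$; $A^{\mathrm{st}}$ is $A$ with all quantifiers (except bounded number quantifiers) relativised to $\mathrm{st}$. Axioms: (i) standardness respects equality, closed terms are standard, a standard functional applied to a standard object is standard, and numbers below a standard number are standard; (ii) Idealization: $(\forall^{\mathrm{st}}x^{\sigma^*})(\exists y^\tau)(\forall z\in x)\varphi(z,y)\to(\exists y)(\forall^{\mathrm{st}}z^{\sigma})\varphi(z,y)$ for internal $\varphi$; (iii) $\mathrm{HAC}_{\mathrm{int}}$: $(\forall^{\mathrm{st}}x^{\rho})(\exists^{\mathrm{st}}y^{\tau})\varphi(x,y)\to(\exists^{\mathrm{st}}\Phi^{\rho\to\tau^*})(\forall^{\mathrm{st}}x)(\exists y\in\Phi(x))\varphi(x,y)$ for internal $\varphi$; (iv) $\mathrm{PF\text{-}TP}_\forall$: $(\forall^{\mathrm{st}}x^\tau)\varphi(x)\to(\forall x^\tau)\varphi(x)$ for internal $\varphi(x)$ with no parameters other than $x$; (v) for certain functionals uniquely specified by a parameter-free internal formula $D$ (e.g. the one in $(\exists^2)$), a constant $\Xi_0$ with the axiom $\mathrm{st}(\Xi_0)\wedge(\forall^{\mathrm{st}}\Xi)[D^{\mathrm{st}}(\Xi)\to \Xi_0$ and $\Xi$ agree on all standard inputs$]$; these constants do not count as parameters in (iv). NOTATION. A real is a fast-converging Cauchy sequence of rationals $q_{(\cdot)}^1$, i.e. $(\forall n,i)(|q_n-q_{n+i}|<2^{-n})$ (via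 a standard trick every $f^1$ can be viewed as a real); reals $q_{(\cdot)},r_{(\cdot)}$ are equal if $(\forall n)(|q_n-r_n|\leq 2^{-n})$. Functions from reals to reals are given by functionals of type $1\to1$ mapping equal reals to equal reals. $f\in C[0,1]$ means $f$ is $\varepsilon$-$\delta$-continuous on $[0,1]$; $f\in\overline{C}[0,1]$ means $f\in C[0,1]$, $f(0)\geq0$ and $f(1)\leq 0$; $\overline{C}^{\mathrm{st}}[0,1]$ is defined by the same formula with all quantifiers relative to $\mathrm{st}$. PRINCIPLES. $(\exists^2)$: $(\exists\varphi^2)(\forall g^1)[(\exists x^0)g(x)=0\leftrightarrow\varphi(g)=0]$. $\Pi^0_1\text{-TRANS}$: $(\forall^{\mathrm{st}}f^1)[(\forall^{\mathrm{st}}n^0)f(n)=0\to(\forall n^0)f(n)=0]$. $\mathrm{IVT}^*$: $(\forall^{\mathrm{st}}f^{1\to1}\in\overline{C}^{\mathrm{st}}[0,1])(\exists^{\mathrm{st}}x^1\in[0,1])(f(x)=0)$, where $f(x)=0$ is (full, internal) equality of reals. $\mathrm{UIVT}$: $(\exists\Phi^{(1\to1)\to1})(\forall f^{1\to1}\in\overline{C}[0,1])(f(\Phi(f))=0)$. *)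

theory Defs
  imports Main
begin

section \<open>Finite types, terms and formulas\<close>

datatype ty = N | Fn ty ty (infixr "\<rightarrow>" 60) | Seq ty

abbreviation T1 :: ty where "T1 \<equiv> N \<rightarrow> N"
abbreviation T2 :: ty where "T2 \<equiv> T1 \<rightarrow> N"

datatype con =
    CZero
  | CSuc
  | CK ty ty              \<comment> \<open>\<open>K x y = x\<close>\<close>
  | CS ty ty ty           \<comment> \<open>\<open>S x y z = x z (y z)\<close>\<close>
  | CR                    \<comment> \<open>the recursor \<open>R\<^sub>0\<close>\<close>
  | CNil ty
  | CCons ty
  | CLen ty
  | CNth ty
  | CTab ty               \<comment> \<open>\<open>Tab F n = \<langle>F 0, \<dots>, F (n - 1)\<rangle>\<close>\<close>
  | CXi nat ty            \<comment> \<open>the constants \<open>\<Xi>\<^sub>0\<close>; those present are fixed by a specification, see below\<close>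

fun conty :: "con \<Rightarrow> ty" where
  "conty CZero = N"
| "conty CSuc = N \<rightarrow> N"
| "conty (CK \<sigma> \<tau>) = \<sigma> \<rightarrow> \<tau> \<rightarrow> \<sigma>"
| "conty (CS \<rho> \<sigma> \<tau>) = (\<rho> \<rightarrow> \<sigma> \<rightarrow> \<tau>) \<rightarrow> (\<rho> \<rightarrow> \<sigma>) \<rightarrow> \<rho> \<rightarrow> \<tau>"
| "conty CR = N \<rightarrow> N \<rightarrow> (N \<rightarrow> N \<rightarrow> N) \<rightarrow> N"
| "conty (CNil \<sigma>) = Seq \<sigma>"
| "conty (CCons \<sigma>) = \<sigma> \<rightarrow> Seq \<sigma> \<rightarrow> Seq \<sigma>"
| "conty (CLen \<sigma>) = Seq \<sigma> \<rightarrow> N"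
| "conty (CNth \<sigma>) = Seq \<sigma> \<rightarrow> N \<rightarrow> \<sigma>"
| "conty (CTab \<sigma>) = (N \<rightarrow> \<sigma>) \<rightarrow> N \<rightarrow> Seq \<sigma>"
| "conty (CXi n \<tau>) = \<tau>"

text \<open>
  Locally nameless syntax: \<open>Free x \<tau>\<close> is the variable of type \<open>\<tau>\<close> with name \<open>x\<close>, and
  \<open>Bound i\<close> is a de Bruijn index, used for bound variables only.  \<open>All \<tau>\<close> and
  \<open>BAll t\<close> bind one index; \<open>BAll t \<phi>\<close> is the bounded number quantifier
  \<open>(\<forall>i < t) \<phi>\<close>.  It is primitive because the relativisation to \<open>st\<close> treats bounded
  number quantifiers separately.  The remaining connectives are defined classically.
\<close>

datatype tm = Free nat ty | Bound nat | Con con | App tm tm (infixl "\<cdot>" 90)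

datatype fm =
    Fls
  | Eq tm tm (infix "\<doteq>" 50)
  | St ty tm
  | Imp fm fm (infixr "\<^bold>\<longrightarrow>" 25)
  | All ty fm
  | BAll tm fm

abbreviation fneg :: "fm \<Rightarrow> fm" ("\<^bold>\<not> _" [40] 40) where "\<^bold>\<not> A \<equiv> A \<^bold>\<longrightarrow> Fls"
abbreviation fconj :: "fm \<Rightarrow> fm \<Rightarrow> fm" (infixr "\<^bold>\<and>" 35) where "A \<^bold>\<and> B \<equiv> \<^bold>\<not> (A \<^bold>\<longrightarrow> \<^bold>\<not> B)"
abbreviation fiff :: "fm \<Rightarrow> fm \<Rightarrow> fm" (infix "\<^bold>\<longleftrightarrow>" 26)
  where "A \<^bold>\<longleftrightarrow> B \<equiv> (A \<^bold>\<longrightarrow> B) \<^bold>\<and> (B \<^bold>\<longrightarrow> A)"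

fun internal :: "fm \<Rightarrow> bool" where
  "internal Fls = True"
| "internal (s \<doteq> t) = True"
| "internal (St \<tau> t) = False"
| "internal (A \<^bold>\<longrightarrow> B) = (internal A \<and> internal B)"
| "internal (All \<tau> A) = internal A"
| "internal (BAll t A) = internal A"

text \<open>Quantifier-free formulas are understood to be internal.\<close>

fun qfree :: "fm \<Rightarrow> bool" where
  "qfree Fls = True"
| "qfree (s \<doteq> t) = True"
| "qfree (St \<tau> t) = False"
| "qfree (A \<^bold>\<longrightarrow> B) = (qfree A \<and> qfree B)"
| "qfree (All \<tau> A) = False"
| "qfree (BAll t A) = False"

fun names_tm :: "tm \<Rightarrow> nat set" where
  "names_tm (Free x \<tau>) = {x}"
| "names_tm (Bound i) = {}"
| "names_tm (Con c) = {}"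
| "names_tm (s \<cdot> t) = names_tm s \<union> names_tm t"

fun names :: "fm \<Rightarrow> nat set" where
  "names Fls = {}"
| "names (s \<doteq> t) = names_tm s \<union> names_tm t"
| "names (St \<tau> t) = names_tm t"
| "names (A \<^bold>\<longrightarrow> B) = names A \<union> names B"
| "names (All \<tau> A) = names A"
| "names (BAll t A) = names_tm t \<union> names A"

text \<open>
  \<open>open_fm k us A\<close> replaces the indices \<open>k, k + 1, \<dots>\<close> by the terms \<open>us\<close>, which are meant
  to contain no \<open>Bound\<close>, so no lifting is needed.  We write \<open>inst A us\<close> for \<open>k = 0\<close>.
  Conversely, \<open>close_fm k x \<sigma> A\<close> turns the variable \<open>Free x \<sigma>\<close> into index \<open>k\<close>.
\<close>

fun open_tm :: "nat \<Rightarrow> tm list \<Rightarrow> tm \<Rightarrow> tm" where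
  "open_tm k us (Free x \<tau>) = Free x \<tau>"
| "open_tm k us (Bound i) = (if k \<le> i \<and> i < k + length us then us ! (i - k) else Bound i)"
| "open_tm k us (Con c) = Con c"
| "open_tm k us (s \<cdot> t) = open_tm k us s \<cdot> open_tm k us t"

fun open_fm :: "nat \<Rightarrow> tm list \<Rightarrow> fm \<Rightarrow> fm" where
  "open_fm k us Fls = Fls"
| "open_fm k us (s \<doteq> t) = (open_tm k us s \<doteq> open_tm k us t)"
| "open_fm k us (St \<tau> t) = St \<tau> (open_tm k us t)"
| "open_fm k us (A \<^bold>\<longrightarrow> B) = (open_fm k us A \<^bold>\<longrightarrow> open_fm k us B)"
| "open_fm k us (All \<tau> A) = All \<tau> (open_fm (Suc k) us A)"
| "open_fm k us (BAll t A) = BAll (open_tm k us t) (open_fm (Suc k) us A)"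

abbreviation inst :: "fm \<Rightarrow> tm list \<Rightarrow> fm" where "inst A us \<equiv> open_fm 0 us A"

fun close_tm :: "nat \<Rightarrow> nat \<Rightarrow> ty \<Rightarrow> tm \<Rightarrow> tm" where
  "close_tm k x \<sigma> (Free y \<tau>) = (if y = x \<and> \<tau> = \<sigma> then Bound k else Free y \<tau>)"
| "close_tm k x \<sigma> (Bound i) = Bound i"
| "close_tm k x \<sigma> (Con c) = Con c"
| "close_tm k x \<sigma> (s \<cdot> t) = close_tm k x \<sigma> s \<cdot> close_tm k x \<sigma> t"

fun close_fm :: "nat \<Rightarrow> nat \<Rightarrow> ty \<Rightarrow> fm \<Rightarrow> fm" where
  "close_fm k x \<sigma> Fls = Fls"
| "close_fm k x \<sigma> (s \<doteq> t) = (close_tm k x \<sigma> s \<doteq> close_tm k x \<sigma> t)"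
| "close_fm k x \<sigma> (St \<tau> t) = St \<tau> (close_tm k x \<sigma> t)"
| "close_fm k x \<sigma> (A \<^bold>\<longrightarrow> B) = (close_fm k x \<sigma> A \<^bold>\<longrightarrow> close_fm k x \<sigma> B)"
| "close_fm k x \<sigma> (All \<tau> A) = All \<tau> (close_fm (Suc k) x \<sigma> A)"
| "close_fm k x \<sigma> (BAll t A) = BAll (close_tm k x \<sigma> t) (close_fm (Suc k) x \<sigma> A)"

text \<open>The closed term \<open>0\<^sup>\<tau>\<close>.\<close>

fun zero :: "ty \<Rightarrow> tm" where
  "zero N = Con CZero"
| "zero (\<sigma> \<rightarrow> \<tau>) = Con (CK \<tau> \<sigma>) \<cdot> zero \<tau>"
| "zero (Seq \<sigma>) = Con (CNil \<sigma>)"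

text \<open>
  Binders for writing concrete formulas: \<open>fall \<sigma> (\<lambda>x. B x)\<close> is \<open>(\<forall>x\<^sup>\<sigma>) B(x)\<close>.
  A name that does not occur in \<open>B\<close> (read off from the instance \<open>B (zero \<sigma>)\<close>, which has no
  occurrence of the bound variable) is chosen and then bound.
\<close>

definition fresh :: "nat set \<Rightarrow> nat" where
  "fresh X = Suc (Max (insert 0 X))"

definition fbody :: "ty \<Rightarrow> (tm \<Rightarrow> fm) \<Rightarrow> fm" where
  "fbody \<sigma> B = (let x = fresh (names (B (zero \<sigma>))) in close_fm 0 x \<sigma> (B (Free x \<sigma>)))"

definition fall :: "ty \<Rightarrow> (tm \<Rightarrow> fm) \<Rightarrow> fm" where
  "fall \<sigma> B = All \<sigma> (fbody \<sigma> B)"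

definition fex :: "ty \<Rightarrow> (tm \<Rightarrow> fm) \<Rightarrow> fm" where
  "fex \<sigma> B = (\<^bold>\<not> fall \<sigma> (\<lambda>x. \<^bold>\<not> B x))"

definition fball :: "tm \<Rightarrow> (tm \<Rightarrow> fm) \<Rightarrow> fm" where
  "fball t B = BAll t (fbody N B)"

definition fall_st :: "ty \<Rightarrow> (tm \<Rightarrow> fm) \<Rightarrow> fm" where
  "fall_st \<sigma> B = fall \<sigma> (\<lambda>x. St \<sigma> x \<^bold>\<longrightarrow> B x)"

definition fex_st :: "ty \<Rightarrow> (tm \<Rightarrow> fm) \<Rightarrow> fm" where
  "fex_st \<sigma> B = fex \<sigma> (\<lambda>x. St \<sigma> x \<^bold>\<and> B x)"

text \<open>\<open>(\<forall>z \<in> s) B(z)\<close> and \<open>(\<exists>z \<in> s) B(z)\<close> for a sequence \<open>s\<close> of type \<open>\<sigma>\<^sup>*\<close>.\<close>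

definition fall_in :: "ty \<Rightarrow> tm \<Rightarrow> (tm \<Rightarrow> fm) \<Rightarrow> fm" where
  "fall_in \<sigma> s B = fball (Con (CLen \<sigma>) \<cdot> s) (\<lambda>i. B (Con (CNth \<sigma>) \<cdot> s \<cdot> i))"

definition fex_in :: "ty \<Rightarrow> tm \<Rightarrow> (tm \<Rightarrow> fm) \<Rightarrow> fm" where
  "fex_in \<sigma> s B = (\<^bold>\<not> fall_in \<sigma> s (\<lambda>z. \<^bold>\<not> B z))"

text \<open>\<open>A\<^sup>s\<^sup>t\<close>: all quantifiers except bounded number quantifiers are relativised to \<open>st\<close>.\<close>

fun relst :: "fm \<Rightarrow> fm" where
  "relst Fls = Fls"
| "relst (s \<doteq> t) = (s \<doteq> t)"
| "relst (St \<tau> t) = St \<tau> t"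
| "relst (A \<^bold>\<longrightarrow> B) = (relst A \<^bold>\<longrightarrow> relst B)"
| "relst (All \<tau> A) = All \<tau> (St \<tau> (Bound 0) \<^bold>\<longrightarrow> relst A)"
| "relst (BAll t A) = BAll t (relst A)"

text \<open>Equality at all types, reduced to equality at type 0.\<close>

primrec eqf :: "ty \<Rightarrow> tm \<Rightarrow> tm \<Rightarrow> fm" where
  "eqf N = (\<lambda>s t. s \<doteq> t)"
| "eqf (\<sigma> \<rightarrow> \<tau>) = (\<lambda>s t. fall \<sigma> (\<lambda>z. eqf \<tau> (s \<cdot> z) (t \<cdot> z)))"
| "eqf (Seq \<sigma>) = (\<lambda>s t. Con (CLen \<sigma>) \<cdot> s \<doteq> Con (CLen \<sigma>) \<cdot> t \<^bold>\<and>
     fball (Con (CLen \<sigma>) \<cdot> s) (\<lambda>i. eqf \<sigma> (Con (CNth \<sigma>) \<cdot> s \<cdot> i) (Con (CNth \<sigma>) \<cdot> t \<cdot> i)))"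

section \<open>Closed terms for primitive recursive arithmetic\<close>

text \<open>Lambda abstraction is bracket abstraction into the typed combinators.\<close>

fun tyof :: "tm \<Rightarrow> ty" where
  "tyof (Free x \<tau>) = \<tau>"
| "tyof (Con c) = conty c"
| "tyof (s \<cdot> t) = (case tyof s of \<sigma> \<rightarrow> \<tau> \<Rightarrow> \<tau> | _ \<Rightarrow> N)"
| "tyof (Bound i) = N"

fun bracket :: "nat \<Rightarrow> ty \<Rightarrow> tm \<Rightarrow> tm" where
  "bracket x \<sigma> (s \<cdot> t) =
     (if x \<notin> names_tm (s \<cdot> t) then Con (CK (tyof (s \<cdot> t)) \<sigma>) \<cdot> (s \<cdot> t)
      else Con (CS \<sigma> (tyof t) (tyof (s \<cdot> t))) \<cdot> bracket x \<sigma> s \<cdot> bracket x \<sigma> t)"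
| "bracket x \<sigma> t =
     (if t = Free x \<sigma> then Con (CS \<sigma> (\<sigma> \<rightarrow> \<sigma>) \<sigma>) \<cdot> Con (CK \<sigma> (\<sigma> \<rightarrow> \<sigma>)) \<cdot> Con (CK \<sigma> \<sigma>)
      else Con (CK (tyof t) \<sigma>) \<cdot> t)"

definition lam :: "ty \<Rightarrow> (tm \<Rightarrow> tm) \<Rightarrow> tm" where
  "lam \<sigma> B = (let x = fresh (names_tm (B (zero \<sigma>))) in bracket x \<sigma> (B (Free x \<sigma>)))"

abbreviation zro :: tm where "zro \<equiv> Con CZero"
abbreviation suc :: "tm \<Rightarrow> tm" where "suc t \<equiv> Con CSuc \<cdot> t"
abbreviation rec :: "tm \<Rightarrow> tm \<Rightarrow> tm \<Rightarrow> tm" where "rec n a f \<equiv> Con CR \<cdot> n \<cdot> a \<cdot> f"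

definition tpred :: tm where
  "tpred = lam N (\<lambda>n. rec n zro (lam N (\<lambda>r. lam N (\<lambda>i. i))))"
definition tadd :: tm where
  "tadd = lam N (\<lambda>m. lam N (\<lambda>n. rec n m (lam N (\<lambda>r. lam N (\<lambda>i. suc r)))))"
definition tmonus :: tm where
  "tmonus = lam N (\<lambda>m. lam N (\<lambda>n. rec n m (lam N (\<lambda>r. lam N (\<lambda>i. tpred \<cdot> r)))))"
definition tmult :: tm where
  "tmult = lam N (\<lambda>m. lam N (\<lambda>n. rec n zro (lam N (\<lambda>r. lam N (\<lambda>i. tadd \<cdot> r \<cdot> m)))))"
definition texp2 :: tm where
  "texp2 = lam N (\<lambda>n. rec n (suc zro) (lam N (\<lambda>r. lam N (\<lambda>i. tadd \<cdot> r \<cdot> r))))"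

abbreviation le :: "tm \<Rightarrow> tm \<Rightarrow> fm" where "le s t \<equiv> tmonus \<cdot> s \<cdot> t \<doteq> zro"
abbreviation less :: "tm \<Rightarrow> tm \<Rightarrow> fm" where "less s t \<equiv> le (suc s) t"

text \<open>
  Cantor pairing \<open>\<langle>m, n\<rangle> = T(m + n) + m\<close>, where \<open>T(k) = 0 + 1 + \<dots> + k\<close>.  The term \<open>troot\<close>
  computes the largest \<open>k\<close> with \<open>T(k) \<le> c\<close>: in the recursion step from \<open>c\<close> to \<open>c + 1\<close> the value
  \<open>r\<close> is increased iff \<open>T(r + 1) \<le> c + 1\<close>, i.e. iff \<open>1 - (T(r + 1) - (c + 1))\<close>, with
  truncated subtraction, is 1.
\<close>

definition ttri :: tm where
  "ttri = lam N (\<lambda>n. rec n zro (lam N (\<lambda>r. lam N (\<lambda>i. tadd \<cdot> r \<cdot> suc i))))"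
definition tpair :: tm where
  "tpair = lam N (\<lambda>m. lam N (\<lambda>n. tadd \<cdot> (ttri \<cdot> (tadd \<cdot> m \<cdot> n)) \<cdot> m))"
definition troot :: tm where
  "troot = lam N (\<lambda>c. rec c zro (lam N (\<lambda>r. lam N (\<lambda>i.
     tadd \<cdot> r \<cdot> (tmonus \<cdot> suc zro \<cdot> (tmonus \<cdot> (ttri \<cdot> suc r) \<cdot> suc i))))))"
definition tfst :: tm where
  "tfst = lam N (\<lambda>c. tmonus \<cdot> c \<cdot> (ttri \<cdot> (troot \<cdot> c)))"
definition tsnd :: tm where
  "tsnd = lam N (\<lambda>c. tmonus \<cdot> (troot \<cdot> c) \<cdot> (tfst \<cdot> c))"

text \<open>The number \<open>\<langle>\<langle>a, b\<rangle>, d\<rangle>\<close> codes the rational \<open>(a - b) / (d + 1)\<close>; every number is a code.\<close>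

abbreviation qpos :: "tm \<Rightarrow> tm" where "qpos c \<equiv> tfst \<cdot> (tfst \<cdot> c)"
abbreviation qneg :: "tm \<Rightarrow> tm" where "qneg c \<equiv> tsnd \<cdot> (tfst \<cdot> c)"
abbreviation qden :: "tm \<Rightarrow> tm" where "qden c \<equiv> suc (tsnd \<cdot> c)"
abbreviation qmk :: "tm \<Rightarrow> tm \<Rightarrow> tm \<Rightarrow> tm" where
  "qmk a b d \<equiv> tpair \<cdot> (tpair \<cdot> a \<cdot> b) \<cdot> (tpred \<cdot> d)"

abbreviation q0 :: tm where "q0 \<equiv> qmk zro zro (suc zro)"
abbreviation q1 :: tm where "q1 \<equiv> qmk (suc zro) zro (suc zro)"

text \<open>\<open>qhalf n\<close> is \<open>2\<^sup>-\<^sup>n\<close>.\<close>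

definition qhalf :: "tm \<Rightarrow> tm" where
  "qhalf n = qmk (suc zro) zro (texp2 \<cdot> n)"
definition qadd :: "tm \<Rightarrow> tm \<Rightarrow> tm" where
  "qadd p q = qmk (tadd \<cdot> (tmult \<cdot> qpos p \<cdot> qden q) \<cdot> (tmult \<cdot> qpos q \<cdot> qden p))
                  (tadd \<cdot> (tmult \<cdot> qneg p \<cdot> qden q) \<cdot> (tmult \<cdot> qneg q \<cdot> qden p))
                  (tmult \<cdot> qden p \<cdot> qden q)"
definition qminus :: "tm \<Rightarrow> tm" where
  "qminus p = qmk (qneg p) (qpos p) (qden p)"
definition qabs :: "tm \<Rightarrow> tm" where
  "qabs p = qmk (tadd \<cdot> (tmonus \<cdot> qpos p \<cdot> qneg p) \<cdot> (tmonus \<cdot> qneg p \<cdot> qpos p)) zro (qden p)"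
definition qdist :: "tm \<Rightarrow> tm \<Rightarrow> tm" where
  "qdist p q = qabs (qadd p (qminus q))"
definition qle :: "tm \<Rightarrow> tm \<Rightarrow> fm" where
  "qle p q = le (tadd \<cdot> (tmult \<cdot> qpos p \<cdot> qden q) \<cdot> (tmult \<cdot> qneg q \<cdot> qden p))
                (tadd \<cdot> (tmult \<cdot> qpos q \<cdot> qden p) \<cdot> (tmult \<cdot> qneg p \<cdot> qden q))"
definition qless :: "tm \<Rightarrow> tm \<Rightarrow> fm" where
  "qless p q = (\<^bold>\<not> qle q p)"

section \<open>Derivability\<close>

text \<open>
  A specification lists the functionals for which a constant \<open>\<Xi>\<^sub>0\<close> is available:
  \<open>sp n = Some (\<tau>, D)\<close> says that \<open>CXi n \<tau>\<close> belongs to the language and stands for the functional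
  of type \<open>\<tau>\<close> specified by the formula \<open>D\<close>, whose argument is \<open>Bound 0\<close>.
\<close>

type_synonym spec = "nat \<Rightarrow> (ty \<times> fm) option"

fun in_lang :: "spec \<Rightarrow> con \<Rightarrow> bool" where
  "in_lang sp (CXi n \<tau>) = (\<exists>D. sp n = Some (\<tau>, D))"
| "in_lang sp c = True"

text \<open>
  \<open>wt sp \<Gamma> t \<tau>\<close>: \<open>t\<close> is a term of type \<open>\<tau>\<close>, where the list \<open>\<Gamma>\<close> gives the types of the indices.
  With \<open>\<Gamma> = []\<close> there are no loose indices.
\<close>

inductive wt :: "spec \<Rightarrow> ty list \<Rightarrow> tm \<Rightarrow> ty \<Rightarrow> bool" for sp where
  "wt sp \<Gamma> (Free x \<tau>) \<tau>"
| "i < length \<Gamma> \<Longrightarrow> wt sp \<Gamma> (Bound i) (\<Gamma> ! i)"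
| "in_lang sp c \<Longrightarrow> wt sp \<Gamma> (Con c) (conty c)"
| "wt sp \<Gamma> s (\<sigma> \<rightarrow> \<tau>) \<Longrightarrow> wt sp \<Gamma> t \<sigma> \<Longrightarrow> wt sp \<Gamma> (s \<cdot> t) \<tau>"

fun wf :: "spec \<Rightarrow> ty list \<Rightarrow> fm \<Rightarrow> bool" where
  "wf sp \<Gamma> Fls = True"
| "wf sp \<Gamma> (s \<doteq> t) = (wt sp \<Gamma> s N \<and> wt sp \<Gamma> t N)"
| "wf sp \<Gamma> (St \<tau> t) = wt sp \<Gamma> t \<tau>"
| "wf sp \<Gamma> (A \<^bold>\<longrightarrow> B) = (wf sp \<Gamma> A \<and> wf sp \<Gamma> B)"
| "wf sp \<Gamma> (All \<tau> A) = wf sp (\<tau> # \<Gamma>) A"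
| "wf sp \<Gamma> (BAll t A) = (wt sp \<Gamma> t N \<and> wf sp (N # \<Gamma>) A)"

text \<open>
  Classical natural deduction from a set \<open>T\<close> of axioms and a set \<open>H\<close> of hypotheses.  Variables free
  in an axiom are implicitly universally quantified, hence the freshness condition of \<open>AllI\<close> only
  concerns \<open>H\<close>.  There are no rules for equality: its properties are among the axioms of the theory.
\<close>

inductive prv :: "spec \<Rightarrow> fm set \<Rightarrow> fm set \<Rightarrow> fm \<Rightarrow> bool" for sp T where
  Axiom: "A \<in> T \<Longrightarrow> prv sp T H A"
| Hyp: "A \<in> H \<Longrightarrow> wf sp [] A \<Longrightarrow> prv sp T H A"
| ImpI: "wf sp [] A \<Longrightarrow> prv sp T (insert A H) B \<Longrightarrow> prv sp T H (A \<^bold>\<longrightarrow> B)"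
| ImpE: "prv sp T H (A \<^bold>\<longrightarrow> B) \<Longrightarrow> prv sp T H A \<Longrightarrow> prv sp T H B"
| Classical: "wf sp [] A \<Longrightarrow> prv sp T (insert (\<^bold>\<not> A) H) Fls \<Longrightarrow> prv sp T H A"
| AllI: "x \<notin> names A \<Longrightarrow> (\<forall>B\<in>H. x \<notin> names B) \<Longrightarrow> prv sp T H (inst A [Free x \<sigma>])
    \<Longrightarrow> prv sp T H (All \<sigma> A)"
| AllE: "prv sp T H (All \<sigma> A) \<Longrightarrow> wt sp [] t \<sigma> \<Longrightarrow> prv sp T H (inst A [t])"
| BAllI: "wt sp [] t N \<Longrightarrow> prv sp T H (All N (less (Bound 0) t \<^bold>\<longrightarrow> A)) \<Longrightarrow> prv sp T H (BAll t A)"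
| BAllE: "prv sp T H (BAll t A) \<Longrightarrow> prv sp T H (All N (less (Bound 0) t \<^bold>\<longrightarrow> A))"

section \<open>The theories\<close>

text \<open>
  In the schemata, a formula \<open>A\<close> that is well-formed in \<open>[\<sigma>, \<tau>]\<close> has the arguments
  \<open>Bound 0\<close> of type \<open>\<sigma>\<close> and \<open>Bound 1\<close> of type \<open>\<tau>\<close>; \<open>inst A [x, y]\<close> is \<open>A(x, y)\<close>.
  It may contain further free variables as parameters.  The axioms for sequences say that
  \<open>CNth\<close> returns \<open>0\<^sup>\<sigma>\<close> beyond the length, which fixes the values that its list argument leaves open.
\<close>

inductive RCA0_omega_ax :: "spec \<Rightarrow> fm \<Rightarrow> bool" for sp where
  eq_refl: "RCA0_omega_ax sp (fall N (\<lambda>x. x \<doteq> x))"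
| eq_euclid: "RCA0_omega_ax sp (fall N (\<lambda>x. fall N (\<lambda>y. fall N (\<lambda>z.
    x \<doteq> y \<^bold>\<longrightarrow> x \<doteq> z \<^bold>\<longrightarrow> y \<doteq> z))))"
| suc_zero: "RCA0_omega_ax sp (fall N (\<lambda>x. \<^bold>\<not> suc x \<doteq> zro))"
| suc_inj: "RCA0_omega_ax sp (fall N (\<lambda>x. fall N (\<lambda>y. suc x \<doteq> suc y \<^bold>\<longrightarrow> x \<doteq> y)))"
| K: "RCA0_omega_ax sp (fall \<sigma> (\<lambda>x. fall \<tau> (\<lambda>y. eqf \<sigma> (Con (CK \<sigma> \<tau>) \<cdot> x \<cdot> y) x)))"
| S: "RCA0_omega_ax sp (fall (\<rho> \<rightarrow> \<sigma> \<rightarrow> \<tau>) (\<lambda>x. fall (\<rho> \<rightarrow> \<sigma>) (\<lambda>y. fall \<rho> (\<lambda>z.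
    eqf \<tau> (Con (CS \<rho> \<sigma> \<tau>) \<cdot> x \<cdot> y \<cdot> z) (x \<cdot> z \<cdot> (y \<cdot> z))))))"
| R_zero: "RCA0_omega_ax sp (fall N (\<lambda>y. fall (N \<rightarrow> N \<rightarrow> N) (\<lambda>f. rec zro y f \<doteq> y)))"
| R_suc: "RCA0_omega_ax sp (fall N (\<lambda>x. fall N (\<lambda>y. fall (N \<rightarrow> N \<rightarrow> N) (\<lambda>f.
    rec (suc x) y f \<doteq> f \<cdot> (rec x y f) \<cdot> x))))"
| len_nil: "RCA0_omega_ax sp (Con (CLen \<sigma>) \<cdot> Con (CNil \<sigma>) \<doteq> zro)"
| len_cons: "RCA0_omega_ax sp (fall \<sigma> (\<lambda>a. fall (Seq \<sigma>) (\<lambda>s.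
    Con (CLen \<sigma>) \<cdot> (Con (CCons \<sigma>) \<cdot> a \<cdot> s) \<doteq> suc (Con (CLen \<sigma>) \<cdot> s))))"
| nth_cons_zero: "RCA0_omega_ax sp (fall \<sigma> (\<lambda>a. fall (Seq \<sigma>) (\<lambda>s.
    eqf \<sigma> (Con (CNth \<sigma>) \<cdot> (Con (CCons \<sigma>) \<cdot> a \<cdot> s) \<cdot> zro) a)))"
| nth_cons_suc: "RCA0_omega_ax sp (fall \<sigma> (\<lambda>a. fall (Seq \<sigma>) (\<lambda>s. fall N (\<lambda>i.
    eqf \<sigma> (Con (CNth \<sigma>) \<cdot> (Con (CCons \<sigma>) \<cdot> a \<cdot> s) \<cdot> suc i) (Con (CNth \<sigma>) \<cdot> s \<cdot> i)))))"
| nth_default: "RCA0_omega_ax sp (fall (Seq \<sigma>) (\<lambda>s. fall N (\<lambda>i.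
    le (Con (CLen \<sigma>) \<cdot> s) i \<^bold>\<longrightarrow> eqf \<sigma> (Con (CNth \<sigma>) \<cdot> s \<cdot> i) (zero \<sigma>))))"
| len_tab: "RCA0_omega_ax sp (fall (N \<rightarrow> \<sigma>) (\<lambda>F. fall N (\<lambda>n.
    Con (CLen \<sigma>) \<cdot> (Con (CTab \<sigma>) \<cdot> F \<cdot> n) \<doteq> n)))"
| nth_tab: "RCA0_omega_ax sp (fall (N \<rightarrow> \<sigma>) (\<lambda>F. fall N (\<lambda>n. fall N (\<lambda>i.
    less i n \<^bold>\<longrightarrow> eqf \<sigma> (Con (CNth \<sigma>) \<cdot> (Con (CTab \<sigma>) \<cdot> F \<cdot> n) \<cdot> i) (F \<cdot> i)))))"
| QF_IND: "qfree A \<Longrightarrow> wf sp [N] A \<Longrightarrow> RCA0_omega_ax sp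
    (inst A [zro] \<^bold>\<longrightarrow> fall N (\<lambda>x. inst A [x] \<^bold>\<longrightarrow> inst A [suc x]) \<^bold>\<longrightarrow> fall N (\<lambda>x. inst A [x]))"
| Ext: "RCA0_omega_ax sp (fall (\<rho> \<rightarrow> \<tau>) (\<lambda>f. fall \<rho> (\<lambda>x. fall \<rho> (\<lambda>y.
    eqf \<rho> x y \<^bold>\<longrightarrow> eqf \<tau> (f \<cdot> x) (f \<cdot> y)))))"
| QF_AC: "qfree A \<Longrightarrow> wf sp [T1, N] A \<Longrightarrow> RCA0_omega_ax sp
    (fall T1 (\<lambda>x. fex N (\<lambda>y. inst A [x, y])) \<^bold>\<longrightarrow> fex T2 (\<lambda>F. fall T1 (\<lambda>x. inst A [x, F \<cdot> x])))"

inductive RCA0_Omega_ax :: "spec \<Rightarrow> fm \<Rightarrow> bool" for sp where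
  base: "RCA0_omega_ax sp A \<Longrightarrow> RCA0_Omega_ax sp A"
| st_eq: "RCA0_Omega_ax sp (fall \<tau> (\<lambda>x. fall \<tau> (\<lambda>y. eqf \<tau> x y \<^bold>\<longrightarrow> St \<tau> x \<^bold>\<longrightarrow> St \<tau> y)))"
| st_closed: "wt sp [] t \<tau> \<Longrightarrow> names_tm t = {} \<Longrightarrow> RCA0_Omega_ax sp (St \<tau> t)"
| st_app: "RCA0_Omega_ax sp (fall (\<sigma> \<rightarrow> \<tau>) (\<lambda>f. fall \<sigma> (\<lambda>x.
    St (\<sigma> \<rightarrow> \<tau>) f \<^bold>\<longrightarrow> St \<sigma> x \<^bold>\<longrightarrow> St \<tau> (f \<cdot> x))))"
| st_le: "RCA0_Omega_ax sp (fall N (\<lambda>n. fall N (\<lambda>m. St N n \<^bold>\<longrightarrow> le m n \<^bold>\<longrightarrow> St N m)))"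
| Idealization: "internal A \<Longrightarrow> wf sp [\<sigma>, \<tau>] A \<Longrightarrow> RCA0_Omega_ax sp
    (fall_st (Seq \<sigma>) (\<lambda>x. fex \<tau> (\<lambda>y. fall_in \<sigma> x (\<lambda>z. inst A [z, y])))
     \<^bold>\<longrightarrow> fex \<tau> (\<lambda>y. fall_st \<sigma> (\<lambda>z. inst A [z, y])))"
| HAC_int: "internal A \<Longrightarrow> wf sp [\<rho>, \<tau>] A \<Longrightarrow> RCA0_Omega_ax sp
    (fall_st \<rho> (\<lambda>x. fex_st \<tau> (\<lambda>y. inst A [x, y]))
     \<^bold>\<longrightarrow> fex_st (\<rho> \<rightarrow> Seq \<tau>) (\<lambda>F. fall_st \<rho> (\<lambda>x. fex_in \<tau> (F \<cdot> x) (\<lambda>y. inst A [x, y]))))"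
| PF_TP: "internal A \<Longrightarrow> wf sp [\<tau>] A \<Longrightarrow> names A = {} \<Longrightarrow> RCA0_Omega_ax sp
    (fall_st \<tau> (\<lambda>x. inst A [x]) \<^bold>\<longrightarrow> fall \<tau> (\<lambda>x. inst A [x]))"
| Xi: "sp n = Some (\<tau>, D) \<Longrightarrow> RCA0_Omega_ax sp
    (St \<tau> (Con (CXi n \<tau>)) \<^bold>\<and>
     fall_st \<tau> (\<lambda>\<xi>. inst (relst D) [\<xi>] \<^bold>\<longrightarrow> relst (eqf \<tau> (Con (CXi n \<tau>)) \<xi>)))"

definition RCA0_omega_proves :: "fm \<Rightarrow> bool" where
  "RCA0_omega_proves A = prv Map.empty {B. RCA0_omega_ax Map.empty B} {} A"

definition RCA0_Omega_proves :: "spec \<Rightarrow> fm \<Rightarrow> bool" where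
  "RCA0_Omega_proves sp A = prv sp {B. RCA0_Omega_ax sp B} {} A"

text \<open>
  \<open>D\<close> is a parameter-free internal formula which, provably in the base theory, specifies at most
  one functional of type \<open>\<tau>\<close>.
\<close>

definition uniquely_specifies :: "ty \<Rightarrow> fm \<Rightarrow> bool" where
  "uniquely_specifies \<tau> D \<longleftrightarrow> internal D \<and> wf Map.empty [\<tau>] D \<and> names D = {} \<and>
     RCA0_omega_proves (fall \<tau> (\<lambda>\<xi>. fall \<tau> (\<lambda>\<xi>'. inst D [\<xi>] \<^bold>\<longrightarrow> inst D [\<xi>'] \<^bold>\<longrightarrow> eqf \<tau> \<xi> \<xi>')))"

text \<open>
  The matrix of \<open>(\<exists>\<^sup>2)\<close> leaves the nonzero values open; requiring all values to be at most 1
  makes the functional unique.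
\<close>

definition exists2_spec :: fm where
  "exists2_spec = fbody T2 (\<lambda>\<phi>. fall T1 (\<lambda>g.
     (fex N (\<lambda>x. g \<cdot> x \<doteq> zro) \<^bold>\<longleftrightarrow> \<phi> \<cdot> g \<doteq> zro) \<^bold>\<and> le (\<phi> \<cdot> g) (suc zro)))"

text \<open>
  Which functionals receive a constant is left open, except that the one in \<open>(\<exists>\<^sup>2)\<close> does.
\<close>

definition admissible :: "spec \<Rightarrow> bool" where
  "admissible sp \<longleftrightarrow> (\<forall>n \<tau> D. sp n = Some (\<tau>, D) \<longrightarrow> uniquely_specifies \<tau> D) \<and>
     (\<exists>n. sp n = Some (T2, exists2_spec))"

section \<open>Reals and the principles\<close>

text \<open>
  Quantifiers over reals are quantifiers over type 1 guarded by \<open>is_real\<close>.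
  The ordering follows the convention for equality, so \<open>x = y\<close> iff \<open>x \<le> y\<close> and \<open>y \<le> x\<close>.
\<close>

definition is_real :: "tm \<Rightarrow> fm" where
  "is_real x = fall N (\<lambda>n. fall N (\<lambda>i. qless (qdist (x \<cdot> n) (x \<cdot> (tadd \<cdot> n \<cdot> i))) (qhalf n)))"
definition real_eq :: "tm \<Rightarrow> tm \<Rightarrow> fm" where
  "real_eq x y = fall N (\<lambda>n. qle (qdist (x \<cdot> n) (y \<cdot> n)) (qhalf n))"
definition real_le :: "tm \<Rightarrow> tm \<Rightarrow> fm" where
  "real_le x y = fall N (\<lambda>n. qle (x \<cdot> n) (qadd (y \<cdot> n) (qhalf n)))"

definition real_of_rat :: "tm \<Rightarrow> tm" where "real_of_rat q = Con (CK N N) \<cdot> q"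
definition real0 :: tm where "real0 = real_of_rat q0"
definition real1 :: tm where "real1 = real_of_rat q1"

text \<open>
  \<open>|x - y| < 2\<^sup>-\<^sup>k\<close>: the real \<open>|x - y|\<close> is represented by the sequence
  \<open>|x\<^sub>n\<^sub>+\<^sub>1 - y\<^sub>n\<^sub>+\<^sub>1|\<close>, and \<open>u < v\<close> is the negation of \<open>v \<le> u\<close>.
\<close>

definition real_near :: "tm \<Rightarrow> tm \<Rightarrow> tm \<Rightarrow> fm" where
  "real_near x y k = fex N (\<lambda>n.
     qless (qadd (qdist (x \<cdot> suc n) (y \<cdot> suc n)) (qhalf n)) (qhalf k))"

definition in_unit :: "tm \<Rightarrow> fm" where
  "in_unit x = (is_real x \<^bold>\<and> real_le real0 x \<^bold>\<and> real_le x real1)"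

definition real_fun :: "tm \<Rightarrow> fm" where
  "real_fun f = fall T1 (\<lambda>x. fall T1 (\<lambda>y. is_real x \<^bold>\<longrightarrow> is_real y \<^bold>\<longrightarrow> real_eq x y \<^bold>\<longrightarrow>
     is_real (f \<cdot> x) \<^bold>\<and> is_real (f \<cdot> y) \<^bold>\<and> real_eq (f \<cdot> x) (f \<cdot> y)))"

definition in_C :: "tm \<Rightarrow> fm" where
  "in_C f = (real_fun f \<^bold>\<and>
     fall T1 (\<lambda>x. in_unit x \<^bold>\<longrightarrow> fall N (\<lambda>k. fex N (\<lambda>m. fall T1 (\<lambda>y. in_unit y \<^bold>\<longrightarrow>
       real_near x y m \<^bold>\<longrightarrow> real_near (f \<cdot> x) (f \<cdot> y) k)))))"

definition in_Cbar :: "tm \<Rightarrow> fm" where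
  "in_Cbar f = (in_C f \<^bold>\<and> real_le real0 (f \<cdot> real0) \<^bold>\<and> real_le (f \<cdot> real1) real0)"

definition exists2 :: fm where
  "exists2 = fex T2 (\<lambda>\<phi>. fall T1 (\<lambda>g. fex N (\<lambda>x. g \<cdot> x \<doteq> zro) \<^bold>\<longleftrightarrow> \<phi> \<cdot> g \<doteq> zro))"

definition Pi01_TRANS :: fm where
  "Pi01_TRANS = fall_st T1 (\<lambda>f.
     fall_st N (\<lambda>n. f \<cdot> n \<doteq> zro) \<^bold>\<longrightarrow> fall N (\<lambda>n. f \<cdot> n \<doteq> zro))"

definition IVT_star :: fm where
  "IVT_star = fall_st (T1 \<rightarrow> T1) (\<lambda>f. relst (in_Cbar f) \<^bold>\<longrightarrow>
     fex_st T1 (\<lambda>x. in_unit x \<^bold>\<and> real_eq (f \<cdot> x) real0))"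

text \<open>As \<open>f\<close> is defined on all reals, the zero is not required to lie in \<open>[0, 1]\<close>.\<close>

definition UIVT :: fm where
  "UIVT = fex ((T1 \<rightarrow> T1) \<rightarrow> T1) (\<lambda>\<Phi>. fall (T1 \<rightarrow> T1) (\<lambda>f. in_Cbar f \<^bold>\<longrightarrow>
     is_real (\<Phi> \<cdot> f) \<^bold>\<and> real_eq (f \<cdot> (\<Phi> \<cdot> f)) real0))"

end

theory Submission
  imports Defs "HOL-Library.Countable" "HOL-Computational_Algebra.Fraction_Field"
begin

text \<open>
  By Henkin completeness it suffices to establish the equivalences in every term model.  Its numbers
  satisfy quantifier-free induction, hence form a discretely ordered semiring, and this embeds into
  an ordered field in which rational codes have values.

  Given \<open>(\<exists>\<^sup>2)\<close>, choice yields a functional that finds zeros of sequences; by transfer there is a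
  standard one, which gives \<open>\<Pi>\<^sup>0\<^sub>1\<close>-transfer.  Conversely, \<open>\<Pi>\<^sup>0\<^sub>1\<close>-transfer and \<open>HAC\<close> bound the search
  for a zero of a standard sequence, so the constant \<open>\<Xi>\<^sub>0\<close> decides it, and transfer applies to \<open>\<Xi>\<^sub>0\<close>.
  With \<open>(\<exists>\<^sup>2)\<close> the sign of \<open>f\<close> at a rational is decidable and bisection computes a root, both among
  all objects and among the standard ones.  \<open>IVT\<^sup>*\<close> for constant functions already gives transfer.
  Finally, a root of \<open>x \<mapsto> max (-\<epsilon>) (min \<epsilon> (a - x))\<close> given as a functional of \<open>\<epsilon>\<close> is near \<open>a\<close> iff \<open>\<epsilon> > 0\<close>,
  for \<open>a\<close> chosen away from the root supplied for \<open>\<epsilon> = 0\<close>; this decides whether \<open>\<epsilon> = 0\<close>.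
\<close>

section \<open>Syntax\<close>

text \<open>The theory is weak in three ways, and each shapes the proof. Induction covers
  quantifier-free formulas only: orderings and invariants of recursions are stated as equations
  between numbers, proved by induction in that form, and only then read as inequalities in the
  field, where one can calculate. Transfer allows no parameters: it cannot be applied to a
  functional obtained from choice, so the constant \<open>\<Xi>\<^sub>0\<close>, which agrees with
  it on standard inputs, has to stand in for it. Finally, a functional on functions is only known to
  respect extensional equality, so the ramp for \<epsilon> = 0 must be one and the same functional
  for all data, not merely represent the same real function.

  For this last reason, too, values of terms are classes modulo extensional equality; the axioms for
  combinators and recursion then become plain equations.\<close>

definition lc :: "tm \<Rightarrow> bool" where
  "lc t \<longleftrightarrow> (\<forall>k us. open_tm k us t = t)"

lemma wt_open_id: "wt sp \<Gamma> t \<tau> \<Longrightarrow> length \<Gamma> \<le> k \<Longrightarrow> open_tm k us t = t"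
  by (induction rule: wt.induct) auto

lemma wt_lc: "wt sp [] t \<tau> \<Longrightarrow> lc t"
  by (simp add: lc_def wt_open_id)

lemma wf_open_id: "wf sp \<Gamma> A \<Longrightarrow> length \<Gamma> \<le> k \<Longrightarrow> open_fm k us A = A"
  by (induction A arbitrary: \<Gamma> k) (auto simp: wt_open_id)

lemma wt_weaken: "wt sp \<Gamma> t \<tau> \<Longrightarrow> wt sp (\<Gamma> @ \<Delta>) t \<tau>"
proof (induction rule: wt.induct)
  case (2 i \<Gamma>)
  then show ?case using wt.intros(2)[of i "\<Gamma> @ \<Delta>" sp] by (simp add: nth_append)
qed (auto intro: wt.intros)

lemma wf_weaken: "wf sp \<Gamma> A \<Longrightarrow> wf sp (\<Gamma> @ \<Delta>) A"
  by (induction A arbitrary: \<Gamma>) (auto simp: wt_weaken simp flip: append_Cons)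

lemma wt_open:
  assumes "wt sp (\<Gamma> @ \<Delta>) t \<tau>" "list_all2 (wt sp []) us \<Delta>"
  shows "wt sp \<Gamma> (open_tm (length \<Gamma>) us t) \<tau>"
  using assms
proof (induction "\<Gamma> @ \<Delta>" t \<tau> rule: wt.induct)
  case (2 i)
  have l: "length us = length \<Delta>" using 2(2) by (rule list_all2_lengthD)
  show ?case
  proof (cases "i < length \<Gamma>")
    case True
    then show ?thesis using wt.intros(2)[of i \<Gamma> sp] by (simp add: nth_append)
  next
    case False
    then have "wt sp [] (us ! (i - length \<Gamma>)) (\<Delta> ! (i - length \<Gamma>))"
      using 2 l by (auto simp: list_all2_conv_all_nth)
    then have "wt sp \<Gamma> (us ! (i - length \<Gamma>)) (\<Delta> ! (i - length \<Gamma>))"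
      using wt_weaken[of sp "[]" _ _ \<Gamma>] by simp
    then show ?thesis using False 2 l by (simp add: nth_append)
  qed
qed (auto intro: wt.intros)

lemma wf_open:
  "wf sp (\<Gamma> @ \<Delta>) A \<Longrightarrow> list_all2 (wt sp []) us \<Delta> \<Longrightarrow> wf sp \<Gamma> (open_fm (length \<Gamma>) us A)"
proof (induction A arbitrary: \<Gamma>)
  case (All \<sigma> A)
  then show ?case using All.IH[of "\<sigma> # \<Gamma>"] by simp
next
  case (BAll t A)
  then show ?case using BAll.IH[of "N # \<Gamma>"] by (auto intro: wt_open)
qed (auto intro: wt_open)

lemma wf_inst: "wf sp \<Delta> A \<Longrightarrow> list_all2 (wt sp []) us \<Delta> \<Longrightarrow> wf sp [] (inst A us)"
  using wf_open[of sp "[]"] by simp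

lemma wt_close: "wt sp \<Gamma> t \<tau> \<Longrightarrow> wt sp (\<Gamma> @ [\<sigma>]) (close_tm (length \<Gamma>) x \<sigma> t) \<tau>"
proof (induction rule: wt.induct)
  case (1 \<Gamma> y \<tau>)
  then show ?case using wt.intros(2)[of "length \<Gamma>" "\<Gamma> @ [\<sigma>]" sp] by (auto intro: wt.intros)
next
  case (2 i \<Gamma>)
  then show ?case using wt.intros(2)[of i "\<Gamma> @ [\<sigma>]" sp] by (simp add: nth_append)
qed (auto intro: wt.intros)

lemma wf_close: "wf sp \<Gamma> A \<Longrightarrow> wf sp (\<Gamma> @ [\<sigma>]) (close_fm (length \<Gamma>) x \<sigma> A)"
proof (induction A arbitrary: \<Gamma>)
  case (All \<tau> A)
  then show ?case using All.IH[of "\<tau> # \<Gamma>"] by simp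
next
  case (BAll t A)
  then show ?case using BAll.IH[of "N # \<Gamma>"] by (simp add: wt_close)
qed (auto simp: wt_close)

lemma close_open_tm: "x \<notin> names_tm t \<Longrightarrow> close_tm k x \<sigma> (open_tm k [Free x \<sigma>] t) = t"
  by (induction t) auto

lemma close_open_fm: "x \<notin> names A \<Longrightarrow> close_fm k x \<sigma> (open_fm k [Free x \<sigma>] A) = A"
  by (induction A arbitrary: k) (auto simp: close_open_tm)

lemma names_zero [simp]: "names_tm (zero \<tau>) = {}"
  by (induction \<tau>) auto

lemma wt_zero: "wt sp [] (zero \<tau>) \<tau>"
proof (induction \<tau>)
  case N
  then show ?case using wt.intros(3)[of sp CZero] by simp
next
  case (Fn \<sigma> \<tau>)
  then show ?case using wt.intros(3)[of sp "CK \<tau> \<sigma>"] by (auto intro: wt.intros(4))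
next
  case (Seq \<sigma>)
  then show ?case using wt.intros(3)[of sp "CNil \<sigma>"] by simp
qed

lemma lc_simps [simp]:
  "lc (Free x \<sigma>)" "lc (Con c)" "lc (zero \<tau>)" "\<not> lc (Bound i)" "lc (s \<cdot> t) \<longleftrightarrow> lc s \<and> lc t"
proof -
  show "\<not> lc (Bound i)"
    unfolding lc_def by (auto intro!: exI[of _ i] exI[of _ "[Con CZero]"])
  show "lc (zero \<tau>)" by (rule wt_lc[OF wt_zero])
qed (auto simp: lc_def)

lemma names_open_closed_tm: "\<forall>u\<in>set us. names_tm u = {} \<Longrightarrow> names_tm (open_tm k us t) = names_tm t"
proof (induction t)
  case (Bound i)
  then have "names_tm (us ! (i - k)) = {}" if "k \<le> i" "i < k + length us"
    using that by simp
  then show ?case by simp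
qed auto

lemma names_open_closed: "\<forall>u\<in>set us. names_tm u = {} \<Longrightarrow> names (open_fm k us A) = names A"
  by (induction A arbitrary: k) (auto simp: names_open_closed_tm)

lemma finite_names_tm [simp]: "finite (names_tm t)"
  by (induction t) auto

lemma finite_names [simp]: "finite (names A)"
  by (induction A) auto

lemma fresh: "finite X \<Longrightarrow> fresh X \<notin> X"
  unfolding fresh_def by (metis Max_ge Suc_n_not_le_n finite_insert insertI2)

text \<open>The tail \<open>us\<close> goes in first, and the later opening at \<open>k\<close> must
  not touch it; local closedness of \<open>us\<close> guarantees this.\<close>

lemma open_append_gen_tm:
  "list_all lc us \<Longrightarrow> open_tm k (y # us) t = open_tm k [y] (open_tm (Suc k) us t)"
proof (induction t)
  case (Bound i)
  show ?case
  proof (cases "k < i \<and> i - Suc k < length us")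
    case True
    then have "open_tm k [y] (us ! (i - Suc k)) = us ! (i - Suc k)"
      using Bound by (simp add: list_all_length lc_def)
    then show ?thesis using True by (simp add: nth_Cons Suc_diff_Suc [symmetric])
  qed auto
qed auto

lemma open_append:
  "list_all lc us \<Longrightarrow> open_fm k (y # us) A = open_fm k [y] (open_fm (Suc k) us A)"
  by (induction A arbitrary: k) (auto intro: open_append_gen_tm)

text \<open>Surplus terms hit no index. So a one-argument instance counts as a simultaneous
  instantiation by a longer list, as \<open>RF\<close> requires.\<close>

lemma open_fm_single_wf: "wf sp [\<sigma>] A \<Longrightarrow> open_fm 0 (u # us) A = open_fm 0 [u] A"
proof -
  have t: "wt sp \<Gamma> t \<tau> \<Longrightarrow> length \<Gamma> \<le> Suc k \<Longrightarrow> open_tm k (u # us) t = open_tm k [u] t" for \<Gamma> t \<tau> k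
    by (induction rule: wt.induct) auto
  have "wf sp \<Gamma> A \<Longrightarrow> length \<Gamma> \<le> Suc k \<Longrightarrow> open_fm k (u # us) A = open_fm k [u] A" for \<Gamma> k
    by (induction A arbitrary: \<Gamma> k) (auto simp: t)
  then show "wf sp [\<sigma>] A \<Longrightarrow> open_fm 0 (u # us) A = open_fm 0 [u] A" by fastforce
qed

subsection \<open>Binders as functions\<close>

text \<open>
  \<open>RF n F\<close> and \<open>RT n f\<close>: the function of \<open>n\<close> locally closed terms is uniform, that is, it is the
  simultaneous instantiation of one formula (term) with loose indices.  For uniform functions the
  binders do not depend on the choice of the bound name.
\<close>

definition RF :: "nat \<Rightarrow> (tm list \<Rightarrow> fm) \<Rightarrow> bool" where
  "RF n F \<longleftrightarrow> (\<exists>A. \<forall>us. length us = n \<longrightarrow> list_all lc us \<longrightarrow> F us = open_fm 0 us A)"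

definition RT :: "nat \<Rightarrow> (tm list \<Rightarrow> tm) \<Rightarrow> bool" where
  "RT n f \<longleftrightarrow> (\<exists>t. \<forall>us. length us = n \<longrightarrow> list_all lc us \<longrightarrow> lc (f us) \<and> f us = open_tm 0 us t)"

lemma RT_const [simp]: "lc t \<Longrightarrow> RT n (\<lambda>us. t)"
  unfolding RT_def by (metis lc_def)

lemma RT_nth: "i < n \<Longrightarrow> RT n (\<lambda>us. us ! i)"
  unfolding RT_def by (rule exI[of _ "Bound i"]) (auto simp: list_all_length)

lemma RT_cong: "(\<And>us. length us = n \<Longrightarrow> f us = g us) \<Longrightarrow> RT n f = RT n g"
  unfolding RT_def by auto

text \<open>Every binder pushes its variable to the front of the list, so a variable bound
  \<open>i\<close> levels further out is reached by \<open>i\<close> tails.\<close>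

lemma RT_var [simp]:
  "RT (Suc n) hd"
  "RT (Suc (Suc n)) (\<lambda>us. hd (tl us))"
  "RT (Suc (Suc (Suc n))) (\<lambda>us. hd (tl (tl us)))"
  "RT (Suc (Suc (Suc (Suc n)))) (\<lambda>us. hd (tl (tl (tl us))))"
  "RT (Suc (Suc (Suc (Suc (Suc n))))) (\<lambda>us. hd (tl (tl (tl (tl us)))))"
  subgoal using RT_nth[of 0 "Suc n"] by (subst RT_cong[where g="\<lambda>us. us ! 0"]) (auto simp: length_Suc_conv)
  subgoal using RT_nth[of 1 "Suc (Suc n)"]
    by (subst RT_cong[where g="\<lambda>us. us ! 1"]) (auto simp: length_Suc_conv)
  subgoal using RT_nth[of 2 "Suc (Suc (Suc n))"]
    by (subst RT_cong[where g="\<lambda>us. us ! 2"]) (auto simp: length_Suc_conv)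
  subgoal using RT_nth[of 3 "Suc (Suc (Suc (Suc n)))"]
    by (subst RT_cong[where g="\<lambda>us. us ! 3"]) (auto simp: length_Suc_conv numeral_3_eq_3)
  subgoal using RT_nth[of 4 "Suc (Suc (Suc (Suc (Suc n))))"]
    by (subst RT_cong[where g="\<lambda>us. us ! 4"]) (auto simp: length_Suc_conv eval_nat_numeral)
  done

lemma RT_App [simp]:
  assumes "RT n f" "RT n g" shows "RT n (\<lambda>us. f us \<cdot> g us)"
proof -
  obtain s t where "\<forall>us. length us = n \<longrightarrow> list_all lc us \<longrightarrow> lc (f us) \<and> f us = open_tm 0 us s"
    "\<forall>us. length us = n \<longrightarrow> list_all lc us \<longrightarrow> lc (g us) \<and> g us = open_tm 0 us t"
    using assms unfolding RT_def by blast
  then show ?thesis unfolding RT_def by (intro exI[of _ "s \<cdot> t"]) auto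
qed

lemma RF_Fls [simp]: "RF n (\<lambda>us. Fls)"
  unfolding RF_def by (rule exI[of _ Fls]) auto

lemma RF_Eq [simp]:
  assumes "RT n f" "RT n g" shows "RF n (\<lambda>us. f us \<doteq> g us)"
proof -
  obtain s t where "\<forall>us. length us = n \<longrightarrow> list_all lc us \<longrightarrow> lc (f us) \<and> f us = open_tm 0 us s"
    "\<forall>us. length us = n \<longrightarrow> list_all lc us \<longrightarrow> lc (g us) \<and> g us = open_tm 0 us t"
    using assms unfolding RT_def by blast
  then show ?thesis unfolding RF_def by (intro exI[of _ "s \<doteq> t"]) auto
qed

lemma RF_St [simp]: "RT n f \<Longrightarrow> RF n (\<lambda>us. St \<tau> (f us))"
  unfolding RF_def RT_def by (metis open_fm.simps(3))

lemma RF_Imp [simp]: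
  assumes "RF n F" "RF n G" shows "RF n (\<lambda>us. F us \<^bold>\<longrightarrow> G us)"
proof -
  obtain A B where "\<forall>us. length us = n \<longrightarrow> list_all lc us \<longrightarrow> F us = open_fm 0 us A"
    "\<forall>us. length us = n \<longrightarrow> list_all lc us \<longrightarrow> G us = open_fm 0 us B"
    using assms unfolding RF_def by blast
  then show ?thesis unfolding RF_def by (intro exI[of _ "A \<^bold>\<longrightarrow> B"]) auto
qed

text \<open>The closed term \<open>zero \<sigma>\<close> contributes no names, so the name chosen by
  \<open>fbody\<close> is fresh for \<open>A\<close> itself, and closing undoes opening. Every
  evaluation of a binder below rests on this.\<close>

lemma fbody_eq:
  assumes "\<And>u. lc u \<Longrightarrow> B u = open_fm 0 [u] A"
  shows "fbody \<sigma> B = A"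
proof -
  have "names (B (zero \<sigma>)) = names A"
    using assms[of "zero \<sigma>"] by (simp add: names_open_closed)
  then have "fresh (names (B (zero \<sigma>))) \<notin> names A" using fresh by simp
  then show ?thesis unfolding fbody_def Let_def using assms by (simp add: close_open_fm)
qed

lemma RF_fbody:
  assumes "RF (Suc n) (\<lambda>us. B (hd us) (tl us))"
  obtains A where "\<And>us. length us = n \<Longrightarrow> list_all lc us \<Longrightarrow> fbody \<sigma> (\<lambda>y. B y us) = open_fm 1 us A"
proof -
  obtain A where A: "\<And>us. length us = Suc n \<Longrightarrow> list_all lc us \<Longrightarrow> B (hd us) (tl us) = open_fm 0 us A"
    using assms unfolding RF_def by blast
  have "fbody \<sigma> (\<lambda>y. B y us) = open_fm 1 us A" if "length us = n" "list_all lc us" for us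
  proof (rule fbody_eq)
    fix u assume "lc u"
    then show "B u us = open_fm 0 [u] (open_fm 1 us A)"
      using A[of "u # us"] that open_append[of us 0 u A] by simp
  qed
  then show ?thesis by (rule that)
qed

lemma RF_fall [simp]:
  assumes "RF (Suc n) (\<lambda>us. B (hd us) (tl us))"
  shows "RF n (\<lambda>us. fall \<sigma> (\<lambda>y. B y us))"
  by (rule RF_fbody[OF assms, of \<sigma>]) (auto simp: RF_def fall_def intro!: exI[of _ "All \<sigma> _"])

lemma RF_fball [simp]:
  assumes "RT n f" "RF (Suc n) (\<lambda>us. B (hd us) (tl us))"
  shows "RF n (\<lambda>us. fball (f us) (\<lambda>y. B y us))"
proof -
  obtain t where t: "\<forall>us. length us = n \<longrightarrow> list_all lc us \<longrightarrow> lc (f us) \<and> f us = open_tm 0 us t"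
    using assms(1) unfolding RT_def by blast
  show ?thesis
    by (rule RF_fbody[OF assms(2), of N]) (auto simp: RF_def fball_def t intro!: exI[of _ "BAll t _"])
qed

lemma RF_fex [simp]:
  "RF (Suc n) (\<lambda>us. B (hd us) (tl us)) \<Longrightarrow> RF n (\<lambda>us. fex \<sigma> (\<lambda>y. B y us))"
  unfolding fex_def by simp

lemma RF_fall_st [simp]:
  "RF (Suc n) (\<lambda>us. B (hd us) (tl us)) \<Longrightarrow> RF n (\<lambda>us. fall_st \<sigma> (\<lambda>y. B y us))"
  unfolding fall_st_def by simp

lemma RF_fex_st [simp]:
  "RF (Suc n) (\<lambda>us. B (hd us) (tl us)) \<Longrightarrow> RF n (\<lambda>us. fex_st \<sigma> (\<lambda>y. B y us))"
  unfolding fex_st_def by simp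

lemma RF_relst [simp]: "RF n F \<Longrightarrow> RF n (\<lambda>us. relst (F us))"
proof -
  have "relst (open_fm k us A) = open_fm k us (relst A)" for k us A
    by (induction A arbitrary: k) auto
  then show "RF n F \<Longrightarrow> RF n (\<lambda>us. relst (F us))" unfolding RF_def by metis
qed

text \<open>Opening with \<open>map Bound [1..<Suc n]\<close> renumbers each index \<open>i\<close>
  to \<open>i + 1\<close>, which makes room for the new first argument. Indices from
  \<open>n\<close> on cannot occur, since the opened term is locally closed.\<close>

lemma RT_tl:
  assumes "RT n f" shows "RT (Suc n) (\<lambda>us. f (tl us))"
proof -
  obtain t where t: "\<And>us. length us = n \<Longrightarrow> list_all lc us \<Longrightarrow> lc (f us) \<and> f us = open_tm 0 us t"
    using assms unfolding RT_def by blast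
  have "lc (open_tm 0 us u) \<Longrightarrow>
      open_tm 0 us u = open_tm 0 (y # us) (open_tm 0 (map Bound [1..<Suc n]) u)"
    if "length us = n" for us y u
  proof (induction u)
    case (Bound i)
    then show ?case using that by (cases "i < n") (auto simp del: upt_Suc)
  qed auto
  then have "f (tl us) = open_tm 0 us (open_tm 0 (map Bound [1..<Suc n]) t)"
    if "length us = Suc n" "list_all lc us" for us
    using that t[of "tl us"] by (cases us) auto
  moreover have "lc (f (tl us))" if "length us = Suc n" "list_all lc us" for us
    using that t[of "tl us"] by (cases us) auto
  ultimately show ?thesis unfolding RT_def by blast
qed

lemma RT_tls:
  assumes "RT n f"
  shows "RT (Suc n) (\<lambda>us. f (tl us))" "RT (Suc (Suc n)) (\<lambda>us. f (tl (tl us)))"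
    "RT (Suc (Suc (Suc n))) (\<lambda>us. f (tl (tl (tl us))))"
    "RT (Suc (Suc (Suc (Suc n)))) (\<lambda>us. f (tl (tl (tl (tl us)))))"
proof -
  show 1: "RT (Suc n) (\<lambda>us. f (tl us))" by (rule RT_tl[OF assms])
  show 2: "RT (Suc (Suc n)) (\<lambda>us. f (tl (tl us)))" by (rule RT_tl[OF 1])
  show 3: "RT (Suc (Suc (Suc n))) (\<lambda>us. f (tl (tl (tl us))))" by (rule RT_tl[OF 2])
  show "RT (Suc (Suc (Suc (Suc n)))) (\<lambda>us. f (tl (tl (tl (tl us)))))" by (rule RT_tl[OF 3])
qed

lemma RF_eqf [simp]: "RT n f \<Longrightarrow> RT n g \<Longrightarrow> RF n (\<lambda>us. eqf \<tau> (f us) (g us))"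
  by (induction \<tau> arbitrary: n f g) (auto simp: RT_tl)

section \<open>Completeness\<close>

instance ty :: countable by countable_datatype
instance con :: countable by countable_datatype
instance tm :: countable by countable_datatype
instance fm :: countable by countable_datatype

primrec depth :: "fm \<Rightarrow> nat" where
  "depth Fls = 0"
| "depth (s \<doteq> t) = 0"
| "depth (St \<tau> t) = 0"
| "depth (A \<^bold>\<longrightarrow> B) = Suc (depth A + depth B)"
| "depth (All \<sigma> A) = Suc (depth A)"
| "depth (BAll s A) = Suc (depth A)"

lemma depth_open [simp]: "depth (open_fm k us A) = depth A"
  by (induction A arbitrary: k) auto

text \<open>
  Truth in the term structure with atomic truth values \<open>at\<close>.  It is defined on all formulas,
  well-formed or not, so that its evaluation has no side conditions.
\<close>

function truth :: "spec \<Rightarrow> (fm \<Rightarrow> bool) \<Rightarrow> fm \<Rightarrow> bool" where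
  "truth sp at Fls = False"
| "truth sp at (s \<doteq> t) = at (s \<doteq> t)"
| "truth sp at (St \<tau> t) = at (St \<tau> t)"
| "truth sp at (A \<^bold>\<longrightarrow> B) = (truth sp at A \<longrightarrow> truth sp at B)"
| "truth sp at (All \<sigma> A) = (\<forall>t. wt sp [] t \<sigma> \<longrightarrow> truth sp at (inst A [t]))"
| "truth sp at (BAll s A) = (\<forall>t. wt sp [] t N \<longrightarrow> at (less t s) \<longrightarrow> truth sp at (inst A [t]))"
  by pat_completeness auto
termination
  by (relation "measure (\<lambda>(sp, at, A). depth A)") auto

text \<open>Together with \<open>tyof\<close> this is a computable form of typing in the empty
  context, so that the simplifier can discharge typing conditions.\<close>

fun ok :: "spec \<Rightarrow> tm \<Rightarrow> bool" where
  "ok sp (Free x \<tau>) = True"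
| "ok sp (Bound i) = False"
| "ok sp (Con c) = in_lang sp c"
| "ok sp (s \<cdot> t) = (ok sp s \<and> ok sp t \<and> (case tyof s of \<sigma> \<rightarrow> \<tau> \<Rightarrow> \<sigma> = tyof t | _ \<Rightarrow> False))"

lemma wt_iff: "wt sp [] t \<tau> \<longleftrightarrow> ok sp t \<and> tyof t = \<tau>"
proof
  have "wt sp \<Gamma> t \<tau> \<Longrightarrow> \<Gamma> = [] \<Longrightarrow> ok sp t \<and> tyof t = \<tau>" for \<Gamma>
    by (induction rule: wt.induct) auto
  then show "wt sp [] t \<tau> \<Longrightarrow> ok sp t \<and> tyof t = \<tau>" by simp
  show "ok sp t \<and> tyof t = \<tau> \<Longrightarrow> wt sp [] t \<tau>"
  proof (induction t arbitrary: \<tau>)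
    case (App s t)
    then obtain \<sigma> where "tyof s = \<sigma> \<rightarrow> \<tau>" "tyof t = \<sigma>" by (auto split: ty.splits)
    then show ?case using App by (auto intro: wt.intros(4))
  qed (auto intro: wt.intros)
qed

lemma ok_lc: "ok sp t \<Longrightarrow> lc t"
  using wt_iff wt_lc by blast

lemma tyof_bracket [simp]: "tyof (bracket x \<sigma> t) = \<sigma> \<rightarrow> tyof t"
  by (induction t) auto

lemma ok_bracket [simp]: "ok sp t \<Longrightarrow> ok sp (bracket x \<sigma> t)"
  by (induction t) (auto split: ty.splits)

lemma ok_zero [simp]: "ok sp (zero \<tau>)" and tyof_zero [simp]: "tyof (zero \<tau>) = \<tau>"
  using wt_zero[of sp \<tau>] by (auto simp: wt_iff)

lemma tyof_lam: "(\<And>x. tyof (B (Free x \<sigma>)) = \<tau>) \<Longrightarrow> tyof (lam \<sigma> B) = \<sigma> \<rightarrow> \<tau>"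
  by (simp add: lam_def Let_def)

lemma ok_lam: "(\<And>x. ok sp (B (Free x \<sigma>))) \<Longrightarrow> ok sp (lam \<sigma> B)"
  by (simp add: lam_def Let_def)

lemma tyof_arith [simp]:
  "tyof tpred = N \<rightarrow> N" "tyof tadd = N \<rightarrow> N \<rightarrow> N" "tyof tmonus = N \<rightarrow> N \<rightarrow> N"
  "tyof tmult = N \<rightarrow> N \<rightarrow> N" "tyof texp2 = N \<rightarrow> N" "tyof ttri = N \<rightarrow> N"
  "tyof tpair = N \<rightarrow> N \<rightarrow> N" "tyof troot = N \<rightarrow> N" "tyof tfst = N \<rightarrow> N" "tyof tsnd = N \<rightarrow> N"
proof -
  show [simp]: "tyof tpred = N \<rightarrow> N" "tyof tadd = N \<rightarrow> N \<rightarrow> N"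
    by (simp_all add: tpred_def tadd_def tyof_lam)
  show [simp]: "tyof tmonus = N \<rightarrow> N \<rightarrow> N" "tyof tmult = N \<rightarrow> N \<rightarrow> N" "tyof texp2 = N \<rightarrow> N"
    "tyof ttri = N \<rightarrow> N"
    by (simp_all add: tmonus_def tmult_def texp2_def ttri_def tyof_lam)
  show [simp]: "tyof tpair = N \<rightarrow> N \<rightarrow> N" "tyof troot = N \<rightarrow> N"
    by (simp_all add: tpair_def troot_def tyof_lam)
  show [simp]: "tyof tfst = N \<rightarrow> N" by (simp add: tfst_def tyof_lam)
  show [simp]: "tyof tsnd = N \<rightarrow> N" by (simp add: tsnd_def tyof_lam)
qed

lemma ok_arith [simp]:
  "ok sp tpred" "ok sp tadd" "ok sp tmonus" "ok sp tmult" "ok sp texp2" "ok sp ttri"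
  "ok sp tpair" "ok sp troot" "ok sp tfst" "ok sp tsnd"
proof -
  show [simp]: "ok sp tpred" "ok sp tadd"
    by (auto simp: tpred_def tadd_def tyof_lam intro!: ok_lam)
  show [simp]: "ok sp tmonus" "ok sp tmult" "ok sp texp2" "ok sp ttri"
    by (auto simp: tmonus_def tmult_def texp2_def ttri_def tyof_lam intro!: ok_lam)
  show [simp]: "ok sp tpair" "ok sp troot"
    by (auto simp: tpair_def troot_def tyof_lam intro!: ok_lam)
  show [simp]: "ok sp tfst" by (auto simp: tfst_def tyof_lam intro!: ok_lam)
  show [simp]: "ok sp tsnd" by (auto simp: tsnd_def tyof_lam intro!: ok_lam)
qed

lemmas lc_arith [simp] = ok_arith[THEN ok_lc]

section \<open>Derived rules of the calculus\<close>

locale proof_system =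
  fixes sp :: spec and T :: "fm set"
begin

abbreviation fwf :: "fm \<Rightarrow> bool" where "fwf A \<equiv> wf sp [] A"
abbreviation pv :: "fm \<Rightarrow> bool" where "pv A \<equiv> prv sp T {} A"
abbreviation pr :: "fm set \<Rightarrow> fm \<Rightarrow> bool" where "pr H A \<equiv> prv sp T H A"

lemma hyp: "A \<in> H \<Longrightarrow> fwf A \<Longrightarrow> pr H A"
  by (rule prv.Hyp)

lemma mp: "pv (A \<^bold>\<longrightarrow> B) \<Longrightarrow> pv A \<Longrightarrow> pv B"
  by (rule prv.ImpE)

lemma detach: "(A \<^bold>\<longrightarrow> B) \<in> H \<Longrightarrow> A \<in> H \<Longrightarrow> fwf A \<Longrightarrow> fwf B \<Longrightarrow> pr H B"
  by (rule prv.ImpE[OF hyp hyp]) auto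

lemma pv_K: "fwf A \<Longrightarrow> fwf B \<Longrightarrow> pv (A \<^bold>\<longrightarrow> B \<^bold>\<longrightarrow> A)"
  by (rule prv.ImpI, simp, rule prv.ImpI, simp, rule hyp) auto

lemma pv_S:
  assumes [simp]: "fwf A" "fwf B" "fwf C"
  shows "pv ((A \<^bold>\<longrightarrow> B \<^bold>\<longrightarrow> C) \<^bold>\<longrightarrow> (A \<^bold>\<longrightarrow> B) \<^bold>\<longrightarrow> A \<^bold>\<longrightarrow> C)"
proof -
  let ?H = "{A, A \<^bold>\<longrightarrow> B, A \<^bold>\<longrightarrow> B \<^bold>\<longrightarrow> C}"
  have "pr ?H (B \<^bold>\<longrightarrow> C)" "pr ?H B"
    by (rule detach[of A], simp_all)+
  then have "pr ?H C" by (rule prv.ImpE)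
  then show ?thesis by (intro prv.ImpI) auto
qed

lemma pv_refl: "fwf A \<Longrightarrow> pv (A \<^bold>\<longrightarrow> A)"
  by (rule prv.ImpI, simp, rule hyp) auto

text \<open>The stages of the Henkin construction are single formulas, so reasoning from a stage
  \<open>C\<close> takes the form of theorems with premise \<open>C\<close>.\<close>

lemma imp_mp:
  "fwf C \<Longrightarrow> fwf A \<Longrightarrow> fwf B \<Longrightarrow> pv (C \<^bold>\<longrightarrow> A \<^bold>\<longrightarrow> B) \<Longrightarrow> pv (C \<^bold>\<longrightarrow> A) \<Longrightarrow> pv (C \<^bold>\<longrightarrow> B)"
  by (rule mp[OF mp[OF pv_S]])

lemma imp_weak: "fwf C \<Longrightarrow> fwf A \<Longrightarrow> pv A \<Longrightarrow> pv (C \<^bold>\<longrightarrow> A)"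
  by (rule mp[OF pv_K])

lemma imp_trans: "fwf A \<Longrightarrow> fwf B \<Longrightarrow> fwf C \<Longrightarrow> pv (A \<^bold>\<longrightarrow> B) \<Longrightarrow> pv (B \<^bold>\<longrightarrow> C) \<Longrightarrow> pv (A \<^bold>\<longrightarrow> C)"
  by (rule imp_mp[of A B C]) (simp_all add: imp_weak)

lemma imp_ccontr: "fwf A \<Longrightarrow> fwf B \<Longrightarrow> pr {\<^bold>\<not> B, A} Fls \<Longrightarrow> pv (A \<^bold>\<longrightarrow> B)"
  by (rule prv.ImpI, simp, rule prv.Classical) auto

lemma imp_classical: "fwf C \<Longrightarrow> fwf A \<Longrightarrow> pv (C \<^bold>\<longrightarrow> \<^bold>\<not> \<^bold>\<not> A) \<Longrightarrow> pv (C \<^bold>\<longrightarrow> A)"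
proof (rule imp_trans[of C "\<^bold>\<not> \<^bold>\<not> A" A])
  assume [simp]: "fwf A"
  have "pr {\<^bold>\<not> A, \<^bold>\<not> \<^bold>\<not> A} Fls" by (rule detach[of "\<^bold>\<not> A"]) auto
  then show "pv (\<^bold>\<not> \<^bold>\<not> A \<^bold>\<longrightarrow> A)" by (rule imp_ccontr[rotated 2]) auto
qed auto

lemma imp_conjD1: "fwf C \<Longrightarrow> fwf A \<Longrightarrow> pv (C \<^bold>\<and> A \<^bold>\<longrightarrow> C)"
proof -
  assume [simp]: "fwf C" "fwf A"
  let ?H = "{\<^bold>\<not> C, C \<^bold>\<and> A}"
  have "pr (insert A (insert C ?H)) Fls" by (rule detach[of C]) auto
  then have "pr ?H (C \<^bold>\<longrightarrow> \<^bold>\<not> A)" by (intro prv.ImpI) auto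
  moreover have "pr ?H (C \<^bold>\<and> A)" by (rule hyp) auto
  ultimately have "pr ?H Fls" by (rule prv.ImpE[rotated])
  then show ?thesis by (rule imp_ccontr[rotated 2]) auto
qed

lemma imp_conjD2: "fwf C \<Longrightarrow> fwf A \<Longrightarrow> pv (C \<^bold>\<and> A \<^bold>\<longrightarrow> A)"
proof -
  assume [simp]: "fwf C" "fwf A"
  let ?H = "{\<^bold>\<not> A, C \<^bold>\<and> A}"
  have "pr (insert C ?H) (\<^bold>\<not> A)" by (rule hyp) auto
  then have "pr ?H (C \<^bold>\<longrightarrow> \<^bold>\<not> A)" by (rule prv.ImpI[rotated]) simp
  moreover have "pr ?H (C \<^bold>\<and> A)" by (rule hyp) auto
  ultimately have "pr ?H Fls" by (rule prv.ImpE[rotated])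
  then show ?thesis by (rule imp_ccontr[rotated 2]) auto
qed

lemma imp_conj_curry:
  assumes [simp]: "fwf C" "fwf A" "fwf B" and B: "pv (C \<^bold>\<and> A \<^bold>\<longrightarrow> B)"
  shows "pv (C \<^bold>\<longrightarrow> A \<^bold>\<longrightarrow> B)"
proof -
  let ?D = "C \<^bold>\<and> A"
  let ?H = "{C \<^bold>\<longrightarrow> \<^bold>\<not> A, A, C, ?D \<^bold>\<longrightarrow> B}"
  have "pr ?H (\<^bold>\<not> A)" by (rule detach[of C]) auto
  moreover have "pr ?H A" by (rule hyp) auto
  ultimately have "pr ?H Fls" by (rule prv.ImpE)
  then have "pr {A, C, ?D \<^bold>\<longrightarrow> B} ?D" by (intro prv.ImpI) auto
  moreover have "pr {A, C, ?D \<^bold>\<longrightarrow> B} (?D \<^bold>\<longrightarrow> B)" by (rule hyp) auto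
  ultimately have "pr {A, C, ?D \<^bold>\<longrightarrow> B} B" by (rule prv.ImpE[rotated])
  then have "pv ((?D \<^bold>\<longrightarrow> B) \<^bold>\<longrightarrow> C \<^bold>\<longrightarrow> A \<^bold>\<longrightarrow> B)" by (intro prv.ImpI) auto
  then show ?thesis using B by (rule mp)
qed

text \<open>Hypotheses are never added to a given derivation. The quantifier is introduced in the
  empty context, and the result enters a second derivation as a hypothesis, which is then discharged
  and cut away.\<close>

lemma imp_All:
  assumes C: "fwf C" and A: "wf sp [\<sigma>] A" and x: "x \<notin> names C" "x \<notin> names A"
    and pv: "pv (C \<^bold>\<longrightarrow> inst A [Free x \<sigma>])"
  shows "pv (C \<^bold>\<longrightarrow> All \<sigma> A)"
proof -
  have inst_C: "inst C us = C" for us using C by (simp add: wf_open_id)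
  have "pv (All \<sigma> (C \<^bold>\<longrightarrow> A))"
    using x pv by (intro prv.AllI[of x]) (auto simp: inst_C)
  define y where "y = fresh (names C \<union> names A)"
  have y: "y \<notin> names C" "y \<notin> names A"
    using fresh[of "names C \<union> names A"] by (auto simp: y_def)
  have wf: "fwf (All \<sigma> (C \<^bold>\<longrightarrow> A))"
  proof -
    have "wf sp ([] @ [\<sigma>]) C" using C by (rule wf_weaken)
    then show ?thesis using A by simp
  qed
  let ?H = "{C, All \<sigma> (C \<^bold>\<longrightarrow> A)}"
  have "pr ?H (inst (C \<^bold>\<longrightarrow> A) [Free y \<sigma>])"
    by (rule prv.AllE[OF hyp]) (use wf in \<open>auto intro: wt.intros\<close>)
  then have "pr ?H (inst A [Free y \<sigma>])"
    using prv.ImpE hyp[of C ?H] C by (auto simp: inst_C)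
  then have "pr ?H (All \<sigma> A)" using y by (intro prv.AllI[of y]) auto
  then have "pr {All \<sigma> (C \<^bold>\<longrightarrow> A)} (C \<^bold>\<longrightarrow> All \<sigma> A)"
    using C by (rule prv.ImpI[rotated])
  then have "pv (All \<sigma> (C \<^bold>\<longrightarrow> A) \<^bold>\<longrightarrow> C \<^bold>\<longrightarrow> All \<sigma> A)"
    using wf by (rule prv.ImpI[rotated])
  then show ?thesis using \<open>pv (All \<sigma> (C \<^bold>\<longrightarrow> A))\<close> by (rule mp)
qed

section \<open>The Henkin construction\<close>

definition consistent :: "fm \<Rightarrow> bool" where
  "consistent C \<longleftrightarrow> fwf C \<and> \<not> pv (C \<^bold>\<longrightarrow> Fls)"

text \<open>A rejected universal formula receives a fresh variable as its counterexample.\<close>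

definition extend :: "fm \<Rightarrow> fm \<Rightarrow> fm" where
  "extend F C =
     (if \<not> fwf F then C
      else if consistent (C \<^bold>\<and> F) then C \<^bold>\<and> F
      else (case F of All \<sigma> A \<Rightarrow> C \<^bold>\<and> \<^bold>\<not> inst A [Free (fresh (names C \<union> names A)) \<sigma>] | _ \<Rightarrow> C))"

lemma inconsistent_imp_neg:
  "fwf C \<Longrightarrow> fwf F \<Longrightarrow> \<not> consistent (C \<^bold>\<and> F) \<Longrightarrow> pv (C \<^bold>\<longrightarrow> \<^bold>\<not> F)"
  by (auto simp: consistent_def intro: imp_conj_curry)

text \<open>If the counterexample were inconsistent with \<open>C\<close>, then \<open>C\<close>
  would prove the instance at a fresh variable, hence the universal formula; but \<open>C\<close>
  proves its negation, since it was rejected.\<close>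

lemma extend_consistent:
  assumes C: "consistent C" shows "consistent (extend F C)"
proof (cases "fwf F \<and> \<not> consistent (C \<^bold>\<and> F) \<and> (\<exists>\<sigma> A. F = All \<sigma> A)")
  case False
  then show ?thesis using C by (auto simp: extend_def split: fm.split)
next
  case True
  then obtain \<sigma> A where F: "F = All \<sigma> A" by blast
  define x where "x = fresh (names C \<union> names A)"
  have x: "x \<notin> names C" "x \<notin> names A"
    using fresh[of "names C \<union> names A"] by (auto simp: x_def)
  have wfs [simp]: "fwf C" "wf sp [\<sigma>] A" using C True F by (auto simp: consistent_def)
  then have wfi [simp]: "fwf (inst A [Free x \<sigma>])" by (auto intro!: wf_inst wt.intros)
  have "consistent (C \<^bold>\<and> \<^bold>\<not> inst A [Free x \<sigma>])"
  proof (rule ccontr)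
    assume "\<not> ?thesis"
    then have "pv (C \<^bold>\<longrightarrow> inst A [Free x \<sigma>])"
      by (auto intro!: imp_classical inconsistent_imp_neg)
    then have "pv (C \<^bold>\<longrightarrow> F)" using x F by (auto intro: imp_All)
    moreover have "pv (C \<^bold>\<longrightarrow> \<^bold>\<not> F)" using True by (intro inconsistent_imp_neg) auto
    ultimately have "pv (C \<^bold>\<longrightarrow> Fls)" using True by (intro imp_mp[of C F Fls]) auto
    then show False using C by (simp add: consistent_def)
  qed
  then show ?thesis using True F by (simp add: extend_def x_def)
qed

lemma extend_imp:
  assumes "consistent C" shows "pv (extend F C \<^bold>\<longrightarrow> C)"
proof -
  have "fwf C" using assms by (simp add: consistent_def)
  then show ?thesis
    by (auto simp: extend_def pv_refl intro!: imp_conjD1 wf_inst wt.intros split: fm.split)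
qed

primrec stage :: "fm \<Rightarrow> nat \<Rightarrow> fm" where
  "stage C 0 = C"
| "stage C (Suc n) = extend (from_nat n) (stage C n)"

definition henkin :: "fm \<Rightarrow> fm \<Rightarrow> bool" where
  "henkin C F \<longleftrightarrow> (\<exists>n. pv (stage C n \<^bold>\<longrightarrow> F))"

context
  fixes C :: fm
  assumes consistent: "consistent C"
begin

lemma stage_consistent: "consistent (stage C n)"
  by (induction n) (auto intro: consistent extend_consistent)

lemma stage_wf [simp]: "fwf (stage C n)"
  using stage_consistent by (simp add: consistent_def)

lemma stage_mono: "m \<le> n \<Longrightarrow> pv (stage C n \<^bold>\<longrightarrow> stage C m)"
proof (induction n rule: dec_induct)
  case (step n)
  have "pv (stage C (Suc n) \<^bold>\<longrightarrow> stage C n)" using extend_imp stage_consistent by simp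
  then show ?case by (rule imp_trans[rotated 3]) (use step in \<open>auto simp del: stage.simps(2)\<close>)
qed (simp add: pv_refl)

lemma henkin_mono:
  "fwf F \<Longrightarrow> pv (stage C m \<^bold>\<longrightarrow> F) \<Longrightarrow> m \<le> n \<Longrightarrow> pv (stage C n \<^bold>\<longrightarrow> F)"
  using imp_trans[OF _ _ _ stage_mono] by simp

lemma henkin_mp: "fwf A \<Longrightarrow> fwf B \<Longrightarrow> henkin C (A \<^bold>\<longrightarrow> B) \<Longrightarrow> henkin C A \<Longrightarrow> henkin C B"
  unfolding henkin_def
proof (elim exE)
  fix m n
  assume wf: "fwf A" "fwf B" and "pv (stage C m \<^bold>\<longrightarrow> A \<^bold>\<longrightarrow> B)" "pv (stage C n \<^bold>\<longrightarrow> A)"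
  then have "pv (stage C (max m n) \<^bold>\<longrightarrow> A \<^bold>\<longrightarrow> B)" "pv (stage C (max m n) \<^bold>\<longrightarrow> A)"
    by (auto intro: henkin_mono)
  then show "\<exists>n. pv (stage C n \<^bold>\<longrightarrow> B)" using wf imp_mp by (meson stage_wf)
qed

lemma henkin_pv: "fwf A \<Longrightarrow> pv A \<Longrightarrow> henkin C A"
  unfolding henkin_def using imp_weak stage_wf by blast

lemma henkin_Fls: "\<not> henkin C Fls"
  using stage_consistent unfolding henkin_def consistent_def by blast

lemma henkin_decide:
  assumes "fwf F" "\<not> henkin C F"
  shows "henkin C (\<^bold>\<not> F)"
    and "F = All \<sigma> A \<Longrightarrow> \<exists>x. henkin C (\<^bold>\<not> inst A [Free x \<sigma>])"
proof -
  \<comment> \<open>The stage at which \<open>F\<close> itself comes up for decision.\<close>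
  define n where "n = to_nat F"
  have not: "\<not> consistent (stage C n \<^bold>\<and> F)"
  proof
    assume "consistent (stage C n \<^bold>\<and> F)"
    then have "stage C (Suc n) = (stage C n \<^bold>\<and> F)" using assms by (simp add: n_def extend_def)
    moreover have "pv (stage C n \<^bold>\<and> F \<^bold>\<longrightarrow> F)" using assms by (intro imp_conjD2) auto
    ultimately show False using assms(2) unfolding henkin_def by metis
  qed
  then show "henkin C (\<^bold>\<not> F)"
    unfolding henkin_def using inconsistent_imp_neg assms(1) stage_wf by blast
  assume F: "F = All \<sigma> A"
  let ?x = "fresh (names (stage C n) \<union> names A)"
  have "stage C (Suc n) = (stage C n \<^bold>\<and> \<^bold>\<not> inst A [Free ?x \<sigma>])"
    using not assms(1) F by (simp add: n_def extend_def)
  moreover have "fwf (inst A [Free ?x \<sigma>])" using assms(1) F by (auto intro!: wf_inst wt.intros)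
  ultimately have "pv (stage C (Suc n) \<^bold>\<longrightarrow> \<^bold>\<not> inst A [Free ?x \<sigma>])" 
    using imp_conjD2[of "stage C n" "\<^bold>\<not> inst A [Free ?x \<sigma>]"] by simp
  then show "\<exists>x. henkin C (\<^bold>\<not> inst A [Free x \<sigma>])" unfolding henkin_def by blast
qed

lemma henkin_Imp:
  assumes "fwf A" "fwf B" shows "henkin C (A \<^bold>\<longrightarrow> B) \<longleftrightarrow> (henkin C A \<longrightarrow> henkin C B)"
proof
  show "henkin C (A \<^bold>\<longrightarrow> B) \<Longrightarrow> henkin C A \<longrightarrow> henkin C B" using henkin_mp assms by blast
next
  assume "henkin C A \<longrightarrow> henkin C B"
  moreover have "pv (B \<^bold>\<longrightarrow> A \<^bold>\<longrightarrow> B)" using assms by (rule pv_K[rotated])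
  moreover have "pv (\<^bold>\<not> A \<^bold>\<longrightarrow> A \<^bold>\<longrightarrow> B)"
  proof -
    have "pr {\<^bold>\<not> B, A, \<^bold>\<not> A} Fls" by (rule detach[of A]) (use assms in auto)
    then have "pr {A, \<^bold>\<not> A} B" by (rule prv.Classical[rotated]) (use assms in auto)
    then have "pr {\<^bold>\<not> A} (A \<^bold>\<longrightarrow> B)" by (rule prv.ImpI[rotated]) (use assms in auto)
    then show ?thesis by (rule prv.ImpI[rotated]) (use assms in auto)
  qed
  ultimately show "henkin C (A \<^bold>\<longrightarrow> B)"
    using assms henkin_decide(1)[of A] henkin_mp[OF _ _ henkin_pv, of B "A \<^bold>\<longrightarrow> B"]
      henkin_mp[OF _ _ henkin_pv, of "\<^bold>\<not> A" "A \<^bold>\<longrightarrow> B"] by auto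
qed

lemma henkin_All:
  assumes "wf sp [\<sigma>] A"
  shows "henkin C (All \<sigma> A) \<longleftrightarrow> (\<forall>t. wt sp [] t \<sigma> \<longrightarrow> henkin C (inst A [t]))"
proof (intro iffI allI impI)
  fix t assume h: "henkin C (All \<sigma> A)" and t: "wt sp [] t \<sigma>"
  have "pv (All \<sigma> A \<^bold>\<longrightarrow> inst A [t])"
    using assms t by (intro prv.ImpI prv.AllE hyp) auto
  then show "henkin C (inst A [t])"
    using h assms t by (intro henkin_mp[OF _ _ henkin_pv h]) (auto intro!: wf_inst)
next
  assume r: "\<forall>t. wt sp [] t \<sigma> \<longrightarrow> henkin C (inst A [t])"
  show "henkin C (All \<sigma> A)"
  proof (rule ccontr)
    assume "\<not> ?thesis"
    then obtain x where "henkin C (\<^bold>\<not> inst A [Free x \<sigma>])"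
      using henkin_decide(2)[of "All \<sigma> A" \<sigma> A] assms by auto
    moreover have "henkin C (inst A [Free x \<sigma>])" using r by (auto intro: wt.intros)
    moreover have "fwf (inst A [Free x \<sigma>])" using assms by (auto intro!: wf_inst wt.intros)
    ultimately show False using henkin_mp henkin_Fls by (meson wf.simps(1))
  qed
qed

lemma henkin_cong: "fwf A \<Longrightarrow> fwf B \<Longrightarrow> pv (A \<^bold>\<longrightarrow> B) \<Longrightarrow> pv (B \<^bold>\<longrightarrow> A) \<Longrightarrow> henkin C A = henkin C B"
  using henkin_mp[OF _ _ henkin_pv] by (metis wf.simps(4))

text \<open>The two rules make a bounded quantifier interderivable with the universal one guarded by
  \<open>less\<close>; the bound has no loose index, so instantiation leaves it alone.\<close>

lemma henkin_BAll:
  assumes s: "wt sp [] s N" and A: "wf sp [N] A"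
  shows "henkin C (BAll s A) \<longleftrightarrow>
    (\<forall>t. wt sp [] t N \<longrightarrow> henkin C (less t s) \<longrightarrow> henkin C (inst A [t]))"
proof -
  let ?B = "less (Bound 0) s \<^bold>\<longrightarrow> A"
  have op: "open_tm k us s = s" "open_tm k us tmonus = tmonus" for k us
    using s wt_lc lc_arith(3) by (auto simp: lc_def)
  have wm: "wt sp \<Gamma> tmonus (N \<rightarrow> N \<rightarrow> N)" and ws: "wt sp \<Gamma> s N" for \<Gamma>
    using wt_weaken[of sp "[]" tmonus _ \<Gamma>] wt_weaken[OF s, of \<Gamma>] by (simp_all add: wt_iff)
  have "wt sp [N] (Bound 0) N" using wt.intros(2)[of 0 "[N]" sp] by simp
  moreover have c: "wt sp \<Gamma> (Con CSuc) (N \<rightarrow> N)" "wt sp \<Gamma> zro N" for \<Gamma>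
    using wt.intros(3)[of sp CSuc \<Gamma>] wt.intros(3)[of sp CZero \<Gamma>] by auto
  ultimately have B: "wf sp [N] ?B"
    using A wm ws by (auto intro!: wt.intros(4)[of _ _ _ N])
  have "pr {BAll s A} (All N ?B)" by (rule prv.BAllE, rule hyp) (use s A in auto)
  moreover have "pr {All N ?B} (BAll s A)" by (rule prv.BAllI[OF s], rule hyp) (use B in auto)
  ultimately have "pv (BAll s A \<^bold>\<longrightarrow> All N ?B)" "pv (All N ?B \<^bold>\<longrightarrow> BAll s A)"
    using prv.ImpI[of sp "BAll s A" T "{}"] prv.ImpI[of sp "All N ?B" T "{}"] s A B by auto
  then have "henkin C (BAll s A) = henkin C (All N ?B)"
    using s A B by (intro henkin_cong) auto
  also have "\<dots> = (\<forall>t. wt sp [] t N \<longrightarrow> henkin C (less t s \<^bold>\<longrightarrow> inst A [t]))"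
    using B by (subst henkin_All) (auto simp: op)
  also have "\<dots> = (\<forall>t. wt sp [] t N \<longrightarrow> henkin C (less t s) \<longrightarrow> henkin C (inst A [t]))"
    using s A by (auto simp: henkin_Imp wf_inst wt_iff)
  finally show ?thesis .
qed

text \<open>The truth lemma. Induction is on \<open>depth\<close> because instances of a quantified
  formula are not among its subformulas.\<close>

lemma truth_henkin: "fwf A \<Longrightarrow> truth sp (henkin C) A = henkin C A"
proof (induction A rule: measure_induct_rule[of depth])
  case (less A)
  show ?case
  proof (cases A)
    case (All \<sigma> B)
    then show ?thesis using less by (auto simp: henkin_All wf_inst)
  next
    case (BAll s B)
    then show ?thesis using less by (auto simp: henkin_BAll wf_inst)
  qed (use less in \<open>auto simp: henkin_Fls henkin_Imp\<close>)
qed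

end

theorem completeness:
  assumes A: "fwf A"
    and valid: "\<And>at. (\<And>B. B \<in> T \<Longrightarrow> fwf B \<Longrightarrow> truth sp at B) \<Longrightarrow> truth sp at A"
  shows "pv A"
proof (rule ccontr)
  assume not: "\<not> pv A"
  have "consistent (\<^bold>\<not> A)"
  proof (rule ccontr)
    assume "\<not> ?thesis"
    then have "pv (\<^bold>\<not> \<^bold>\<not> A)" using A by (simp add: consistent_def)
    moreover have "pv (\<^bold>\<not> \<^bold>\<not> A \<^bold>\<longrightarrow> A)" using A by (simp add: imp_classical pv_refl)
    ultimately show False using mp not by blast
  qed
  note C = this
  have "truth sp (henkin (\<^bold>\<not> A)) B" if "B \<in> T" "fwf B" for B
    using that C by (simp add: truth_henkin henkin_pv prv.Axiom)
  then have "truth sp (henkin (\<^bold>\<not> A)) A" by (rule valid)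
  moreover have "henkin (\<^bold>\<not> A) (\<^bold>\<not> A)"
    unfolding henkin_def by (rule exI[of _ 0]) (use A in \<open>simp add: pv_refl\<close>)
  ultimately show False using A C by (simp add: truth_henkin henkin_Imp henkin_Fls)
qed

end

section \<open>Well-formedness and evaluation of binders\<close>

lemma wf_fbody: "(\<And>x. wf sp [] (B (Free x \<sigma>))) \<Longrightarrow> wf sp [\<sigma>] (fbody \<sigma> B)"
  using wf_close[of sp "[]"] by (simp add: fbody_def Let_def)

lemma wf_fall [simp]: "(\<And>x. wf sp [] (B (Free x \<sigma>))) \<Longrightarrow> wf sp [] (fall \<sigma> B)"
  by (simp add: fall_def wf_fbody)

lemma wf_fex [simp]: "(\<And>x. wf sp [] (B (Free x \<sigma>))) \<Longrightarrow> wf sp [] (fex \<sigma> B)"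
  by (simp add: fex_def)

lemma wf_fball [simp]:
  "ok sp t \<Longrightarrow> tyof t = N \<Longrightarrow> (\<And>x. wf sp [] (B (Free x N))) \<Longrightarrow> wf sp [] (fball t B)"
  by (simp add: fball_def wf_fbody wt_iff)

lemma wf_fall_st [simp]: "(\<And>x. wf sp [] (B (Free x \<sigma>))) \<Longrightarrow> wf sp [] (fall_st \<sigma> B)"
  by (simp add: fall_st_def wt_iff)

lemma wf_fex_st [simp]: "(\<And>x. wf sp [] (B (Free x \<sigma>))) \<Longrightarrow> wf sp [] (fex_st \<sigma> B)"
  by (simp add: fex_st_def wt_iff)

lemma wf_eqf [simp]:
  "ok sp s \<Longrightarrow> ok sp t \<Longrightarrow> tyof s = \<tau> \<Longrightarrow> tyof t = \<tau> \<Longrightarrow> wf sp [] (eqf \<tau> s t)"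
  by (induction \<tau> arbitrary: s t) (simp_all add: wt_iff)

lemma wf_relst [simp]: "wf sp \<Gamma> A \<Longrightarrow> wf sp \<Gamma> (relst A)"
proof (induction A arbitrary: \<Gamma>)
  case (All \<tau> A)
  then show ?case using wt.intros(2)[of 0 "\<tau> # \<Gamma>" sp] by simp
qed auto

lemma RF_1E:
  assumes "RF (Suc 0) (\<lambda>us. B (hd us))"
  obtains A where "\<And>u. lc u \<Longrightarrow> B u = open_fm 0 [u] A"
proof -
  obtain A where A: "\<forall>us. length us = Suc 0 \<longrightarrow> list_all lc us \<longrightarrow> B (hd us) = open_fm 0 us A"
    using assms unfolding RF_def by blast
  show ?thesis using A[rule_format, of "[_]"] by (intro that[of A]) simp
qed

lemma names_fbody:
  assumes "RF (Suc 0) (\<lambda>us. B (hd us))" shows "names (fbody \<sigma> B) = names (B (zero \<sigma>))"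
proof -
  obtain A where A: "\<And>u. lc u \<Longrightarrow> B u = open_fm 0 [u] A" by (rule RF_1E[OF assms]) blast
  then show ?thesis by (simp add: fbody_eq names_open_closed)
qed

lemma inst_fbody:
  assumes "RF (Suc 0) (\<lambda>us. B (hd us))" "lc t" shows "inst (fbody \<sigma> B) [t] = B t"
proof -
  obtain A where A: "\<And>u. lc u \<Longrightarrow> B u = open_fm 0 [u] A" by (rule RF_1E[OF assms(1)]) blast
  then show ?thesis using assms(2) by (simp add: fbody_eq)
qed

lemma names_fall [simp]:
  "RF (Suc 0) (\<lambda>us. B (hd us)) \<Longrightarrow> names (fall \<sigma> B) = names (B (zero \<sigma>))"
  by (simp add: fall_def names_fbody)

lemma internal_close [simp]: "internal (close_fm k x \<sigma> A) = internal A"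
  by (induction A arbitrary: k) auto

lemma internal_fbody [simp]: "(\<And>x. internal (B (Free x \<sigma>))) \<Longrightarrow> internal (fbody \<sigma> B)"
  by (simp add: fbody_def Let_def)

lemma internal_fall [simp]: "(\<And>x. internal (B (Free x \<sigma>))) \<Longrightarrow> internal (fall \<sigma> B)"
  by (simp add: fall_def)

lemma relst_open: "relst (open_fm k us A) = open_fm k us (relst A)"
  by (induction A arbitrary: k) auto

lemma RF_inst_hd: "wf sp [\<sigma>] A \<Longrightarrow> RF (Suc n) (\<lambda>us. inst A [hd us])"
proof -
  assume A: "wf sp [\<sigma>] A"
  have "inst A [hd us] = inst A us" if "length us = Suc n" for us
    using that open_fm_single_wf[OF A, symmetric] by (cases us) auto
  then show ?thesis unfolding RF_def by blast
qed

section \<open>Term models of the theory\<close>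

definition Tm :: "spec \<Rightarrow> ty \<Rightarrow> tm set" where
  "Tm sp \<sigma> = {t. ok sp t \<and> tyof t = \<sigma>}"

lemma Tm_iff [simp]: "t \<in> Tm sp \<sigma> \<longleftrightarrow> ok sp t \<and> tyof t = \<sigma>"
  by (simp add: Tm_def)

lemma Tm_App: "s \<in> Tm sp (\<sigma> \<rightarrow> \<tau>) \<Longrightarrow> t \<in> Tm sp \<sigma> \<Longrightarrow> s \<cdot> t \<in> Tm sp \<tau>"
  by simp

locale model =
  fixes sp :: spec and at :: "fm \<Rightarrow> bool"
  assumes ax: "RCA0_Omega_ax sp A \<Longrightarrow> wf sp [] A \<Longrightarrow> truth sp at A"
begin

abbreviation "ev \<equiv> truth sp at"
abbreviation "D \<equiv> Tm sp"

lemma lc_ok [simp]: "ok sp t \<Longrightarrow> lc t"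
  by (rule ok_lc)

text \<open>While the body of a quantifier over \<open>D \<sigma>\<close> is simplified, the typing
  of the bound term must be at hand, since the evaluation of atomic formulas depends on it.\<close>

declare ball_cong_simp [cong] bex_cong_simp [cong]

lemma ev_All_fbody:
  assumes "RF (Suc 0) (\<lambda>us. B (hd us))"
  shows "ev (All \<sigma> (fbody \<sigma> B)) \<longleftrightarrow> (\<forall>t\<in>D \<sigma>. ev (B t))"
  using inst_fbody[OF assms] by (auto simp: wt_iff)

lemma ev_fall [simp]:
  "RF (Suc 0) (\<lambda>us. B (hd us)) \<Longrightarrow> ev (fall \<sigma> B) \<longleftrightarrow> (\<forall>t\<in>D \<sigma>. ev (B t))"
  unfolding fall_def by (rule ev_All_fbody)

lemma ev_fex [simp]:
  "RF (Suc 0) (\<lambda>us. B (hd us)) \<Longrightarrow> ev (fex \<sigma> B) \<longleftrightarrow> (\<exists>t\<in>D \<sigma>. ev (B t))"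
  by (simp add: fex_def del: Tm_iff)

lemma ev_fall_st [simp]:
  "RF (Suc 0) (\<lambda>us. B (hd us)) \<Longrightarrow> ev (fall_st \<sigma> B) \<longleftrightarrow> (\<forall>t\<in>D \<sigma>. at (St \<sigma> t) \<longrightarrow> ev (B t))"
  by (simp add: fall_st_def del: Tm_iff)

lemma ev_fex_st [simp]:
  "RF (Suc 0) (\<lambda>us. B (hd us)) \<Longrightarrow> ev (fex_st \<sigma> B) \<longleftrightarrow> (\<exists>t\<in>D \<sigma>. at (St \<sigma> t) \<and> ev (B t))"
  by (auto simp add: fex_st_def simp del: Tm_iff)

lemma ev_fball [simp]:
  "RF (Suc 0) (\<lambda>us. B (hd us)) \<Longrightarrow>
    ev (fball s B) \<longleftrightarrow> (\<forall>t\<in>D N. at (less t s) \<longrightarrow> ev (B t))"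
  using inst_fbody[of B] by (auto simp: wt_iff fball_def)

lemma ev_relst_fall [simp]:
  assumes "RF (Suc 0) (\<lambda>us. B (hd us))"
  shows "ev (relst (fall \<sigma> B)) \<longleftrightarrow> (\<forall>t\<in>D \<sigma>. at (St \<sigma> t) \<longrightarrow> ev (relst (B t)))"
proof -
  have "inst (relst (fbody \<sigma> B)) [t] = relst (B t)" if "ok sp t" for t
    using inst_fbody[OF assms ok_lc[OF that]] by (simp flip: relst_open)
  then show ?thesis by (auto simp: fall_def wt_iff)
qed

lemma ev_relst_fex [simp]:
  "RF (Suc 0) (\<lambda>us. B (hd us)) \<Longrightarrow>
    ev (relst (fex \<sigma> B)) \<longleftrightarrow> (\<exists>t\<in>D \<sigma>. at (St \<sigma> t) \<and> ev (relst (B t)))"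
  by (simp add: fex_def del: Tm_iff)

section \<open>The extensional quotient\<close>

lemma ax_base: "RCA0_omega_ax sp A \<Longrightarrow> wf sp [] A \<Longrightarrow> ev A"
  by (intro ax RCA0_Omega_ax.base)

lemma eqN_refl: "t \<in> D N \<Longrightarrow> at (t \<doteq> t)"
  using ax_base[OF eq_refl] by (auto simp: wt_iff)

lemma eqN_euclid: "x \<in> D N \<Longrightarrow> y \<in> D N \<Longrightarrow> z \<in> D N \<Longrightarrow> at (x \<doteq> y) \<Longrightarrow> at (x \<doteq> z) \<Longrightarrow> at (y \<doteq> z)"
proof -
  have "ev (fall N (\<lambda>x. fall N (\<lambda>y. fall N (\<lambda>z. x \<doteq> y \<^bold>\<longrightarrow> x \<doteq> z \<^bold>\<longrightarrow> y \<doteq> z))))"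
    by (rule ax_base[OF eq_euclid]) (simp add: wt_iff)
  then have "\<forall>x\<in>D N. \<forall>y\<in>D N. \<forall>z\<in>D N. at (x \<doteq> y) \<longrightarrow> at (x \<doteq> z) \<longrightarrow> at (y \<doteq> z)"
    by (simp (no_asm_use))
  then show "x \<in> D N \<Longrightarrow> y \<in> D N \<Longrightarrow> z \<in> D N \<Longrightarrow> at (x \<doteq> y) \<Longrightarrow> at (x \<doteq> z) \<Longrightarrow> at (y \<doteq> z)"
    by blast
qed

lemma eqN_sym: "x \<in> D N \<Longrightarrow> y \<in> D N \<Longrightarrow> at (x \<doteq> y) \<Longrightarrow> at (y \<doteq> x)"
  using eqN_euclid eqN_refl by blast

definition eqv :: "ty \<Rightarrow> tm \<Rightarrow> tm \<Rightarrow> bool" where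
  "eqv \<tau> s t \<longleftrightarrow> ev (eqf \<tau> s t)"

lemma eqv_N [simp]: "eqv N s t = at (s \<doteq> t)"
  by (simp add: eqv_def)

lemma eqv_Fn: "s \<in> D (\<sigma> \<rightarrow> \<tau>) \<Longrightarrow> t \<in> D (\<sigma> \<rightarrow> \<tau>) \<Longrightarrow>
    eqv (\<sigma> \<rightarrow> \<tau>) s t \<longleftrightarrow> (\<forall>z\<in>D \<sigma>. eqv \<tau> (s \<cdot> z) (t \<cdot> z))"
  unfolding eqv_def by (simp add: ok_lc)

lemma eqv_Seq: "s \<in> D (Seq \<sigma>) \<Longrightarrow> t \<in> D (Seq \<sigma>) \<Longrightarrow>
    eqv (Seq \<sigma>) s t \<longleftrightarrow> at (Con (CLen \<sigma>) \<cdot> s \<doteq> Con (CLen \<sigma>) \<cdot> t) \<and>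
      (\<forall>i\<in>D N. at (less i (Con (CLen \<sigma>) \<cdot> s)) \<longrightarrow>
        eqv \<sigma> (Con (CNth \<sigma>) \<cdot> s \<cdot> i) (Con (CNth \<sigma>) \<cdot> t \<cdot> i))"
  unfolding eqv_def by (simp add: ok_lc)

lemma ext: "f \<in> D (\<rho> \<rightarrow> \<tau>) \<Longrightarrow> x \<in> D \<rho> \<Longrightarrow> y \<in> D \<rho> \<Longrightarrow> eqv \<rho> x y \<Longrightarrow> eqv \<tau> (f \<cdot> x) (f \<cdot> y)"
  using ax_base[OF Ext[of _ \<rho> \<tau>]] unfolding eqv_def by (simp add: wt_iff)

text \<open>Equality of sequences bounds its quantifier by the length of the first sequence; to make
  it an equivalence, the bound has to be invariant under equality of lengths.\<close>

lemma less_cong: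
  assumes "i \<in> D N" "m \<in> D N" "n \<in> D N" "at (m \<doteq> n)" "at (less i m)"
  shows "at (less i n)"
proof -
  have "at (tmonus \<cdot> suc i \<cdot> m \<doteq> tmonus \<cdot> suc i \<cdot> n)"
    using ext[of "tmonus \<cdot> suc i" N N m n] assms by simp
  then show ?thesis
    using eqN_euclid[of "tmonus \<cdot> suc i \<cdot> m" "tmonus \<cdot> suc i \<cdot> n" zro] assms by simp
qed

lemma eqv_refl: "t \<in> D \<tau> \<Longrightarrow> eqv \<tau> t t"
proof (induction \<tau> arbitrary: t)
  case N
  then show ?case by (simp add: eqN_refl)
next
  case (Fn \<sigma> \<tau>)
  then show ?case by (auto simp: eqv_Fn)
next
  case (Seq \<tau>)
  then show ?case by (auto simp: eqv_Seq intro: eqN_refl)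
qed

lemma eqv_euclid: "x \<in> D \<tau> \<Longrightarrow> y \<in> D \<tau> \<Longrightarrow> z \<in> D \<tau> \<Longrightarrow> eqv \<tau> x y \<Longrightarrow> eqv \<tau> x z \<Longrightarrow> eqv \<tau> y z"
proof (induction \<tau> arbitrary: x y z)
  case N
  then show ?case using eqN_euclid[of x y z] by simp
next
  case (Fn \<sigma> \<tau>)
  have "eqv \<tau> (y \<cdot> t) (z \<cdot> t)" if t: "t \<in> D \<sigma>" for t
    by (rule Fn.IH(2)[of "x \<cdot> t"]) (use Fn.prems t in \<open>auto simp: eqv_Fn\<close>)
  then show ?case using Fn.prems by (simp add: eqv_Fn)
next
  case (Seq \<sigma>)
  let ?l = "\<lambda>s. Con (CLen \<sigma>) \<cdot> s" and ?n = "\<lambda>s i. Con (CNth \<sigma>) \<cdot> s \<cdot> i"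
  have l: "?l x \<in> D N" "?l y \<in> D N" "?l z \<in> D N" using Seq.prems by auto
  have "eqv \<sigma> (?n y i) (?n z i)" if i: "i \<in> D N" "at (less i (?l y))" for i
  proof (rule Seq.IH[of "?n x i"])
    have "at (less i (?l x))"
      by (rule less_cong[of _ "?l y"]) (use Seq.prems i l in \<open>auto simp: eqv_Seq intro: eqN_sym\<close>)
    then show "eqv \<sigma> (?n x i) (?n y i)" "eqv \<sigma> (?n x i) (?n z i)"
      using Seq.prems i by (auto simp: eqv_Seq)
  qed (use Seq.prems i in auto)
  moreover have "at (?l y \<doteq> ?l z)"
    by (rule eqN_euclid[of "?l x"]) (use Seq.prems l in \<open>auto simp: eqv_Seq\<close>)
  ultimately show ?case using Seq.prems by (simp add: eqv_Seq)
qed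

lemma eqv_sym: "x \<in> D \<tau> \<Longrightarrow> y \<in> D \<tau> \<Longrightarrow> eqv \<tau> x y \<Longrightarrow> eqv \<tau> y x"
  using eqv_euclid eqv_refl by blast

lemma eqv_trans: "x \<in> D \<tau> \<Longrightarrow> y \<in> D \<tau> \<Longrightarrow> z \<in> D \<tau> \<Longrightarrow> eqv \<tau> x y \<Longrightarrow> eqv \<tau> y z \<Longrightarrow> eqv \<tau> x z"
  using eqv_euclid eqv_sym by blast

lemma eqv_App:
  assumes "f \<in> D (\<sigma> \<rightarrow> \<tau>)" "g \<in> D (\<sigma> \<rightarrow> \<tau>)" "x \<in> D \<sigma>" "y \<in> D \<sigma>" "eqv (\<sigma> \<rightarrow> \<tau>) f g" "eqv \<sigma> x y"
  shows "eqv \<tau> (f \<cdot> x) (g \<cdot> y)"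
proof (rule eqv_trans[of _ _ "f \<cdot> y"])
  show "eqv \<tau> (f \<cdot> x) (f \<cdot> y)" using assms by (intro ext) auto
  show "eqv \<tau> (f \<cdot> y) (g \<cdot> y)" using assms by (simp add: eqv_Fn)
qed (use assms in auto)

section \<open>The quotient as an applicative structure\<close>

definition cls :: "tm \<Rightarrow> tm set" where
  "cls t = {s \<in> D (tyof t). eqv (tyof t) s t}"

lemma cls_eq: "s \<in> D \<tau> \<Longrightarrow> t \<in> D \<tau> \<Longrightarrow> cls s = cls t \<longleftrightarrow> eqv \<tau> s t"
proof
  assume *: "s \<in> D \<tau>" "t \<in> D \<tau>" "cls s = cls t"
  have "s \<in> cls s" using *(1) eqv_refl[OF *(1)] by (simp add: cls_def)
  then have "s \<in> cls t" unfolding *(3) .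
  then show "eqv \<tau> s t" using *(2) by (simp add: cls_def)
next
  assume *: "s \<in> D \<tau>" "t \<in> D \<tau>" "eqv \<tau> s t"
  then have ts: "eqv \<tau> t s" by (intro eqv_sym[of s]) auto
  show "cls s = cls t"
    using * eqv_trans[OF _ *(1,2) _ *(3)] eqv_trans[OF _ *(2,1) _ ts] unfolding cls_def by auto
qed

definition ap :: "tm set \<Rightarrow> tm set \<Rightarrow> tm set" (infixl "\<bullet>" 90) where
  "X \<bullet> Y = cls ((SOME s. s \<in> X) \<cdot> (SOME t. t \<in> Y))"

lemma cls_some: "t \<in> D \<tau> \<Longrightarrow> (SOME s. s \<in> cls t) \<in> D \<tau> \<and> eqv \<tau> (SOME s. s \<in> cls t) t"
  using someI[of "\<lambda>s. s \<in> cls t" t] by (auto simp: cls_def eqv_refl)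

lemma cls_App: "s \<in> D (\<sigma> \<rightarrow> \<tau>) \<Longrightarrow> t \<in> D \<sigma> \<Longrightarrow> cls (s \<cdot> t) = cls s \<bullet> cls t"
proof -
  assume st: "s \<in> D (\<sigma> \<rightarrow> \<tau>)" "t \<in> D \<sigma>"
  note S = cls_some[OF st(1)] and T = cls_some[OF st(2)]
  have "eqv \<tau> (s \<cdot> t) ((SOME x. x \<in> cls s) \<cdot> (SOME x. x \<in> cls t))"
    by (rule eqv_App[of _ \<sigma>]) (use S T st eqv_sym[OF _ st(1)] eqv_sym[OF _ st(2)] in auto)
  then show ?thesis
    unfolding ap_def using S T st by (subst cls_eq[where \<tau>=\<tau>]) auto
qed

text \<open>
  Values are classes of terms modulo extensional equality.  In \<open>env0\<close> every variable denotes its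
  own class, which turns truth of atomic formulas into equality of values.
\<close>

primrec den :: "(nat \<Rightarrow> ty \<Rightarrow> tm set) \<Rightarrow> tm \<Rightarrow> tm set" where
  "den \<rho> (Free x \<tau>) = \<rho> x \<tau>"
| "den \<rho> (Bound i) = {}"
| "den \<rho> (Con c) = cls (Con c)"
| "den \<rho> (s \<cdot> t) = den \<rho> s \<bullet> den \<rho> t"

definition env0 :: "nat \<Rightarrow> ty \<Rightarrow> tm set" where
  "env0 x \<tau> = cls (Free x \<tau>)"

definition Val :: "ty \<Rightarrow> tm set set" where
  "Val \<tau> = cls ` D \<tau>"

definition genv :: "(nat \<Rightarrow> ty \<Rightarrow> tm set) \<Rightarrow> bool" where
  "genv \<rho> \<longleftrightarrow> (\<forall>x \<tau>. \<rho> x \<tau> \<in> Val \<tau>)"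

lemma cls_den: "ok sp t \<Longrightarrow> cls t = den env0 t"
proof (induction t)
  case (App s t)
  then obtain \<tau> where "tyof s = tyof t \<rightarrow> \<tau>" by (auto split: ty.splits)
  then have "cls (s \<cdot> t) = cls s \<bullet> cls t" using App.prems by (intro cls_App) auto
  then show ?case using App by simp
qed (auto simp: env0_def)

lemma genv_env0 [simp]: "genv env0"
  by (auto simp: genv_def env0_def Val_def)

lemma ap_Val: "X \<in> Val (\<sigma> \<rightarrow> \<tau>) \<Longrightarrow> Y \<in> Val \<sigma> \<Longrightarrow> X \<bullet> Y \<in> Val \<tau>"
proof -
  assume "X \<in> Val (\<sigma> \<rightarrow> \<tau>)" "Y \<in> Val \<sigma>"
  then obtain s t where st: "s \<in> D (\<sigma> \<rightarrow> \<tau>)" "X = cls s" "t \<in> D \<sigma>" "Y = cls t"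
    by (auto simp: Val_def)
  then have "X \<bullet> Y = cls (s \<cdot> t)" by (simp add: cls_App)
  then show ?thesis using st Tm_App by (auto simp: Val_def)
qed

lemma den_Val: "ok sp t \<Longrightarrow> genv \<rho> \<Longrightarrow> tyof t = \<tau> \<Longrightarrow> den \<rho> t \<in> Val \<tau>"
proof (induction t arbitrary: \<tau>)
  case (App s t)
  then have "tyof s = tyof t \<rightarrow> \<tau>" by (auto split: ty.splits)
  then have "den \<rho> s \<in> Val (tyof t \<rightarrow> \<tau>)" "den \<rho> t \<in> Val (tyof t)" using App by auto
  then show ?case by (simp add: ap_Val)
qed (auto simp: genv_def Val_def)

text \<open>Equality at function types is pointwise on terms, and every value is the class of a
  term. At the end this identifies a ramp with a constant functional.\<close>

lemma Val_ext:
  assumes "X \<in> Val (\<sigma> \<rightarrow> \<tau>)" "Y \<in> Val (\<sigma> \<rightarrow> \<tau>)" "\<And>v. v \<in> Val \<sigma> \<Longrightarrow> X \<bullet> v = Y \<bullet> v"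
  shows "X = Y"
proof -
  obtain s t where st: "s \<in> D (\<sigma> \<rightarrow> \<tau>)" "X = cls s" "t \<in> D (\<sigma> \<rightarrow> \<tau>)" "Y = cls t"
    using assms by (auto simp: Val_def)
  have "eqv \<tau> (s \<cdot> z) (t \<cdot> z)" if "z \<in> D \<sigma>" for z
  proof -
    have "cls (s \<cdot> z) = cls (t \<cdot> z)"
      using assms(3)[of "cls z"] st that by (simp add: cls_App Val_def)
    then show ?thesis using st that by (subst (asm) cls_eq[where \<tau>=\<tau>]) auto
  qed
  then have "eqv (\<sigma> \<rightarrow> \<tau>) s t" using st by (subst eqv_Fn) auto
  then show ?thesis using st cls_eq[of s _ t] by simp
qed

lemma Val_eq: "Val \<sigma> = den env0 ` D \<sigma>"
  unfolding Val_def by (rule image_cong) (auto simp: cls_den)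

lemma at_Eq [simp]:
  "ok sp s \<Longrightarrow> ok sp t \<Longrightarrow> tyof s = N \<Longrightarrow> tyof t = N \<Longrightarrow> at (s \<doteq> t) \<longleftrightarrow> den env0 s = den env0 t"
  using cls_eq[of s N t] by (simp add: cls_den)

lemma ev_eqf [simp]:
  "ok sp s \<Longrightarrow> ok sp t \<Longrightarrow> tyof s = \<tau> \<Longrightarrow> tyof t = \<tau> \<Longrightarrow> ev (eqf \<tau> s t) \<longleftrightarrow> den env0 s = den env0 t"
  using cls_eq[of s \<tau> t] by (simp add: cls_den eqv_def)

lemma den_K: "x \<in> Val \<sigma> \<Longrightarrow> y \<in> Val \<tau> \<Longrightarrow> cls (Con (CK \<sigma> \<tau>)) \<bullet> x \<bullet> y = x"
  using ax_base[OF K[of _ \<sigma> \<tau>]] by (auto simp: wt_iff ok_lc Val_eq)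

lemma den_S: "x \<in> Val (\<rho> \<rightarrow> \<sigma> \<rightarrow> \<tau>) \<Longrightarrow> y \<in> Val (\<rho> \<rightarrow> \<sigma>) \<Longrightarrow> z \<in> Val \<rho> \<Longrightarrow>
    cls (Con (CS \<rho> \<sigma> \<tau>)) \<bullet> x \<bullet> y \<bullet> z = x \<bullet> z \<bullet> (y \<bullet> z)"
  using ax_base[OF S[of _ \<rho> \<sigma> \<tau>]] by (auto simp: wt_iff ok_lc Val_eq)

definition upd :: "(nat \<Rightarrow> ty \<Rightarrow> tm set) \<Rightarrow> nat \<Rightarrow> ty \<Rightarrow> tm set \<Rightarrow> nat \<Rightarrow> ty \<Rightarrow> tm set" where
  "upd \<rho> x \<sigma> v = (\<lambda>y \<tau>. if y = x \<and> \<tau> = \<sigma> then v else \<rho> y \<tau>)"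

lemma upd_same [simp]: "upd \<rho> x \<sigma> v x \<sigma> = v"
  and upd_other [simp]: "y \<noteq> x \<or> \<tau> \<noteq> \<sigma> \<Longrightarrow> upd \<rho> x \<sigma> v y \<tau> = \<rho> y \<tau>"
  by (auto simp: upd_def)

lemma genv_upd [simp]: "genv \<rho> \<Longrightarrow> v \<in> Val \<sigma> \<Longrightarrow> genv (upd \<rho> x \<sigma> v)"
  by (auto simp: genv_def upd_def)

lemma den_upd_fresh: "x \<notin> names_tm t \<Longrightarrow> den (upd \<rho> x \<sigma> v) t = den \<rho> t"
  by (induction t) auto

text \<open>Bracket abstraction inspects an application only for the name \<open>x\<close>, while
  \<open>upd\<close> changes just the variable of type \<open>\<sigma>\<close>. Nothing breaks: a
  namesake of another type passes through S and ends up under K.\<close>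

lemma beta:
  assumes "ok sp t" "genv \<rho>" "v \<in> Val \<sigma>"
  shows "den \<rho> (bracket x \<sigma> t) \<bullet> v = den (upd \<rho> x \<sigma> v) t"
  using assms
proof (induction t)
  case (App s t)
  show ?case
  proof (cases "x \<in> names_tm (s \<cdot> t)")
    case False
    have "den \<rho> (s \<cdot> t) \<in> Val (tyof (s \<cdot> t))" using App.prems den_Val by blast
    then show ?thesis using False App.prems den_upd_fresh[OF False] by (simp add: den_K)
  next
    case True
    obtain \<tau> where ty: "tyof s = tyof t \<rightarrow> \<tau>" using App.prems by (auto split: ty.splits)
    have "den \<rho> (bracket x \<sigma> s) \<in> Val (\<sigma> \<rightarrow> tyof t \<rightarrow> \<tau>)" "den \<rho> (bracket x \<sigma> t) \<in> Val (\<sigma> \<rightarrow> tyof t)"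
      using App.prems ty by (auto intro!: den_Val)
    then show ?thesis using App ty True by (auto simp: den_S)
  qed
next
  case (Free y \<tau>)
  show ?case
  proof (cases "y = x \<and> \<tau> = \<sigma>")
    case True
    have "cls (Con (CK \<sigma> (\<sigma> \<rightarrow> \<sigma>))) \<in> Val (\<sigma> \<rightarrow> (\<sigma> \<rightarrow> \<sigma>) \<rightarrow> \<sigma>)" "cls (Con (CK \<sigma> \<sigma>)) \<in> Val (\<sigma> \<rightarrow> \<sigma> \<rightarrow> \<sigma>)"
      by (auto simp: Val_def)
    then show ?thesis using True Free by (auto simp: den_S den_K ap_Val[of _ \<sigma>])
  next
    case False
    then show ?thesis using Free by (auto simp: den_K genv_def)
  qed
next
  case (Con c)
  then have "cls (Con c) \<in> Val (conty c)" by (auto simp: Val_def)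
  then show ?case using Con by (simp add: den_K)
qed auto

end

section \<open>Arithmetic\<close>

text \<open>Abstracting \<open>x\<close> at type \<open>\<sigma>\<close> leaves namesakes of other
  types free; the name disappears altogether only if there are none.\<close>

primrec sole :: "nat \<Rightarrow> ty \<Rightarrow> tm \<Rightarrow> bool" where
  "sole x \<sigma> (Free y \<tau>) = (y = x \<longrightarrow> \<tau> = \<sigma>)"
| "sole x \<sigma> (Bound i) = True"
| "sole x \<sigma> (Con c) = True"
| "sole x \<sigma> (s \<cdot> t) = (sole x \<sigma> s \<and> sole x \<sigma> t)"

lemma sole_bracket: "sole y \<tau> t \<Longrightarrow> sole y \<tau> (bracket x \<sigma> t)"
  by (induction t) auto

lemma names_bracket: "sole x \<sigma> t \<Longrightarrow> names_tm (bracket x \<sigma> t) = names_tm t - {x}"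
  by (induction t) auto

lemma sole_names: "names_tm t = {} \<Longrightarrow> sole x \<sigma> t"
  by (induction t) auto

lemma insert_Diff_if': "insert x A - {y} = (if x = y then A - {y} else insert x (A - {y}))"
  by auto

lemmas names_simps = sole_bracket names_bracket sole_names insert_Diff_if'
lemmas lam_simps = lam_def Let_def fresh_def names_simps

text \<open>The names that \<open>lam\<close> picks are computed once, which yields explicit
  abstractions to which \<open>beta\<close> applies. The terms come in order of dependence, because
  each computation has to know that the earlier terms are closed.\<close>

lemma arith_eqs:
  "tpred = bracket 1 N (rec (Free 1 N) zro (bracket 1 N (bracket 1 N (Free 1 N))))"
  "tadd = bracket 1 N (bracket 2 N (rec (Free 2 N) (Free 1 N) (bracket 1 N (bracket 2 N (suc (Free 1 N))))))"
  and names_arith1 [simp]: "names_tm tpred = {}" "names_tm tadd = {}"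
  by (simp_all add: tpred_def tadd_def lam_simps eval_nat_numeral del: bracket.simps)

lemma arith_eqs2:
  "tmonus = bracket 1 N (bracket 2 N (rec (Free 2 N) (Free 1 N)
     (bracket 1 N (bracket 2 N (tpred \<cdot> Free 1 N)))))"
  "tmult = bracket 1 N (bracket 2 N (rec (Free 2 N) zro
     (bracket 2 N (bracket 3 N (tadd \<cdot> Free 2 N \<cdot> Free 1 N)))))"
  "texp2 = bracket 1 N (rec (Free 1 N) (suc zro) (bracket 1 N (bracket 2 N (tadd \<cdot> Free 1 N \<cdot> Free 1 N))))"
  "ttri = bracket 1 N (rec (Free 1 N) zro (bracket 1 N (bracket 2 N (tadd \<cdot> Free 1 N \<cdot> suc (Free 2 N)))))"
  and names_arith2 [simp]: "names_tm tmonus = {}" "names_tm tmult = {}" "names_tm texp2 = {}" "names_tm ttri = {}"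
  by (simp_all add: tmonus_def tmult_def texp2_def ttri_def lam_simps eval_nat_numeral del: bracket.simps)

lemma arith_eqs3:
  "tpair = bracket 1 N (bracket 2 N (tadd \<cdot> (ttri \<cdot> (tadd \<cdot> Free 1 N \<cdot> Free 2 N)) \<cdot> Free 1 N))"
  "troot = bracket 1 N (rec (Free 1 N) zro (bracket 1 N (bracket 2 N
     (tadd \<cdot> Free 1 N \<cdot> (tmonus \<cdot> suc zro \<cdot> (tmonus \<cdot> (ttri \<cdot> suc (Free 1 N)) \<cdot> suc (Free 2 N)))))))"
  and names_arith3 [simp]: "names_tm tpair = {}" "names_tm troot = {}"
  by (simp_all add: tpair_def troot_def lam_simps eval_nat_numeral del: bracket.simps)

lemma arith_eqs4:
  "tfst = bracket 1 N (tmonus \<cdot> Free 1 N \<cdot> (ttri \<cdot> (troot \<cdot> Free 1 N)))"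
  and names_arith4 [simp]: "names_tm tfst = {}"
  by (simp_all add: tfst_def lam_simps eval_nat_numeral del: bracket.simps)

lemma arith_eqs5:
  "tsnd = bracket 1 N (tmonus \<cdot> (troot \<cdot> Free 1 N) \<cdot> (tfst \<cdot> Free 1 N))"
  and names_arith5 [simp]: "names_tm tsnd = {}"
  by (simp_all add: tsnd_def lam_simps eval_nat_numeral del: bracket.simps)

text \<open>The term \<open>s \<cdot> Bound 0\<close> is not locally closed; below a quantifier its
  index would be captured. Quantifier-free formulas are safe, and they are what the induction schema
  is about.\<close>

lemma open_App_qfree:
  assumes "wf sp [\<sigma>] A" "qfree A" "lc s"
  shows "inst A [s \<cdot> u] = inst (open_fm 0 [s \<cdot> Bound 0] A) [u]"
proof -
  have "wt sp \<Gamma> t \<tau> \<Longrightarrow> length \<Gamma> \<le> 1 \<Longrightarrow>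
      open_tm 0 [s \<cdot> u] t = open_tm 0 [u] (open_tm 0 [s \<cdot> Bound 0] t)" for t \<Gamma> \<tau>
    by (induction rule: wt.induct) (use assms(3) in \<open>auto simp: lc_def nth_Cons'\<close>)
  then show ?thesis using assms(1,2) by (induction A) fastforce+
qed

context model
begin

lemma den_closed: "names_tm t = {} \<Longrightarrow> ok sp t \<Longrightarrow> den \<rho> t = cls t"
proof -
  have "names_tm t = {} \<Longrightarrow> den \<rho> t = den \<rho>' t" for \<rho>' by (induction t) auto
  then show "names_tm t = {} \<Longrightarrow> ok sp t \<Longrightarrow> den \<rho> t = cls t" by (simp add: cls_den)
qed

lemma den_arith [simp]:
  "den \<rho> tpred = cls tpred" "den \<rho> tadd = cls tadd" "den \<rho> tmonus = cls tmonus"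
  "den \<rho> tmult = cls tmult" "den \<rho> texp2 = cls texp2" "den \<rho> ttri = cls ttri"
  "den \<rho> tpair = cls tpair" "den \<rho> troot = cls troot" "den \<rho> tfst = cls tfst" "den \<rho> tsnd = cls tsnd"
  by (simp_all add: den_closed)

lemmas ap_Val_simps [simp] =
  ap_Val[of _ N] ap_Val[of _ T1] ap_Val[of _ T2] ap_Val[of _ "T1 \<rightarrow> T1"] ap_Val[of _ "N \<rightarrow> N \<rightarrow> N"]
  ap_Val[of _ "Seq N"]

lemma cls_Val [simp]: "ok sp t \<Longrightarrow> tyof t = \<tau> \<Longrightarrow> cls t \<in> Val \<tau>"
  by (auto simp: Val_def)

declare beta [simp]

lemma den_Val_simp [simp]: "ok sp t \<Longrightarrow> genv \<rho> \<Longrightarrow> tyof t = \<tau> \<Longrightarrow> den \<rho> t \<in> Val \<tau>"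
  by (rule den_Val)

section \<open>Arithmetic on the values of type 0\<close>

definition zerov :: "tm set" where "zerov = cls zro"
definition sucv where "sucv a = cls (Con CSuc) \<bullet> a"
definition recv where "recv n a f = cls (Con CR) \<bullet> n \<bullet> a \<bullet> f"
definition predv where "predv a = cls tpred \<bullet> a"
definition addv (infixl "\<oplus>" 65) where "a \<oplus> b = cls tadd \<bullet> a \<bullet> b"
definition monusv (infixl "\<ominus>" 65) where "a \<ominus> b = cls tmonus \<bullet> a \<bullet> b"
definition multv (infixl "\<otimes>" 70) where "a \<otimes> b = cls tmult \<bullet> a \<bullet> b"
definition expv where "expv a = cls texp2 \<bullet> a"
definition triv where "triv a = cls ttri \<bullet> a"
definition pairv where "pairv a b = cls tpair \<bullet> a \<bullet> b"
definition rootv where "rootv a = cls troot \<bullet> a"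
definition fstv where "fstv a = cls tfst \<bullet> a"
definition sndv where "sndv a = cls tsnd \<bullet> a"

abbreviation "NV \<equiv> Val N"

lemma NV_closed [simp]:
  "zerov \<in> NV" "a \<in> NV \<Longrightarrow> sucv a \<in> NV" "a \<in> NV \<Longrightarrow> predv a \<in> NV"
  "a \<in> NV \<Longrightarrow> b \<in> NV \<Longrightarrow> a \<oplus> b \<in> NV" "a \<in> NV \<Longrightarrow> b \<in> NV \<Longrightarrow> a \<ominus> b \<in> NV"
  "a \<in> NV \<Longrightarrow> b \<in> NV \<Longrightarrow> a \<otimes> b \<in> NV" "a \<in> NV \<Longrightarrow> expv a \<in> NV" "a \<in> NV \<Longrightarrow> triv a \<in> NV"
  "a \<in> NV \<Longrightarrow> b \<in> NV \<Longrightarrow> pairv a b \<in> NV" "a \<in> NV \<Longrightarrow> rootv a \<in> NV" "a \<in> NV \<Longrightarrow> fstv a \<in> NV"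
  "a \<in> NV \<Longrightarrow> sndv a \<in> NV" "a \<in> NV \<Longrightarrow> b \<in> NV \<Longrightarrow> f \<in> Val (N \<rightarrow> N \<rightarrow> N) \<Longrightarrow> recv a b f \<in> NV"
  by (simp_all add: zerov_def sucv_def predv_def addv_def monusv_def multv_def expv_def triv_def
      pairv_def rootv_def fstv_def sndv_def recv_def)

lemmas opv = zerov_def[symmetric] sucv_def[symmetric] recv_def[symmetric] predv_def[symmetric]
  addv_def[symmetric] monusv_def[symmetric] multv_def[symmetric] expv_def[symmetric]
  triv_def[symmetric] pairv_def[symmetric] rootv_def[symmetric] fstv_def[symmetric] sndv_def[symmetric]

lemma sucv_neq_zerov [simp]: "a \<in> NV \<Longrightarrow> sucv a \<noteq> zerov"
  using ax_base[OF suc_zero] by (auto simp: wt_iff Val_eq opv)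

lemma zerov_neq_sucv [simp]: "a \<in> NV \<Longrightarrow> zerov \<noteq> sucv a"
  using sucv_neq_zerov by metis

lemma recv_zero [simp]: "a \<in> NV \<Longrightarrow> f \<in> Val (N \<rightarrow> N \<rightarrow> N) \<Longrightarrow> recv zerov a f = a"
  using ax_base[OF R_zero] by (auto simp: wt_iff Val_eq opv)

lemma recv_suc [simp]: "n \<in> NV \<Longrightarrow> a \<in> NV \<Longrightarrow> f \<in> Val (N \<rightarrow> N \<rightarrow> N) \<Longrightarrow>
    recv (sucv n) a f = f \<bullet> recv n a f \<bullet> n"
  using ax_base[OF R_suc] by (auto simp: wt_iff Val_eq opv)

lemma cls_beta: "t = bracket x \<sigma> u \<Longrightarrow> ok sp u \<Longrightarrow> v \<in> Val \<sigma> \<Longrightarrow> cls t \<bullet> v = den (upd env0 x \<sigma> v) u"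
  by (simp add: cls_den)

lemma predv [simp]: "predv zerov = zerov" "a \<in> NV \<Longrightarrow> predv (sucv a) = a"
  unfolding predv_def by (simp_all add: cls_beta[OF arith_eqs(1)] opv den_upd_fresh names_simps del: bracket.simps predv_def[symmetric])

lemma addv_zero [simp]: "a \<in> NV \<Longrightarrow> a \<oplus> zerov = a"
  and addv_suc [simp]: "a \<in> NV \<Longrightarrow> b \<in> NV \<Longrightarrow> a \<oplus> sucv b = sucv (a \<oplus> b)"
  unfolding addv_def by (simp_all add: cls_beta[OF arith_eqs(2)] opv den_upd_fresh names_simps del: bracket.simps)

lemma monusv_zero [simp]: "a \<in> NV \<Longrightarrow> a \<ominus> zerov = a"
  and monusv_suc [simp]: "a \<in> NV \<Longrightarrow> b \<in> NV \<Longrightarrow> a \<ominus> sucv b = predv (a \<ominus> b)"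
  unfolding monusv_def by (simp_all add: cls_beta[OF arith_eqs2(1)] opv den_upd_fresh names_simps del: bracket.simps)

lemma multv_zero [simp]: "a \<in> NV \<Longrightarrow> a \<otimes> zerov = zerov"
  and multv_suc [simp]: "a \<in> NV \<Longrightarrow> b \<in> NV \<Longrightarrow> a \<otimes> sucv b = (a \<otimes> b) \<oplus> a"
  unfolding multv_def by (simp_all add: cls_beta[OF arith_eqs2(2)] opv den_upd_fresh names_simps del: bracket.simps)

lemma expv_zero [simp]: "expv zerov = sucv zerov"
  and expv_suc [simp]: "b \<in> NV \<Longrightarrow> expv (sucv b) = expv b \<oplus> expv b"
  unfolding expv_def by (simp_all add: cls_beta[OF arith_eqs2(3)] opv den_upd_fresh names_simps del: bracket.simps expv_def[symmetric])

lemma triv_zero [simp]: "triv zerov = zerov"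
  and triv_suc [simp]: "b \<in> NV \<Longrightarrow> triv (sucv b) = triv b \<oplus> sucv b"
  unfolding triv_def by (simp_all add: cls_beta[OF arith_eqs2(4)] opv den_upd_fresh names_simps del: bracket.simps triv_def[symmetric])

lemma pairv: "a \<in> NV \<Longrightarrow> b \<in> NV \<Longrightarrow> pairv a b = triv (a \<oplus> b) \<oplus> a"
  unfolding pairv_def by (simp add: cls_beta[OF arith_eqs3(1)] opv den_upd_fresh names_simps del: bracket.simps)

lemma rootv_zero [simp]: "rootv zerov = zerov"
  and rootv_suc: "b \<in> NV \<Longrightarrow>
    rootv (sucv b) = rootv b \<oplus> (sucv zerov \<ominus> (triv (sucv (rootv b)) \<ominus> sucv b))"
  unfolding rootv_def by (simp_all add: cls_beta[OF arith_eqs3(2)] opv den_upd_fresh names_simps del: bracket.simps rootv_def[symmetric])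

lemma fstv: "a \<in> NV \<Longrightarrow> fstv a = a \<ominus> triv (rootv a)"
  unfolding fstv_def by (simp add: cls_beta[OF arith_eqs4(1)] opv den_upd_fresh names_simps del: bracket.simps fstv_def[symmetric])

lemma sndv: "a \<in> NV \<Longrightarrow> sndv a = rootv a \<ominus> fstv a"
  unfolding sndv_def by (simp add: cls_beta[OF arith_eqs5(1)] opv den_upd_fresh names_simps del: bracket.simps sndv_def[symmetric])

subsection \<open>Induction\<close>

text \<open>Induction is a schema over formulas, so predicates on values must be shown to come from
  formulas. A term with one loose index and arbitrary free variables gives a function with
  parameters; the introduction rules turn definability into proof search.\<close>

definition tmd :: "ty \<Rightarrow> (tm set \<Rightarrow> tm set) \<Rightarrow> bool" where
  "tmd \<tau> f \<longleftrightarrow> (\<exists>s. wt sp [N] s \<tau> \<and> (\<forall>t\<in>D N. f (den env0 t) = den env0 (open_tm 0 [t] s)))"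

definition qfd :: "(tm set \<Rightarrow> bool) \<Rightarrow> bool" where
  "qfd P \<longleftrightarrow> (\<exists>A. qfree A \<and> wf sp [N] A \<and> (\<forall>t\<in>D N. P (den env0 t) \<longleftrightarrow> ev (inst A [t])))"

lemma tmd_id [intro!]: "tmd N (\<lambda>v. v)"
  unfolding tmd_def by (rule exI[of _ "Bound 0"]) (use wt.intros(2)[of 0 "[N]"] in simp)

lemma tmd_const [intro!]: "v \<in> Val \<tau> \<Longrightarrow> tmd \<tau> (\<lambda>_. v)"
proof -
  assume "v \<in> Val \<tau>"
  then obtain t where t: "t \<in> D \<tau>" "v = den env0 t" by (auto simp: Val_eq)
  then have "wt sp [N] t \<tau>" using wt_weaken[of sp "[]" t \<tau> "[N]"] by (simp add: wt_iff)
  then show ?thesis unfolding tmd_def using t ok_lc[of sp t] by (auto simp: lc_def intro!: exI[of _ t])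
qed

lemma tmd_ap: "tmd (\<sigma> \<rightarrow> \<tau>) f \<Longrightarrow> tmd \<sigma> g \<Longrightarrow> tmd \<tau> (\<lambda>v. f v \<bullet> g v)"
  unfolding tmd_def
proof (elim exE conjE)
  fix s u
  assume "wt sp [N] s (\<sigma> \<rightarrow> \<tau>)" "\<forall>t\<in>D N. f (den env0 t) = den env0 (open_tm 0 [t] s)"
    "wt sp [N] u \<sigma>" "\<forall>t\<in>D N. g (den env0 t) = den env0 (open_tm 0 [t] u)"
  then show "\<exists>s. wt sp [N] s \<tau> \<and> (\<forall>t\<in>D N. f (den env0 t) \<bullet> g (den env0 t) = den env0 (open_tm 0 [t] s))"
    by (intro exI[of _ "s \<cdot> u"]) (auto intro: wt.intros simp del: Tm_iff)
qed

lemma tmd_ops [intro!]: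
  "tmd N f \<Longrightarrow> tmd N (\<lambda>v. sucv (f v))"
  "tmd N f \<Longrightarrow> tmd N (\<lambda>v. predv (f v))"
  "tmd N f \<Longrightarrow> tmd N g \<Longrightarrow> tmd N (\<lambda>v. f v \<oplus> g v)"
  "tmd N f \<Longrightarrow> tmd N g \<Longrightarrow> tmd N (\<lambda>v. f v \<ominus> g v)"
  "tmd N f \<Longrightarrow> tmd N g \<Longrightarrow> tmd N (\<lambda>v. f v \<otimes> g v)"
  "tmd N f \<Longrightarrow> tmd N (\<lambda>v. expv (f v))"
  "tmd N f \<Longrightarrow> tmd N (\<lambda>v. triv (f v))"
  "tmd N f \<Longrightarrow> tmd N g \<Longrightarrow> tmd N (\<lambda>v. pairv (f v) (g v))"
  "tmd N f \<Longrightarrow> tmd N (\<lambda>v. rootv (f v))"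
  "tmd N f \<Longrightarrow> tmd N (\<lambda>v. fstv (f v))"
  "tmd N f \<Longrightarrow> tmd N (\<lambda>v. sndv (f v))"
  unfolding sucv_def predv_def addv_def monusv_def multv_def expv_def triv_def pairv_def rootv_def
    fstv_def sndv_def
  by (auto intro!: tmd_ap[of N N] tmd_ap[of N "N \<rightarrow> N"] tmd_const)

lemma qfd_eq [intro!]:
  assumes "tmd N f" "tmd N g" shows "qfd (\<lambda>v. f v = g v)"
proof -
  obtain s u where "wt sp [N] s N" "wt sp [N] u N"
    and f: "\<forall>t\<in>D N. f (den env0 t) = den env0 (open_tm 0 [t] s)"
    and g: "\<forall>t\<in>D N. g (den env0 t) = den env0 (open_tm 0 [t] u)"
    using assms unfolding tmd_def by blast
  moreover from this have "wt sp [] (open_tm 0 [t] s) N" "wt sp [] (open_tm 0 [t] u) N" if "t \<in> D N" for t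
    using that wt_open[of sp "[]" "[N]" _ N "[t]"] by (auto simp: wt_iff)
  ultimately show ?thesis unfolding qfd_def
    by (intro exI[of _ "s \<doteq> u"]) (simp add: wt_iff)
qed

lemma qfd_False [intro!]: "qfd (\<lambda>v. False)"
  unfolding qfd_def by (rule exI[of _ Fls]) auto

lemma qfd_imp [intro!]: "qfd P \<Longrightarrow> qfd Q \<Longrightarrow> qfd (\<lambda>v. P v \<longrightarrow> Q v)"
  unfolding qfd_def
proof (elim exE conjE)
  fix A B
  assume "qfree A" "wf sp [N] A" "\<forall>t\<in>D N. P (den env0 t) \<longleftrightarrow> ev (inst A [t])"
    "qfree B" "wf sp [N] B" "\<forall>t\<in>D N. Q (den env0 t) \<longleftrightarrow> ev (inst B [t])"
  then show "\<exists>A. qfree A \<and> wf sp [N] A \<and> (\<forall>t\<in>D N. (P (den env0 t) \<longrightarrow> Q (den env0 t)) \<longleftrightarrow> ev (inst A [t]))"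
    by (intro exI[of _ "A \<^bold>\<longrightarrow> B"]) (auto simp del: Tm_iff)
qed

lemma qfd_not [intro!]: "qfd P \<Longrightarrow> qfd (\<lambda>v. \<not> P v)"
  using qfd_imp[OF _ qfd_False] by simp

lemma qfd_conj [intro!]: "qfd P \<Longrightarrow> qfd Q \<Longrightarrow> qfd (\<lambda>v. P v \<and> Q v)"
  using qfd_not[OF qfd_imp[OF _ qfd_not[of Q]], of P] by simp

lemma qfd_disj [intro!]: "qfd P \<Longrightarrow> qfd Q \<Longrightarrow> qfd (\<lambda>v. P v \<or> Q v)"
  using qfd_imp[OF qfd_not[of P], of Q] by (simp add: disj_imp)

lemma QF_induct [consumes 1, case_names zero suc qfd]:
  assumes "n \<in> NV" "P zerov" "\<And>n. n \<in> NV \<Longrightarrow> P n \<Longrightarrow> P (sucv n)" "qfd P"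
  shows "P n"
proof -
  obtain A where A: "qfree A" "wf sp [N] A" and P: "\<forall>t\<in>D N. P (den env0 t) \<longleftrightarrow> ev (inst A [t])"
    using assms(4) unfolding qfd_def by blast
  have RF1: "RF (Suc 0) (\<lambda>us. inst A [hd us])" using A by (intro RF_inst_hd)
  have RF2: "RF (Suc 0) (\<lambda>us. inst A [suc (hd us)])"
    unfolding RF_def
    by (intro exI[of _ "open_fm 0 [suc (Bound 0)] A"])
      (auto simp only: length_Suc_conv length_0_conv list.sel lc_simps intro!: open_App_qfree[OF A(2,1)])
  have "ev (inst A [zro] \<^bold>\<longrightarrow> fall N (\<lambda>x. inst A [x] \<^bold>\<longrightarrow> inst A [suc x]) \<^bold>\<longrightarrow> fall N (\<lambda>x. inst A [x]))"
    by (rule ax_base[OF QF_IND[OF A]]) (use A in \<open>auto simp: wf_inst wt_iff\<close>)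
  then have "ev (inst A [zro]) \<longrightarrow> (\<forall>t\<in>D N. ev (inst A [t]) \<longrightarrow> ev (inst A [suc t])) \<longrightarrow> (\<forall>t\<in>D N. ev (inst A [t]))"
    by (simp (no_asm_use) add: RF1 RF2 del: Tm_iff)
  moreover have "ev (inst A [zro])"
    using assms(2) P[rule_format, of zro] by (simp add: opv)
  moreover have "ev (inst A [suc t])" if "t \<in> D N" "ev (inst A [t])" for t
  proof -
    have "P (sucv (den env0 t))" using assms(3)[of "den env0 t"] P that by simp
    then show ?thesis using P[rule_format, of "suc t"] that by (simp add: sucv_def)
  qed
  ultimately have "\<forall>t\<in>D N. ev (inst A [t])" by blast
  then show "P n" using P assms(1) by (auto simp: Val_eq)
qed

subsection \<open>The discretely ordered semiring of numbers\<close>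

lemma zero_addv [simp]: "a \<in> NV \<Longrightarrow> zerov \<oplus> a = a"
  by (erule QF_induct) auto

lemma suc_addv [simp]: "b \<in> NV \<Longrightarrow> a \<in> NV \<Longrightarrow> sucv a \<oplus> b = sucv (a \<oplus> b)"
  by (erule QF_induct) auto

lemma addv_comm: "b \<in> NV \<Longrightarrow> a \<in> NV \<Longrightarrow> a \<oplus> b = b \<oplus> a"
  by (erule QF_induct) auto

lemma addv_assoc: "c \<in> NV \<Longrightarrow> a \<in> NV \<Longrightarrow> b \<in> NV \<Longrightarrow> a \<oplus> b \<oplus> c = a \<oplus> (b \<oplus> c)"
  by (erule QF_induct) auto

lemma NV_cases: "a \<in> NV \<Longrightarrow> a = zerov \<or> a = sucv (predv a)"
  by (erule QF_induct) auto

lemma NV_casesE: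
  assumes "a \<in> NV" obtains "a = zerov" | b where "b \<in> NV" "a = sucv b"
  using NV_cases[OF assms] assms by (metis NV_closed(3))

lemma zero_multv [simp]: "a \<in> NV \<Longrightarrow> zerov \<otimes> a = zerov"
  by (erule QF_induct) auto

lemma addv_lcomm: "a \<in> NV \<Longrightarrow> b \<in> NV \<Longrightarrow> c \<in> NV \<Longrightarrow> a \<oplus> (b \<oplus> c) = b \<oplus> (a \<oplus> c)"
  using addv_assoc addv_comm by metis

lemma suc_multv [simp]: "b \<in> NV \<Longrightarrow> a \<in> NV \<Longrightarrow> sucv a \<otimes> b = (a \<otimes> b) \<oplus> b"
proof (erule QF_induct, goal_cases)
  case (2 b)
  then show ?case by (simp add: addv_assoc addv_comm[of b a])
qed auto

lemma multv_comm: "b \<in> NV \<Longrightarrow> a \<in> NV \<Longrightarrow> a \<otimes> b = b \<otimes> a"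
  by (erule QF_induct) auto

lemma addv_multv: "c \<in> NV \<Longrightarrow> a \<in> NV \<Longrightarrow> b \<in> NV \<Longrightarrow> (a \<oplus> b) \<otimes> c = a \<otimes> c \<oplus> b \<otimes> c"
  by (erule QF_induct) (auto simp: addv_assoc addv_lcomm)

lemma multv_addv: "c \<in> NV \<Longrightarrow> a \<in> NV \<Longrightarrow> b \<in> NV \<Longrightarrow> c \<otimes> (a \<oplus> b) = c \<otimes> a \<oplus> c \<otimes> b"
  using addv_multv[of c a b] by (simp add: multv_comm)

lemma multv_assoc: "c \<in> NV \<Longrightarrow> a \<in> NV \<Longrightarrow> b \<in> NV \<Longrightarrow> a \<otimes> b \<otimes> c = a \<otimes> (b \<otimes> c)"
  by (erule QF_induct) (auto simp: multv_addv)

lemma suc_monusv [simp]: "b \<in> NV \<Longrightarrow> a \<in> NV \<Longrightarrow> sucv a \<ominus> sucv b = a \<ominus> b"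
  by (erule QF_induct) auto

lemma monusv_self [simp]: "a \<in> NV \<Longrightarrow> a \<ominus> a = zerov"
  by (erule QF_induct) (auto simp del: monusv_suc)

lemma zero_monusv [simp]: "a \<in> NV \<Longrightarrow> zerov \<ominus> a = zerov"
  by (erule QF_induct) auto

lemma addv_monusv [simp]: "b \<in> NV \<Longrightarrow> a \<in> NV \<Longrightarrow> a \<oplus> b \<ominus> b = a"
  by (erule QF_induct) (auto simp del: monusv_suc)

lemma monusv_addv: "c \<in> NV \<Longrightarrow> a \<in> NV \<Longrightarrow> b \<in> NV \<Longrightarrow> a \<ominus> (b \<oplus> c) = a \<ominus> b \<ominus> c"
  by (erule QF_induct) auto

text \<open>Subtraction is either truncated or exact. As a disjunction of equations this is open to
  quantifier-free induction.\<close>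

lemma monusv_add_back: "b \<in> NV \<Longrightarrow> a \<in> NV \<Longrightarrow> a \<ominus> b = zerov \<or> a \<ominus> b \<oplus> b = a"
proof (erule QF_induct, goal_cases)
  case (2 b)
  define c where "c = predv (a \<ominus> b)"
  show ?case
  proof (cases "a \<ominus> b = zerov")
    case True
    then show ?thesis using 2 by simp
  next
    case False
    then have c: "c \<in> NV" "a \<ominus> b = sucv c" using 2 NV_cases[of "a \<ominus> b"] by (auto simp: c_def)
    then have "sucv c \<oplus> b = a" using 2 False by metis
    then show ?thesis using c 2 by simp
  qed
qed auto

lemma monusv_antisym:
  "b \<in> NV \<Longrightarrow> a \<in> NV \<Longrightarrow> b \<ominus> a = zerov \<Longrightarrow> a \<ominus> b = zerov \<Longrightarrow> b = a"
proof -
  have "b \<in> NV \<Longrightarrow> a \<in> NV \<Longrightarrow> b \<ominus> a = zerov \<and> a \<ominus> b = zerov \<longrightarrow> b = a" for b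
  proof (erule QF_induct, goal_cases)
    case suc: (2 b)
    show ?case
    proof
      assume *: "sucv b \<ominus> a = zerov \<and> a \<ominus> sucv b = zerov"
      have "b \<ominus> a = zerov"
        using * suc suc_monusv[of a b] monusv_suc[of "sucv b" a] by (metis NV_closed(2) predv(1))
      \<comment> \<open>If \<open>a \<ominus> b\<close> vanishes, then \<open>b = a\<close> by
        induction and \<open>sucv a \<ominus> a\<close> would be 0 instead of 1; otherwise
        \<open>a \<ominus> b\<close> has predecessor 0, so it is 1.\<close>
      show "sucv b = a"
      proof (cases "a \<ominus> b = zerov")
        case True
        then have "a \<ominus> b = zerov" using \<open>b \<ominus> a = zerov\<close> suc * by auto
        then have "sucv b \<ominus> b = zerov" using suc * \<open>b \<ominus> a = zerov\<close> by auto
        moreover have "sucv zerov \<oplus> b \<ominus> b = sucv zerov" using suc by (intro addv_monusv) auto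
        ultimately show ?thesis using suc by simp
      next
        case False
        then have "a \<ominus> b = sucv (predv (a \<ominus> b))" using NV_cases[of "a \<ominus> b"] suc by simp
        also have "predv (a \<ominus> b) = zerov" using * suc by simp
        finally have "sucv zerov \<oplus> b = a" using False monusv_add_back[of b a] suc by simp
        then show ?thesis using suc by simp
      qed
    qed
  qed auto
  then show "b \<in> NV \<Longrightarrow> a \<in> NV \<Longrightarrow> b \<ominus> a = zerov \<Longrightarrow> a \<ominus> b = zerov \<Longrightarrow> b = a" by blast
qed

lemma monusv_total: "a \<in> NV \<Longrightarrow> b \<in> NV \<Longrightarrow> a \<ominus> b = zerov \<or> b \<ominus> a = zerov"
proof -
  assume ab: "a \<in> NV" "b \<in> NV"
  have "b \<ominus> a = zerov" if "a \<ominus> b \<oplus> b = a"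
  proof -
    have "b \<ominus> (b \<oplus> (a \<ominus> b)) = zerov" using ab by (subst monusv_addv) auto
    then show ?thesis using that ab by (simp add: addv_comm)
  qed
  then show ?thesis using monusv_add_back[of b a] ab by blast
qed

text \<open>Both sides are the maximum of \<open>a\<close> and \<open>b\<close>. This law makes the
  order by vanishing differences agree with the algebraic order.\<close>

lemma monusv_max: "a \<in> NV \<Longrightarrow> b \<in> NV \<Longrightarrow> a \<oplus> (b \<ominus> a) = b \<oplus> (a \<ominus> b)"
  using monusv_add_back[of a b] monusv_add_back[of b a] monusv_antisym[of a b] monusv_total[of a b]
  by (auto simp: addv_comm)

lemma addv_eq_zero: "a \<in> NV \<Longrightarrow> b \<in> NV \<Longrightarrow> a \<oplus> b = zerov \<Longrightarrow> a = zerov"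
  by (cases b rule: NV_casesE) auto

lemma multv_eq_zero: "a \<in> NV \<Longrightarrow> b \<in> NV \<Longrightarrow> a \<otimes> b = zerov \<Longrightarrow> a = zerov \<or> b = zerov"
  by (cases b rule: NV_casesE; cases a rule: NV_casesE) auto

end

section \<open>An ordered field over the numbers of a model\<close>

subsection \<open>Differences\<close>

definition diff_rel :: "'a::linordered_semidom \<times> 'a \<Rightarrow> 'a \<times> 'a \<Rightarrow> bool" where
  "diff_rel = (\<lambda>(a, b) (c, d). a + d = c + b)"

quotient_type (overloaded) 'a diff = "'a::linordered_semidom \<times> 'a" / diff_rel
  morphisms diff_rep diff_class
proof (rule equivpI)
  show "reflp (diff_rel :: 'a \<times> 'a \<Rightarrow> _)" by (auto simp: reflp_def diff_rel_def)
  show "symp (diff_rel :: 'a \<times> 'a \<Rightarrow> _)" by (auto simp: symp_def diff_rel_def)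
  show "transp (diff_rel :: 'a \<times> 'a \<Rightarrow> _)"
  proof (rule transpI, clarsimp simp: diff_rel_def)
    fix a b c d e f :: 'a
    assume "a + d = c + b" "c + f = e + d"
    then have "(a + f) + (c + d) = (e + b) + (c + d)" by (metis add.assoc add.commute)
    then show "a + f = e + b" by simp
  qed
qed

text \<open>Multiplication respects a change of representative in one factor; two such changes are
  composed by \<open>add_cancel_aux\<close>.\<close>

lemma mult_diff_aux:
  fixes a b c d :: "'a::linordered_semidom"
  assumes "a + d = c + b"
  shows "(a * e + b * f) + (c * f + d * e) = (c * e + d * f) + (a * f + b * e)"
proof -
  have "(a + d) * e + (c + b) * f = (c + b) * e + (a + d) * f" using assms by simp
  then show ?thesis by (simp add: algebra_simps)
qed

lemma add_cancel_aux:
  fixes p q r s x y :: "'a::cancel_comm_monoid_add"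
  assumes "p + q = r + s" "r + x = y + q"
  shows "p + x = y + s"
proof -
  have "(p + x) + (q + r) = (p + q) + (r + x)" by (simp only: ac_simps)
  also have "\<dots> = (y + s) + (q + r)" unfolding assms by (simp only: ac_simps)
  finally show ?thesis by simp
qed

instantiation diff :: (linordered_semidom) linordered_idom
begin

lift_definition zero_diff :: "'a diff" is "(0, 0)" .
lift_definition one_diff :: "'a diff" is "(1, 0)" .
lift_definition plus_diff :: "'a diff \<Rightarrow> 'a diff \<Rightarrow> 'a diff" is "\<lambda>(a, b) (c, d). (a + c, b + d)"
proof (clarsimp simp: diff_rel_def)
  fix a b c d a' b' c' d' :: 'a
  assume "a + b' = a' + b" "c + d' = c' + d"
  then have "(a + b') + (c + d') = (a' + b) + (c' + d)" by simp
  then show "a + c + (b' + d') = a' + c' + (b + d)" by (simp only: ac_simps)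
qed
lift_definition uminus_diff :: "'a diff \<Rightarrow> 'a diff" is "\<lambda>(a, b). (b, a)"
  by (auto simp: diff_rel_def algebra_simps)
lift_definition times_diff :: "'a diff \<Rightarrow> 'a diff \<Rightarrow> 'a diff"
  is "\<lambda>(a, b) (c, d). (a * c + b * d, a * d + b * c)"
proof (clarsimp simp: diff_rel_def)
  fix a b c d a' b' c' d' :: 'a
  assume h: "a + b' = a' + b" "c + d' = c' + d"
  have "(a * c + b * d) + (a' * d + b' * c) = (a' * c + b' * d) + (a * d + b * c)"
    by (rule mult_diff_aux[OF h(1)])
  moreover have "(a' * c + b' * d) + (a' * d' + b' * c') = (a' * c' + b' * d') + (a' * d + b' * c)"
    using mult_diff_aux[OF h(2), of a' b'] by (simp add: mult.commute add.commute)
  ultimately show "a * c + b * d + (a' * d' + b' * c') = a' * c' + b' * d' + (a * d + b * c)"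
    by (rule add_cancel_aux)
qed
lift_definition less_eq_diff :: "'a diff \<Rightarrow> 'a diff \<Rightarrow> bool" is "\<lambda>(a, b) (c, d). a + d \<le> c + b"
proof (clarsimp simp: diff_rel_def)
  fix a b c d a' b' c' d' :: 'a
  assume *: "a + b' = a' + b" "c + d' = c' + d"
  have "a + d \<le> c + b \<longleftrightarrow> (a + d) + (b' + d') \<le> (c + b) + (b' + d')" by simp
  also have "(a + d) + (b' + d') = (a + b') + (d + d')" by (simp only: ac_simps)
  also have "\<dots> = (a' + d') + (b + d)" unfolding * by (simp only: ac_simps)
  also have "(c + b) + (b' + d') = (c + d') + (b + b')" by (simp only: ac_simps)
  also have "\<dots> = (c' + b') + (b + d)" unfolding * by (simp only: ac_simps)
  finally show "a + d \<le> c + b \<longleftrightarrow> a' + d' \<le> c' + b'" by simp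
qed
definition minus_diff :: "'a diff \<Rightarrow> 'a diff \<Rightarrow> 'a diff" where "minus_diff x y = x + - y"
definition less_diff :: "'a diff \<Rightarrow> 'a diff \<Rightarrow> bool" where "less_diff x y \<longleftrightarrow> x \<le> y \<and> \<not> y \<le> x"
definition abs_diff :: "'a diff \<Rightarrow> 'a diff" where "abs_diff x = (if x < 0 then - x else x)"
definition sgn_diff :: "'a diff \<Rightarrow> 'a diff" where "sgn_diff x = (if x = 0 then 0 else if 0 < x then 1 else - 1)"

instance
proof
  fix x y z :: "'a diff"
  show "x + y + z = x + (y + z)" by transfer (auto simp: diff_rel_def algebra_simps)
  show "x + y = y + x" by transfer (auto simp: diff_rel_def algebra_simps)
  show "0 + x = x" by transfer (auto simp: diff_rel_def)
  show "- x + x = 0" by transfer (auto simp: diff_rel_def algebra_simps)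
  show "x - y = x + - y" by (fact minus_diff_def)
  show "x + y - x = y" "x - y - z = x - (y + z)"
    unfolding minus_diff_def by (transfer; auto simp: diff_rel_def algebra_simps)+
  show "0 * x = 0" "x * 0 = 0" by (transfer; auto simp: diff_rel_def)+
  show "x * y * z = x * (y * z)" by transfer (auto simp: diff_rel_def algebra_simps)
  show "x * y = y * x" by transfer (auto simp: diff_rel_def algebra_simps)
  show "1 * x = x" by transfer (auto simp: diff_rel_def)
  show "(x + y) * z = x * z + y * z" by transfer (auto simp: diff_rel_def algebra_simps)
  show "(0::'a diff) \<noteq> 1" by transfer (auto simp: diff_rel_def)
  show "x < y \<longleftrightarrow> x \<le> y \<and> \<not> y \<le> x" by (fact less_diff_def)
  show "x \<le> x" by transfer auto
  show "x \<le> y \<Longrightarrow> y \<le> z \<Longrightarrow> x \<le> z"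
  proof (transfer, clarsimp)
    fix a b c d e f :: 'a
    assume "a + d \<le> c + b" "c + f \<le> e + d"
    then have "(a + d) + (c + f) \<le> (c + b) + (e + d)" by (rule add_mono)
    then have "(a + f) + (c + d) \<le> (e + b) + (c + d)" by (simp add: algebra_simps)
    then show "a + f \<le> e + b" by simp
  qed
  show "x \<le> y \<Longrightarrow> y \<le> x \<Longrightarrow> x = y" by transfer (auto simp: diff_rel_def)
  show "x \<le> y \<or> y \<le> x" by transfer auto
  show "x \<le> y \<Longrightarrow> z + x \<le> z + y" 
  proof (transfer, clarsimp)
    fix a b c d e f :: 'a
    assume "a + d \<le> c + b"
    then have "(a + d) + (e + f) \<le> (c + b) + (e + f)" by simp
    then show "e + a + (f + d) \<le> e + c + (f + b)" by (simp add: algebra_simps)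
  qed
  show "x < y \<Longrightarrow> 0 < z \<Longrightarrow> z * x < z * y"
    unfolding less_diff_def
  proof (transfer, clarsimp simp: not_le, goal_cases)
    case (1 a b c d e f)
    then have *: "a + d < c + b" "f < e" by auto
    \<comment> \<open>With \<open>e = f + v\<close> the contributions of \<open>f\<close> are the
      same on both sides, and only multiplication by the positive \<open>v\<close> remains.\<close>
    define v where "v = e - f"
    have e: "e = f + v" using * by (simp add: v_def)
    then have "0 < v" using * by simp
    then have "v * (a + d) + (f * (a + d) + f * (c + b)) < v * (c + b) + (f * (a + d) + f * (c + b))"
      using * by (simp add: mult_strict_left_mono)
    then have "e * a + f * b + (e * d + f * c) < e * c + f * d + (e * b + f * a)"
      unfolding e by (simp only: distrib_left distrib_right ac_simps)
    then show ?case by simp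
  qed
  show "\<bar>x\<bar> = (if x < 0 then - x else x)" by (fact abs_diff_def)
  show "sgn x = (if x = 0 then 0 else if 0 < x then 1 else - 1)" by (fact sgn_diff_def)
qed

end

lift_definition diff_of :: "'a::linordered_semidom \<Rightarrow> 'a diff" is "\<lambda>a. (a, 0)" .

lemma diff_of_hom:
  "diff_of 0 = 0" "diff_of 1 = 1" "diff_of (a + b) = diff_of a + diff_of b"
  "diff_of (a * b) = diff_of a * diff_of b"
  by (transfer, simp add: diff_rel_def)+

lemma diff_of_le [simp]: "diff_of a \<le> diff_of b \<longleftrightarrow> a \<le> b"
  by transfer simp

definition frac_of :: "'a::linordered_semidom \<Rightarrow> 'a diff fract" where
  "frac_of a = Fract (diff_of a) 1"

lemma frac_of_hom [simp]:
  "frac_of 0 = 0" "frac_of 1 = 1" "frac_of (a + b) = frac_of a + frac_of b"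
  "frac_of (a * b) = frac_of a * frac_of b"
  by (auto simp: frac_of_def diff_of_hom Zero_fract_def One_fract_def)

lemma frac_of_le [simp]: "frac_of a \<le> frac_of b \<longleftrightarrow> a \<le> b"
  by (simp add: frac_of_def)

lemma frac_of_inj [simp]: "frac_of a = frac_of b \<longleftrightarrow> a = b"
  by (simp add: order_eq_iff)

subsection \<open>Numbers of a model\<close>

text \<open>Carrier, zero, one, addition, multiplication and truncated subtraction.\<close>

type_synonym 'v num_struct =
  "'v set \<times> 'v \<times> 'v \<times> ('v \<Rightarrow> 'v \<Rightarrow> 'v) \<times> ('v \<Rightarrow> 'v \<Rightarrow> 'v) \<times> ('v \<Rightarrow> 'v \<Rightarrow> 'v)"

locale nat_like =
  fixes C :: "'v set" and z e :: 'v and p t m :: "'v \<Rightarrow> 'v \<Rightarrow> 'v"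
  assumes closed: "z \<in> C" "e \<in> C" "\<lbrakk>a \<in> C; b \<in> C\<rbrakk> \<Longrightarrow> p a b \<in> C" "\<lbrakk>a \<in> C; b \<in> C\<rbrakk> \<Longrightarrow> t a b \<in> C"
      "\<lbrakk>a \<in> C; b \<in> C\<rbrakk> \<Longrightarrow> m a b \<in> C"
    and zero_one: "z \<noteq> e"
    and add_zero: "a \<in> C \<Longrightarrow> p z a = a"
    and mult_zero: "a \<in> C \<Longrightarrow> t z a = z"
    and mult_one: "a \<in> C \<Longrightarrow> t e a = a"
    and add_comm: "\<lbrakk>a \<in> C; b \<in> C\<rbrakk> \<Longrightarrow> p a b = p b a"
    and mult_comm: "\<lbrakk>a \<in> C; b \<in> C\<rbrakk> \<Longrightarrow> t a b = t b a"
    and add_monus: "\<lbrakk>a \<in> C; b \<in> C\<rbrakk> \<Longrightarrow> m (p a b) b = a"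
    and max_comm: "\<lbrakk>a \<in> C; b \<in> C\<rbrakk> \<Longrightarrow> p a (m b a) = p b (m a b)"
    and total: "\<lbrakk>a \<in> C; b \<in> C\<rbrakk> \<Longrightarrow> m a b = z \<or> m b a = z"
    and add_eq_zero: "\<lbrakk>a \<in> C; b \<in> C; p a b = z\<rbrakk> \<Longrightarrow> a = z"
    and mult_eq_zero: "\<lbrakk>a \<in> C; b \<in> C; t a b = z\<rbrakk> \<Longrightarrow> a = z \<or> b = z"
    and add_assoc: "\<lbrakk>a \<in> C; b \<in> C; c \<in> C\<rbrakk> \<Longrightarrow> p (p a b) c = p a (p b c)"
    and mult_assoc: "\<lbrakk>a \<in> C; b \<in> C; c \<in> C\<rbrakk> \<Longrightarrow> t (t a b) c = t a (t b c)"
    and distrib: "\<lbrakk>a \<in> C; b \<in> C; c \<in> C\<rbrakk> \<Longrightarrow> t (p a b) c = p (t a c) (t b c)"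
    and monus_add: "\<lbrakk>a \<in> C; b \<in> C; c \<in> C\<rbrakk> \<Longrightarrow> m a (p b c) = m (m a b) c"

definition nat_struct :: "'v num_struct \<Rightarrow> bool" where
  "nat_struct = (\<lambda>(C, z, e, p, t, m). nat_like C z e p t m)"

definition (in model) numbers :: "tm set num_struct" where
  "numbers = (NV, zerov, sucv zerov, addv, multv, monusv)"

lemma (in model) nat_like_numbers: "nat_struct numbers"
  unfolding nat_struct_def numbers_def prod.case
  by unfold_locales
    ((simp add: addv_assoc multv_assoc addv_multv monusv_addv; fail)
     | (rule addv_comm multv_comm monusv_max monusv_total; assumption)
     | (auto dest: addv_eq_zero multv_eq_zero))+

text \<open>
  The ordered field of a model depends on the model, but a type cannot depend on a term.  It
  suffices to reason in one hypothetical countermodel, so the type of numbers is defined from a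
  countermodel if there is one, and from the natural numbers otherwise.
\<close>

definition equivalences :: "fm list" where
  "equivalences = [exists2 \<^bold>\<longleftrightarrow> Pi01_TRANS, Pi01_TRANS \<^bold>\<longleftrightarrow> IVT_star, IVT_star \<^bold>\<longleftrightarrow> UIVT]"

definition countermodel :: "spec \<times> (fm \<Rightarrow> bool) \<Rightarrow> bool" where
  "countermodel = (\<lambda>(sp, at). admissible sp \<and> model sp at \<and> (\<exists>A\<in>set equivalences. \<not> truth sp at A))"

text \<open>The fallback must have the type of the numbers of a model, whose elements are sets of
  terms; the singleton of \<open>Bound n\<close> stands for \<open>n\<close>.\<close>

definition nats :: "tm set num_struct" where
  "nats = (let e = (\<lambda>n. {Bound n}); d = inv e; op = (\<lambda>f X Y. e (f (d X) (d Y)))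
     in (range e, e 0, e 1, op (+), op (*), op (-)))"

lemma nat_like_nats: "nat_struct nats"
proof -
  define e :: "nat \<Rightarrow> tm set" where "e n = {Bound n}" for n
  define d where "d = inv e"
  have [simp]: "d (e n) = n" for n unfolding d_def by (rule inv_f_f) (simp add: inj_def e_def)
  have [simp]: "e m = e n \<longleftrightarrow> m = n" for m n by (simp add: e_def)
  have "e = (\<lambda>n. {Bound n})" by (simp add: e_def fun_eq_iff)
  then have eq: "nats = (range e, e 0, e 1, \<lambda>X Y. e (d X + d Y), \<lambda>X Y. e (d X * d Y), \<lambda>X Y. e (d X - d Y))"
    by (simp add: nats_def Let_def d_def)
  show ?thesis
    unfolding nat_struct_def eq by (simp only: prod.case, unfold_locales) (auto simp: add_mult_distrib)
qed

definition the_countermodel :: "spec \<times> (fm \<Rightarrow> bool)" where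
  "the_countermodel = (SOME M. countermodel M)"

definition the_numbers :: "tm set num_struct" where
  "the_numbers = (if Ex countermodel then case the_countermodel of (sp, at) \<Rightarrow> model.numbers sp at else nats)"

lemma nat_like_the_numbers: "nat_struct the_numbers"
proof (cases "Ex countermodel")
  case True
  then have "countermodel the_countermodel" unfolding the_countermodel_def by (rule someI_ex)
  then show ?thesis
    using True by (auto simp: the_numbers_def countermodel_def split_beta intro: model.nat_like_numbers)
qed (simp add: the_numbers_def nat_like_nats)

definition "num_carrier = fst the_numbers"
definition "num_zero = fst (snd the_numbers)"
definition "num_one = fst (snd (snd the_numbers))"
definition "num_add = fst (snd (snd (snd the_numbers)))"
definition "num_mult = fst (snd (snd (snd (snd the_numbers))))"
definition "num_monus = snd (snd (snd (snd (snd the_numbers))))"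

interpretation num: nat_like num_carrier num_zero num_one num_add num_mult num_monus
  using nat_like_the_numbers
  by (simp add: nat_struct_def split_beta num_carrier_def num_zero_def num_one_def num_add_def
      num_mult_def num_monus_def)

typedef number = num_carrier
  using num.closed by blast

setup_lifting type_definition_number

instantiation number :: linordered_semidom
begin

lift_definition zero_number :: number is num_zero by (rule num.closed)
lift_definition one_number :: number is num_one by (rule num.closed)
lift_definition plus_number :: "number \<Rightarrow> number \<Rightarrow> number" is num_add by (rule num.closed)
lift_definition times_number :: "number \<Rightarrow> number \<Rightarrow> number" is num_mult by (rule num.closed)
lift_definition minus_number :: "number \<Rightarrow> number \<Rightarrow> number" is num_monus by (rule num.closed)
definition less_eq_number :: "number \<Rightarrow> number \<Rightarrow> bool" where "less_eq_number a b \<longleftrightarrow> a - b = 0"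
definition less_number :: "number \<Rightarrow> number \<Rightarrow> bool" where "less_number a b \<longleftrightarrow> a \<le> b \<and> \<not> b \<le> a"

lemma number_laws:
  fixes a b c :: number
  shows "(0::number) \<noteq> 1" "0 + a = a" "0 * a = 0" "1 * a = a"
    "a + b = b + a" "a * b = b * a" "a + b - b = a" "a + (b - a) = b + (a - b)"
    "a - b = 0 \<or> b - a = 0" "a + b = 0 \<Longrightarrow> a = 0" "a * b = 0 \<Longrightarrow> a = 0 \<or> b = 0"
    "a + b + c = a + (b + c)" "a * b * c = a * (b * c)" "(a + b) * c = a * c + b * c"
    "a - (b + c) = a - b - c"
  by (transfer; (rule num.zero_one num.add_zero num.mult_zero num.mult_one num.add_comm num.mult_comm
        num.add_monus num.max_comm num.total num.add_eq_zero num.mult_eq_zero num.add_assoc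
        num.mult_assoc num.distrib num.monus_add; assumption))+

text \<open>If \<open>a - b\<close> vanishes, the law for maxima turns \<open>a + (b - a)\<close>
  into \<open>b\<close>. With the order in algebraic form, the order axioms reduce to
  equations.\<close>

lemma number_le: "a \<le> b \<longleftrightarrow> (\<exists>c. b = a + c)" for a b :: number
proof
  assume "a \<le> b"
  then have "b = a + (b - a)"
    using number_laws(8)[of a b] number_laws(2)[of b] number_laws(5)[of b 0] by (simp add: less_eq_number_def)
  then show "\<exists>c. b = a + c" ..
next
  have "a - a = 0" using number_laws(7)[of 0 a] number_laws(2)[of a] by simp
  moreover have "0 - c = 0" for c :: number
    using number_laws(7)[of c 0] number_laws(9)[of 0 c] number_laws(2,5) by metis
  ultimately have "a - (a + c) = 0" for c by (simp add: number_laws(15))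
  then show "\<exists>c. b = a + c \<Longrightarrow> a \<le> b" by (auto simp: less_eq_number_def)
qed

instance
proof
  fix a b c :: number
  show "a + b + c = a + (b + c)" "a + b = b + a" "0 + a = a" "a * b * c = a * (b * c)" "a * b = b * a"
    "1 * a = a" "(a + b) * c = a * c + b * c" "0 * a = 0" "(0::number) \<noteq> 1" "a - b - c = a - (b + c)"
    by (fact number_laws number_laws(15)[symmetric])+
  show "a * 0 = 0" "a + b - a = b"
    using number_laws(3)[of a] number_laws(6)[of 0 a] number_laws(7)[of b a] number_laws(5)[of a b]
    by simp_all
  have zero: "a + 0 = a" for a :: number using number_laws(2,5) by metis
  have left: "a * (b + c) = a * b + a * c" for a b c :: number
    using number_laws(14)[of b c a] by (simp only: number_laws(6)[of a])
  show "a * (b + c) = a * b + a * c" by (fact left)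
  have self: "a - (a + b) = 0" for a b :: number
    using number_le[of a "a + b"] unfolding less_eq_number_def by blast
  have cancel: "a + b - a = b" for a b :: number using number_laws(5,7) by metis
  have "b \<le> c \<or> c \<le> b" unfolding less_eq_number_def by (rule number_laws)
  \<comment> \<open>In the first case both differences are truncated to 0, in the second both sides
    equal \<open>a * d\<close>.\<close>
  then obtain d where "c = b + d \<or> b = c + d" unfolding number_le by blast
  then show "a * (b - c) = a * b - a * c"
    using number_laws(3,6) by (metis left self cancel)
  show "a < b \<longleftrightarrow> a \<le> b \<and> \<not> b \<le> a" by (fact less_number_def)
  show "a \<le> a" unfolding number_le using zero by metis
  show "a \<le> b \<Longrightarrow> b \<le> c \<Longrightarrow> a \<le> c" unfolding number_le using number_laws(12) by metis
  show antisym: "a \<le> b \<Longrightarrow> b \<le> a \<Longrightarrow> a = b" for a b :: number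
    using number_laws(8)[of a b] by (simp add: less_eq_number_def zero)
  show "a \<le> b \<or> b \<le> a" unfolding less_eq_number_def by (rule number_laws)
  show "a \<le> b \<Longrightarrow> c + a \<le> c + b" unfolding number_le using number_laws(12) by metis
  show nz: "a \<noteq> 0 \<Longrightarrow> b \<noteq> 0 \<Longrightarrow> a * b \<noteq> 0" for a b :: number using number_laws(11) by blast
  show "b \<le> a \<Longrightarrow> a - b + b = a" unfolding number_le using number_laws(5,7) by metis
  have "(0::number) \<le> 1" unfolding number_le using number_laws(2) by metis
  then show "(0::number) < 1" using antisym[of 0 1] number_laws(1) unfolding less_number_def by auto
  assume *: "a < b" "0 < c"
  then obtain d where d: "b = a + d" unfolding less_number_def number_le by blast
  have "d \<noteq> 0" using * d zero unfolding less_number_def by auto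
  moreover have "c \<noteq> 0" using * unfolding less_number_def by auto
  ultimately have cd: "c * d \<noteq> 0" using nz by blast
  have cb: "c * b = c * a + c * d" unfolding d using number_laws(6,14) by metis
  then have "c * a \<le> c * b" unfolding number_le by blast
  moreover have "\<not> c * b \<le> c * a"
  proof
    assume "c * b \<le> c * a"
    then have "c * a = c * a + c * d" using antisym \<open>c * a \<le> c * b\<close> cb by metis
    then have "c * d = 0" using number_laws(2,5,7) by metis
    then show False using cd by simp
  qed
  ultimately show "c * a < c * b" unfolding less_number_def by blast
qed

end

text \<open>These laws are all that is used of the field from here on. As the field type is a
  parameter, the arguments do not depend on how it arises from the countermodel.\<close>

locale embedded_model = model sp at for sp at +
  fixes nv :: "tm set \<Rightarrow> 'k::linordered_field"
  assumes nv_zero [simp]: "nv zerov = 0"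
    and nv_suc [simp]: "a \<in> NV \<Longrightarrow> nv (sucv a) = nv a + 1"
    and nv_add [simp]: "a \<in> NV \<Longrightarrow> b \<in> NV \<Longrightarrow> nv (a \<oplus> b) = nv a + nv b"
    and nv_mult [simp]: "a \<in> NV \<Longrightarrow> b \<in> NV \<Longrightarrow> nv (a \<otimes> b) = nv a * nv b"
    and nv_monus: "a \<in> NV \<Longrightarrow> b \<in> NV \<Longrightarrow> nv (a \<ominus> b) = max 0 (nv a - nv b)"
    and nv_inj: "a \<in> NV \<Longrightarrow> b \<in> NV \<Longrightarrow> nv a = nv b \<longleftrightarrow> a = b"
    and nv_nonneg [simp]: "a \<in> NV \<Longrightarrow> 0 \<le> nv a"

lemma embedded_the_countermodel:
  assumes "Ex countermodel" "the_countermodel = (sp, at)"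
  shows "embedded_model sp at (\<lambda>X. frac_of (Abs_number X))"
proof -
  have "countermodel (sp, at)"
    unfolding assms(2)[symmetric] the_countermodel_def using assms(1) by (rule someI_ex)
  then interpret model sp at by (simp add: countermodel_def)
  have eq: "the_numbers = numbers" using assms(1) unfolding the_numbers_def assms(2) by (simp only: if_True prod.case)
  have C: "num_carrier = NV" and z: "num_zero = zerov" and e: "num_one = sucv zerov"
    and p: "num_add = addv" and t: "num_mult = multv" and m: "num_monus = monusv"
    by (simp_all add: num_carrier_def num_zero_def num_one_def num_add_def num_mult_def
        num_monus_def eq numbers_def)
  let ?A = Abs_number
  have R: "Rep_number (?A a) = a" if "a \<in> NV" for a
    using that C by (simp add: Abs_number_inverse)
  have hom: "?A zerov = 0" "?A (sucv zerov) = 1" "a \<in> NV \<Longrightarrow> b \<in> NV \<Longrightarrow> ?A (a \<oplus> b) = ?A a + ?A b"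
    "a \<in> NV \<Longrightarrow> b \<in> NV \<Longrightarrow> ?A (a \<otimes> b) = ?A a * ?A b" "a \<in> NV \<Longrightarrow> b \<in> NV \<Longrightarrow> ?A (a \<ominus> b) = ?A a - ?A b" for a b
    by (simp_all add: zero_number_def one_number_def plus_number_def times_number_def minus_number_def
        R z e p t m)
  have sub: "frac_of (a - b) = max 0 (frac_of a - frac_of b)" for a b :: number
  proof (cases "b \<le> a")
    case True
    then have "frac_of (a - b) + frac_of b = frac_of a" by (simp flip: frac_of_hom)
    then show ?thesis using True by (simp add: max_def algebra_simps)
  next
    case False
    then have "a - b = 0" using linear[of a b] by (simp add: less_eq_number_def)
    then show ?thesis using False by (simp add: max_def)
  qed
  show ?thesis
  proof
    fix a b assume ab: "a \<in> NV"
    have "sucv a = a \<oplus> sucv zerov" using ab by simp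
    then show "frac_of (?A (sucv a)) = frac_of (?A a) + 1" using ab by (simp only: hom NV_closed frac_of_hom)
    have "0 \<le> ?A a" unfolding number_le using number_laws(2) by metis
    then show "0 \<le> frac_of (?A a)" using frac_of_le[of 0 "?A a"] by simp
    assume b: "b \<in> NV"
    show "frac_of (?A a) = frac_of (?A b) \<longleftrightarrow> a = b" using R ab b by (metis frac_of_inj)
  qed (simp_all add: hom sub)
qed

section \<open>Rational numbers\<close>

lemma tyof_q [simp]:
  "tyof (qhalf s) = N" "tyof (qadd s t) = N" "tyof (qminus s) = N" "tyof (qabs s) = N" "tyof (qdist s t) = N"
  by (simp_all add: qhalf_def qadd_def qminus_def qabs_def qdist_def)

lemma ok_q [simp]:
  "ok sp s \<Longrightarrow> tyof s = N \<Longrightarrow> ok sp (qhalf s)"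
  "ok sp s \<Longrightarrow> ok sp t \<Longrightarrow> tyof s = N \<Longrightarrow> tyof t = N \<Longrightarrow> ok sp (qadd s t)"
  "ok sp s \<Longrightarrow> tyof s = N \<Longrightarrow> ok sp (qminus s)"
  "ok sp s \<Longrightarrow> tyof s = N \<Longrightarrow> ok sp (qabs s)"
  "ok sp s \<Longrightarrow> ok sp t \<Longrightarrow> tyof s = N \<Longrightarrow> tyof t = N \<Longrightarrow> ok sp (qdist s t)"
  by (simp_all add: qhalf_def qadd_def qminus_def qabs_def qdist_def)

lemma RT_q [simp]:
  "RT n f \<Longrightarrow> RT n (\<lambda>us. qhalf (f us))"
  "RT n f \<Longrightarrow> RT n g \<Longrightarrow> RT n (\<lambda>us. qadd (f us) (g us))"
  "RT n f \<Longrightarrow> RT n (\<lambda>us. qminus (f us))"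
  "RT n f \<Longrightarrow> RT n (\<lambda>us. qabs (f us))"
  "RT n f \<Longrightarrow> RT n g \<Longrightarrow> RT n (\<lambda>us. qdist (f us) (g us))"
  by (simp_all add: qhalf_def qadd_def qminus_def qabs_def qdist_def)

lemma RF_q [simp]:
  "RT n f \<Longrightarrow> RT n g \<Longrightarrow> RF n (\<lambda>us. qle (f us) (g us))"
  "RT n f \<Longrightarrow> RT n g \<Longrightarrow> RF n (\<lambda>us. qless (f us) (g us))"
  by (simp_all add: qle_def qless_def)

lemma wf_q [simp]:
  "ok sp s \<Longrightarrow> ok sp t \<Longrightarrow> tyof s = N \<Longrightarrow> tyof t = N \<Longrightarrow> wf sp [] (qle s t)"
  "ok sp s \<Longrightarrow> ok sp t \<Longrightarrow> tyof s = N \<Longrightarrow> tyof t = N \<Longrightarrow> wf sp [] (qless s t)"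
  by (simp_all add: qle_def qless_def wt_iff)

lemma names_q [simp]:
  "names_tm (qhalf s) = names_tm s"
  "names_tm (qadd s t) = names_tm s \<union> names_tm t"
  "names_tm (qminus s) = names_tm s"
  "names_tm (qabs s) = names_tm s"
  "names_tm (qdist s t) = names_tm s \<union> names_tm t"
  by (auto simp: qhalf_def qadd_def qminus_def qabs_def qdist_def)

lemma relst_q [simp]: "relst (qle s t) = qle s t" "relst (qless s t) = qless s t"
  by (simp_all add: qle_def qless_def)

context embedded_model
begin

text \<open>The bridge between the two levels: inequalities of the field are equations of values.
  Invariants are stated with \<open>\<ominus>\<close>, where quantifier-free induction applies, and
  used as inequalities, where linear arithmetic applies.\<close>

lemma monusv_eq_zero: "a \<in> NV \<Longrightarrow> b \<in> NV \<Longrightarrow> a \<ominus> b = zerov \<longleftrightarrow> nv a \<le> nv b"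
proof -
  assume ab: "a \<in> NV" "b \<in> NV"
  then have "a \<ominus> b = zerov \<longleftrightarrow> max 0 (nv a - nv b) = 0"
    using nv_inj[of "a \<ominus> b" zerov] by (simp add: nv_monus)
  also have "\<dots> \<longleftrightarrow> nv a \<le> nv b" by (simp add: max_def)
  finally show ?thesis .
qed

lemma nv_eq_zero: "a \<in> NV \<Longrightarrow> nv a = 0 \<longleftrightarrow> a = zerov"
  using nv_inj[of a zerov] by simp

lemma nv_discrete: "a \<in> NV \<Longrightarrow> b \<in> NV \<Longrightarrow> nv a < nv b \<Longrightarrow> nv a + 1 \<le> nv b"
proof -
  assume ab: "a \<in> NV" "b \<in> NV" "nv a < nv b"
  then have "b \<ominus> a \<noteq> zerov" by (simp add: monusv_eq_zero)
  then obtain d where "d \<in> NV" "b \<ominus> a = sucv d" using NV_casesE[of "b \<ominus> a"] ab by auto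
  then have "nv (b \<ominus> a) \<ge> 1" by simp
  then show ?thesis using ab by (simp add: nv_monus max_def split: if_splits)
qed

lemma nv_ge_one: "a \<in> NV \<Longrightarrow> a \<noteq> zerov \<Longrightarrow> 1 \<le> nv a"
  using nv_discrete[of zerov a] nv_eq_zero[of a] nv_nonneg[of a] by (simp add: less_le del: nv_nonneg)

subsection \<open>Pairing\<close>

lemma nv_triv: "a \<in> NV \<Longrightarrow> 2 * nv (triv a) = nv a * (nv a + 1)"
proof -
  assume a: "a \<in> NV"
  have "nv (triv a \<oplus> triv a) = nv (a \<otimes> sucv a)" using a
  proof (erule_tac QF_induct[where P = "\<lambda>a. triv a \<oplus> triv a = a \<otimes> sucv a", THEN arg_cong], goal_cases)
    case (2 n)
    then have "nv (triv n) + nv (triv n) = nv n * (nv n + 1)"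
      by (metis nv_add nv_mult nv_suc NV_closed(2,8))
    then have "nv (triv (sucv n) \<oplus> triv (sucv n)) = nv (sucv n \<otimes> sucv (sucv n))"
      using 2 by (simp add: algebra_simps)
    then show ?case using 2 nv_inj by (metis NV_closed(2,4,6,8))
  qed auto
  then have "nv (triv a) + nv (triv a) = nv a * (nv a + 1)" using a by (simp only: nv_add nv_mult nv_suc NV_closed)
  then show ?thesis by simp
qed

lemma triv_less: "a \<in> NV \<Longrightarrow> b \<in> NV \<Longrightarrow> nv a < nv b \<Longrightarrow> nv (triv a) + nv a + 1 \<le> nv (triv b)"
proof -
  assume ab: "a \<in> NV" "b \<in> NV" "nv a < nv b"
  then have "nv a + 1 \<le> nv b" by (rule nv_discrete)
  then have "(nv a + 1) * (nv a + 1 + 1) \<le> nv b * (nv b + 1)"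
    using ab by (intro mult_mono) auto
  then show ?thesis using nv_triv[of a] nv_triv[of b] ab by (simp add: algebra_simps)
qed

text \<open>The recursion keeps T(r) \<le> c < T(r + 1). When \<open>r\<close> grows, T(r + 2)
  exceeds c + 1 because c + 1 \<le> T(r + 1); when it does not, the failed test is the new upper
  bound.\<close>

lemma rootv:
  assumes "c \<in> NV"
  shows "nv (triv (rootv c)) \<le> nv c" "nv c < nv (triv (rootv c)) + nv (rootv c) + 1"
proof -
  have "triv (rootv c) \<ominus> c = zerov \<and> sucv c \<ominus> triv (sucv (rootv c)) = zerov" using assms
  proof (induction rule: QF_induct)
    case (suc c)
    let ?r = "rootv c" and ?t = "nv (triv (rootv c))"
    have IH: "?t \<le> nv c" "nv c + 1 \<le> ?t + nv ?r + 1"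
      using suc by (simp_all add: monusv_eq_zero del: monusv_suc suc_monusv)
    show ?case
    proof (cases "triv (sucv ?r) \<ominus> sucv c = zerov")
      case True
      then have "?t + nv ?r + 1 \<le> nv c + 1" using suc by (simp add: monusv_eq_zero del: monusv_suc suc_monusv)
      moreover have "rootv (sucv c) = sucv ?r" using True suc by (simp add: rootv_suc del: triv_suc monusv_suc suc_monusv)
      ultimately show ?thesis using IH suc by (simp add: monusv_eq_zero del: monusv_suc suc_monusv)
    next
      case False
      then obtain d where "d \<in> NV" "triv (sucv ?r) \<ominus> sucv c = sucv d"
        using NV_casesE[of "triv (sucv ?r) \<ominus> sucv c"] suc by auto
      then have "rootv (sucv c) = ?r" using suc
        by (simp add: rootv_suc del: triv_suc monusv_suc) 
      moreover have "nv (sucv c) < nv (triv (sucv ?r))"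
        using False suc monusv_eq_zero[of "triv (sucv ?r)" "sucv c"] by auto
      then have "nv (sucv c) + 1 \<le> nv (triv (sucv ?r))" using suc by (intro nv_discrete) auto
      ultimately show ?thesis using IH suc by (simp add: monusv_eq_zero del: monusv_suc suc_monusv)
    qed
  qed auto
  then have "nv (triv (rootv c)) \<le> nv c \<and> nv (sucv c) \<le> nv (triv (sucv (rootv c)))"
    using assms by (simp add: monusv_eq_zero del: monusv_suc suc_monusv)
  then show "nv (triv (rootv c)) \<le> nv c" "nv c < nv (triv (rootv c)) + nv (rootv c) + 1"
    using assms by auto
qed

text \<open>T(a + b) \<le> T(a + b) + a < T(a + b + 1), and T is strictly increasing in the sense of
  \<open>triv_less\<close>, so no other root is possible.\<close>

lemma rootv_pairv: "a \<in> NV \<Longrightarrow> b \<in> NV \<Longrightarrow> rootv (pairv a b) = a \<oplus> b"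
proof -
  assume ab: "a \<in> NV" "b \<in> NV"
  let ?c = "pairv a b" and ?r = "rootv (pairv a b)"
  have c: "nv ?c = nv (triv (a \<oplus> b)) + nv a" using ab by (simp add: pairv)
  have cN: "?c \<in> NV" "?r \<in> NV" "a \<oplus> b \<in> NV" using ab by auto
  note r = rootv[OF cN(1)]
  have nn: "0 \<le> nv a" "nv a \<le> nv (a \<oplus> b)" using ab by auto
  have "\<not> nv ?r < nv (a \<oplus> b)"
  proof
    assume "nv ?r < nv (a \<oplus> b)"
    from triv_less[OF cN(2,3) this] show False using r(2) c nn by linarith
  qed
  moreover have "\<not> nv (a \<oplus> b) < nv ?r"
  proof
    assume "nv (a \<oplus> b) < nv ?r"
    from triv_less[OF cN(3,2) this] show False using r(1) c nn by linarith
  qed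
  ultimately have "nv ?r = nv (a \<oplus> b)" by order
  then show ?thesis using nv_inj[of ?r "a \<oplus> b"] ab by auto
qed

lemma fstv_pairv [simp]: "a \<in> NV \<Longrightarrow> b \<in> NV \<Longrightarrow> fstv (pairv a b) = a"
  and sndv_pairv [simp]: "a \<in> NV \<Longrightarrow> b \<in> NV \<Longrightarrow> sndv (pairv a b) = b"
proof -
  assume ab: "a \<in> NV" "b \<in> NV"
  have "nv (fstv (pairv a b)) = nv a"
    using ab by (subst fstv) (simp_all add: rootv_pairv nv_monus, simp add: pairv)
  then show 1: "fstv (pairv a b) = a" using nv_inj[of "fstv (pairv a b)" a] ab by simp
  have "nv (sndv (pairv a b)) = nv b" using ab by (simp add: sndv 1 rootv_pairv nv_monus)
  then show "sndv (pairv a b) = b" using nv_inj[of "sndv (pairv a b)" b] ab by simp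
qed

subsection \<open>Rational codes\<close>

definition qposv where "qposv c = fstv (fstv c)"
definition qnegv where "qnegv c = sndv (fstv c)"
definition qdenv where "qdenv c = sucv (sndv c)"
definition qmkv where "qmkv a b d = pairv (pairv a b) (predv d)"
definition qv :: "tm set \<Rightarrow> 'k" where "qv c = (nv (qposv c) - nv (qnegv c)) / nv (qdenv c)"

abbreviation onev where "onev \<equiv> sucv zerov"
definition qhalfv where "qhalfv n = qmkv onev zerov (expv n)"
definition qaddv where "qaddv p q = qmkv (qposv p \<otimes> qdenv q \<oplus> qposv q \<otimes> qdenv p)
  (qnegv p \<otimes> qdenv q \<oplus> qnegv q \<otimes> qdenv p) (qdenv p \<otimes> qdenv q)"
definition qminusv where "qminusv p = qmkv (qnegv p) (qposv p) (qdenv p)"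
definition qabsv where
  "qabsv p = qmkv ((qposv p \<ominus> qnegv p) \<oplus> (qnegv p \<ominus> qposv p)) zerov (qdenv p)"
definition qlev where "qlev p q = (qposv p \<otimes> qdenv q \<oplus> qnegv q \<otimes> qdenv p) \<ominus>
  (qposv q \<otimes> qdenv p \<oplus> qnegv p \<otimes> qdenv q)"

lemma q_closed [simp]:
  "c \<in> NV \<Longrightarrow> qposv c \<in> NV" "c \<in> NV \<Longrightarrow> qnegv c \<in> NV" "c \<in> NV \<Longrightarrow> qdenv c \<in> NV"
  "c \<in> NV \<Longrightarrow> d \<in> NV \<Longrightarrow> e \<in> NV \<Longrightarrow> qmkv c d e \<in> NV"
  by (simp_all add: qposv_def qnegv_def qdenv_def qmkv_def)

lemma q_closed2 [simp]:
  "c \<in> NV \<Longrightarrow> qhalfv c \<in> NV" "c \<in> NV \<Longrightarrow> d \<in> NV \<Longrightarrow> qaddv c d \<in> NV" "c \<in> NV \<Longrightarrow> qminusv c \<in> NV"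
  "c \<in> NV \<Longrightarrow> qabsv c \<in> NV" "c \<in> NV \<Longrightarrow> d \<in> NV \<Longrightarrow> qlev c d \<in> NV"
  by (simp_all add: qhalfv_def qaddv_def qminusv_def qabsv_def qlev_def)

lemma qdenv_pos [simp]: "c \<in> NV \<Longrightarrow> 0 < nv (qdenv c)"
  using nv_nonneg[of "sndv c"] by (simp add: qdenv_def add_nonneg_pos)

lemma qdenv_nonzero [simp]: "c \<in> NV \<Longrightarrow> qdenv c \<noteq> zerov" "c \<in> NV \<Longrightarrow> nv (qdenv c) \<noteq> 0"
  using qdenv_pos[of c] by (simp_all add: qdenv_def)

lemma qv_qmkv: "a \<in> NV \<Longrightarrow> b \<in> NV \<Longrightarrow> d \<in> NV \<Longrightarrow> d \<noteq> zerov \<Longrightarrow> qv (qmkv a b d) = (nv a - nv b) / nv d"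
  using NV_cases[of d] by (simp add: qv_def qmkv_def qposv_def qnegv_def qdenv_def)

lemma expv_pos: "n \<in> NV \<Longrightarrow> 1 \<le> nv (expv n)"
proof -
  assume n: "n \<in> NV"
  then have "expv n \<noteq> zerov"
  proof (induction rule: QF_induct)
    case (suc n)
    then show ?case using addv_eq_zero[of "expv n" "expv n"] by (metis NV_closed(7) expv_suc)
  qed auto
  then show ?thesis using n by (intro nv_ge_one) auto
qed

lemma expv_nonzero [simp]: "n \<in> NV \<Longrightarrow> expv n \<noteq> zerov" "n \<in> NV \<Longrightarrow> nv (expv n) \<noteq> 0"
  using expv_pos[of n] by auto

definition hv :: "tm set \<Rightarrow> 'k" where "hv n = 1 / nv (expv n)"

lemma qv_qhalfv [simp]: "n \<in> NV \<Longrightarrow> qv (qhalfv n) = hv n"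
  by (simp add: qhalfv_def qv_qmkv hv_def)

lemma mult_nonzero: "a \<in> NV \<Longrightarrow> b \<in> NV \<Longrightarrow> a \<noteq> zerov \<Longrightarrow> b \<noteq> zerov \<Longrightarrow> a \<otimes> b \<noteq> zerov"
  using multv_eq_zero by blast

lemma qv_qaddv [simp]: "p \<in> NV \<Longrightarrow> q \<in> NV \<Longrightarrow> qv (qaddv p q) = qv p + qv q"
  using qdenv_nonzero(2)[of p] qdenv_nonzero(2)[of q]
  by (simp add: qaddv_def qv_qmkv mult_nonzero) (simp add: qv_def field_simps)

lemma qv_qminusv [simp]: "p \<in> NV \<Longrightarrow> qv (qminusv p) = - qv p"
  by (simp add: qminusv_def qv_qmkv) (simp add: qv_def minus_divide_left)

lemma qv_qabsv [simp]: "p \<in> NV \<Longrightarrow> qv (qabsv p) = \<bar>qv p\<bar>"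
  using qdenv_pos[of p] by (simp add: qabsv_def qv_qmkv nv_monus) (auto simp: qv_def abs_if max_def field_simps)

lemma qlev_zero [simp]: "p \<in> NV \<Longrightarrow> q \<in> NV \<Longrightarrow> qlev p q = zerov \<longleftrightarrow> qv p \<le> qv q"
  using qdenv_pos[of p] qdenv_pos[of q]
  by (simp add: qlev_def monusv_eq_zero) (simp add: qv_def field_simps)

lemma den_q [simp]:
  "den \<rho> (qhalf s) = qhalfv (den \<rho> s)"
  "den \<rho> (qadd s t) = qaddv (den \<rho> s) (den \<rho> t)"
  "den \<rho> (qminus s) = qminusv (den \<rho> s)"
  "den \<rho> (qabs s) = qabsv (den \<rho> s)"
  "den \<rho> (qdist s t) = qabsv (qaddv (den \<rho> s) (qminusv (den \<rho> t)))"
  by (simp_all add: qhalf_def qadd_def qminus_def qabs_def qdist_def opv qposv_def qnegv_def qdenv_def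
      qmkv_def qhalfv_def qaddv_def qminusv_def qabsv_def)

text \<open>The formula \<open>qle\<close> says that this term vanishes; as a term it lets programs
  branch on a comparison.\<close>

definition tqle :: "tm \<Rightarrow> tm \<Rightarrow> tm" where
  "tqle p q = tmonus \<cdot> (tadd \<cdot> (tmult \<cdot> qpos p \<cdot> qden q) \<cdot> (tmult \<cdot> qneg q \<cdot> qden p))
     \<cdot> (tadd \<cdot> (tmult \<cdot> qpos q \<cdot> qden p) \<cdot> (tmult \<cdot> qneg p \<cdot> qden q))"

lemma den_tqle [simp]: "den \<rho> (tqle p q) = qlev (den \<rho> p) (den \<rho> q)"
  by (simp add: tqle_def opv qposv_def qnegv_def qdenv_def qlev_def)

lemma tqle [simp]: "ok sp s \<Longrightarrow> ok sp t \<Longrightarrow> tyof s = N \<Longrightarrow> tyof t = N \<Longrightarrow> ok sp (tqle s t)"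
  "tyof (tqle s t) = N" "names_tm (tqle s t) = names_tm s \<union> names_tm t"
  by (auto simp: tqle_def)

lemma ev_qle [simp]:
  "ok sp s \<Longrightarrow> ok sp t \<Longrightarrow> tyof s = N \<Longrightarrow> tyof t = N \<Longrightarrow>
    ev (qle s t) \<longleftrightarrow> qv (den env0 s) \<le> qv (den env0 t)"
proof -
  assume st: "ok sp s" "ok sp t" "tyof s = N" "tyof t = N"
  have "qle s t = (tqle s t \<doteq> zro)" by (simp add: qle_def tqle_def)
  then show ?thesis using st by (simp add: opv)
qed

lemma ev_qless [simp]:
  "ok sp s \<Longrightarrow> ok sp t \<Longrightarrow> tyof s = N \<Longrightarrow> tyof t = N \<Longrightarrow>
    ev (qless s t) \<longleftrightarrow> qv (den env0 s) < qv (den env0 t)"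
  by (simp add: qless_def not_le)

section \<open>Negative powers of two\<close>

lemma hv_pos [simp]: "n \<in> NV \<Longrightarrow> 0 < hv n"
  using expv_pos[of n] by (simp add: hv_def)

lemma hv_zero [simp]: "hv zerov = 1"
  by (simp add: hv_def)

lemma hv_suc: "n \<in> NV \<Longrightarrow> hv (sucv n) = hv n / 2"
  by (simp add: hv_def field_simps)

lemma nv_less_expv: "n \<in> NV \<Longrightarrow> nv n < nv (expv n)"
proof -
  assume n: "n \<in> NV"
  then have "sucv n \<ominus> expv n = zerov"
  proof (induction rule: QF_induct)
    case (suc n)
    then have "nv n + 1 \<le> nv (expv n)" by (simp add: monusv_eq_zero del: suc_monusv monusv_suc)
    then show ?case using suc expv_pos[of n] by (simp add: monusv_eq_zero del: suc_monusv monusv_suc)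
  qed auto
  then show ?thesis using n by (simp add: monusv_eq_zero del: suc_monusv monusv_suc)
qed

text \<open>Takes the place of the Archimedean property, which is not assumed of the field: by
  discreteness a positive code has numerator at least 1, so its value is at least the reciprocal of
  its denominator \<open>d\<close>, and d < 2^d.\<close>

lemma hv_qdenv: "c \<in> NV \<Longrightarrow> 0 < qv c \<Longrightarrow> hv (qdenv c) \<le> qv c"
proof -
  assume c: "c \<in> NV" "0 < qv c"
  then have "nv (qnegv c) < nv (qposv c)" using qdenv_pos[of c] by (auto simp add: qv_def zero_less_divide_iff simp del: qdenv_pos)
  then have "nv (qnegv c) + 1 \<le> nv (qposv c)" using c by (intro nv_discrete) auto
  then have "1 / nv (qdenv c) \<le> qv c"
    using qdenv_pos[of c] c by (simp add: qv_def divide_right_mono)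
  moreover have "hv (qdenv c) \<le> 1 / nv (qdenv c)"
    using nv_less_expv[of "qdenv c"] qdenv_pos[of c] c by (simp add: hv_def frac_le)
  ultimately show ?thesis by simp
qed

lemma hv_add_mono: "n \<in> NV \<Longrightarrow> i \<in> NV \<Longrightarrow> hv (n \<oplus> i) \<le> hv n"
proof -
  assume ni: "n \<in> NV" "i \<in> NV"
  have "expv n \<ominus> expv (n \<oplus> i) = zerov" using ni(2)
  proof (induction rule: QF_induct)
    case (suc i)
    then have "nv (expv n) \<le> nv (expv (n \<oplus> i))" using ni by (simp add: monusv_eq_zero)
    then show ?case using suc ni expv_pos[of "n \<oplus> i"] by (simp add: monusv_eq_zero)
  qed (use ni in auto)
  then show ?thesis using ni expv_pos[of n] by (simp add: monusv_eq_zero hv_def frac_le)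
qed

lemma le_addE:
  assumes "m \<in> NV" "n \<in> NV" "nv m \<le> nv n"
  obtains i where "i \<in> NV" "n = m \<oplus> i"
proof
  show "n \<ominus> m \<in> NV" using assms by simp
  have "nv (m \<oplus> (n \<ominus> m)) = nv n" using assms by (simp add: nv_monus)
  then show "n = m \<oplus> (n \<ominus> m)" using nv_inj[of n "m \<oplus> (n \<ominus> m)"] assms by simp
qed

lemma hv_mono: "m \<in> NV \<Longrightarrow> n \<in> NV \<Longrightarrow> nv m \<le> nv n \<Longrightarrow> hv n \<le> hv m"
  using hv_add_mono by (metis le_addE)

end

section \<open>The principles in a model\<close>

lemma tyof_real [simp]: "tyof (real_of_rat s) = T1" "tyof real0 = T1" "tyof real1 = T1"
  by (simp_all add: real_of_rat_def real0_def real1_def)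

lemma ok_real [simp]: "ok sp s \<Longrightarrow> tyof s = N \<Longrightarrow> ok sp (real_of_rat s)" "ok sp real0" "ok sp real1"
  by (simp_all add: real_of_rat_def real0_def real1_def)

lemma names_real [simp]: "names_tm (real_of_rat s) = names_tm s" "names_tm real0 = {}" "names_tm real1 = {}"
  by (simp_all add: real_of_rat_def real0_def real1_def)

lemma lc_real [simp]: "lc real0" "lc real1"
  by (rule ok_lc[of undefined]; simp)+

lemma RF_real [simp]:
  "RT n f \<Longrightarrow> RF n (\<lambda>us. is_real (f us))"
  "RT n f \<Longrightarrow> RT n g \<Longrightarrow> RF n (\<lambda>us. real_eq (f us) (g us))"
  "RT n f \<Longrightarrow> RT n g \<Longrightarrow> RF n (\<lambda>us. real_le (f us) (g us))"
  "RT n f \<Longrightarrow> RT n g \<Longrightarrow> RT n h \<Longrightarrow> RF n (\<lambda>us. real_near (f us) (g us) (h us))"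
  by (simp_all add: is_real_def real_eq_def real_le_def real_near_def RT_tls)

lemma wf_real [simp]:
  "ok sp s \<Longrightarrow> tyof s = T1 \<Longrightarrow> wf sp [] (is_real s)"
  "ok sp s \<Longrightarrow> tyof s = T1 \<Longrightarrow> ok sp t \<Longrightarrow> tyof t = T1 \<Longrightarrow> wf sp [] (real_eq s t)"
  "ok sp s \<Longrightarrow> tyof s = T1 \<Longrightarrow> ok sp t \<Longrightarrow> tyof t = T1 \<Longrightarrow> wf sp [] (real_le s t)"
  "ok sp s \<Longrightarrow> tyof s = T1 \<Longrightarrow> ok sp t \<Longrightarrow> tyof t = T1 \<Longrightarrow> ok sp k \<Longrightarrow> tyof k = N \<Longrightarrow>
    wf sp [] (real_near s t k)"
  by (simp_all add: is_real_def real_eq_def real_le_def real_near_def)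

lemma RF_unit [simp]: "RT n f \<Longrightarrow> RF n (\<lambda>us. in_unit (f us))"
  by (simp add: in_unit_def)

lemma wf_unit [simp]: "ok sp s \<Longrightarrow> tyof s = T1 \<Longrightarrow> wf sp [] (in_unit s)"
  by (simp add: in_unit_def)

lemma RF_C [simp]:
  "RT n f \<Longrightarrow> RF n (\<lambda>us. real_fun (f us))" "RT n f \<Longrightarrow> RF n (\<lambda>us. in_C (f us))"
  "RT n f \<Longrightarrow> RF n (\<lambda>us. in_Cbar (f us))"
  by (simp_all add: real_fun_def in_C_def in_Cbar_def RT_tls)

lemma wf_C [simp]:
  assumes "ok sp s" "tyof s = T1 \<rightarrow> T1"
  shows "wf sp [] (real_fun s)" "wf sp [] (in_C s)" "wf sp [] (in_Cbar s)"
  using assms by (simp_all add: real_fun_def in_C_def in_Cbar_def)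

lemma wf_principles: "wf sp [] exists2" "wf sp [] Pi01_TRANS" "wf sp [] IVT_star" "wf sp [] UIVT"
  by (simp_all add: exists2_def Pi01_TRANS_def IVT_star_def UIVT_def wt_iff)

context embedded_model
begin

section \<open>Standard values and universes\<close>

definition Std :: "ty \<Rightarrow> tm set set" where
  "Std \<tau> = den env0 ` {t \<in> D \<tau>. at (St \<tau> t)}"

lemma Std_Val: "v \<in> Std \<tau> \<Longrightarrow> v \<in> Val \<tau>"
  by (auto simp: Std_def Val_eq)

lemma at_St [simp]: "ok sp t \<Longrightarrow> tyof t = \<tau> \<Longrightarrow> at (St \<tau> t) \<longleftrightarrow> den env0 t \<in> Std \<tau>"
proof -
  assume t: "ok sp t" "tyof t = \<tau>"
  have "ev (fall \<tau> (\<lambda>x. fall \<tau> (\<lambda>y. eqf \<tau> x y \<^bold>\<longrightarrow> St \<tau> x \<^bold>\<longrightarrow> St \<tau> y)))"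
    by (rule ax[OF st_eq]) (simp add: wt_iff)
  then have "\<forall>s\<in>D \<tau>. \<forall>t\<in>D \<tau>. den env0 s = den env0 t \<longrightarrow> at (St \<tau> s) \<longrightarrow> at (St \<tau> t)"
    by (simp (no_asm_use))
  moreover have "t \<in> D \<tau>" using t by simp
  ultimately show ?thesis unfolding Std_def by blast
qed

lemma Val_ball: "(\<forall>v\<in>Val \<sigma>. P v) \<longleftrightarrow> (\<forall>t\<in>D \<sigma>. P (den env0 t))"
  and Val_bex: "(\<exists>v\<in>Val \<sigma>. P v) \<longleftrightarrow> (\<exists>t\<in>D \<sigma>. P (den env0 t))"
  by (auto simp: Val_eq)

lemma Std_ball: "(\<forall>v\<in>Std \<sigma>. P v) \<longleftrightarrow> (\<forall>v\<in>Val \<sigma>. v \<in> Std \<sigma> \<longrightarrow> P v)"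
  and Std_bex: "(\<exists>v\<in>Std \<sigma>. P v) \<longleftrightarrow> (\<exists>v\<in>Val \<sigma>. v \<in> Std \<sigma> \<and> P v)"
  using Std_Val by blast+

lemma Std_ap: "f \<in> Std (\<sigma> \<rightarrow> \<tau>) \<Longrightarrow> x \<in> Std \<sigma> \<Longrightarrow> f \<bullet> x \<in> Std \<tau>"
proof -
  have "ev (fall (\<sigma> \<rightarrow> \<tau>) (\<lambda>f. fall \<sigma> (\<lambda>x. St (\<sigma> \<rightarrow> \<tau>) f \<^bold>\<longrightarrow> St \<sigma> x \<^bold>\<longrightarrow> St \<tau> (f \<cdot> x))))"
    by (rule ax[OF st_app]) (simp add: wt_iff)
  then have "\<forall>f\<in>Val (\<sigma> \<rightarrow> \<tau>). \<forall>x\<in>Val \<sigma>. f \<in> Std (\<sigma> \<rightarrow> \<tau>) \<longrightarrow> x \<in> Std \<sigma> \<longrightarrow> f \<bullet> x \<in> Std \<tau>"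
    by (simp add: Val_eq)
  then show "f \<in> Std (\<sigma> \<rightarrow> \<tau>) \<Longrightarrow> x \<in> Std \<sigma> \<Longrightarrow> f \<bullet> x \<in> Std \<tau>" using Std_Val by blast
qed

lemma Std_closed: "ok sp t \<Longrightarrow> names_tm t = {} \<Longrightarrow> cls t \<in> Std (tyof t)"
  using ax[OF st_closed[of sp t "tyof t"]] by (simp add: wt_iff cls_den)

lemma Std_le: "n \<in> Std N \<Longrightarrow> m \<in> NV \<Longrightarrow> nv m \<le> nv n \<Longrightarrow> m \<in> Std N"
proof -
  have "ev (fall N (\<lambda>n. fall N (\<lambda>m. St N n \<^bold>\<longrightarrow> le m n \<^bold>\<longrightarrow> St N m)))"
    by (rule ax[OF st_le]) (simp add: wt_iff)
  then have "\<forall>n\<in>Val N. \<forall>m\<in>Val N. n \<in> Std N \<longrightarrow> m \<ominus> n = zerov \<longrightarrow> m \<in> Std N"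
    by (simp add: Val_eq opv)
  then show "n \<in> Std N \<Longrightarrow> m \<in> NV \<Longrightarrow> nv m \<le> nv n \<Longrightarrow> m \<in> Std N"
    using Std_Val[of n N] monusv_eq_zero[of m n] by blast
qed

text \<open>
  The constructive parts of the arguments are needed both for all objects and, relativised, for the
  standard ones.  Universes cover the two cases.
\<close>

definition universe :: "(ty \<Rightarrow> tm set set) \<Rightarrow> bool" where
  "universe U \<longleftrightarrow> (\<forall>\<tau>. U \<tau> \<subseteq> Val \<tau>) \<and> (\<forall>\<sigma> \<tau>. \<forall>f\<in>U (\<sigma> \<rightarrow> \<tau>). \<forall>x\<in>U \<sigma>. f \<bullet> x \<in> U \<tau>) \<and>
     (\<forall>t. ok sp t \<longrightarrow> names_tm t = {} \<longrightarrow> cls t \<in> U (tyof t)) \<and>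
     (\<forall>n\<in>U N. \<forall>m\<in>NV. nv m \<le> nv n \<longrightarrow> m \<in> U N)"

lemma universe_Val: "universe Val"
  unfolding universe_def by (auto simp: ap_Val)

lemma universe_Std: "universe Std"
  unfolding universe_def using Std_Val Std_ap Std_closed Std_le by blast

text \<open>This is how constructed functionals are seen to be standard: a term is built by
  application from constants and from the parameters that the environment supplies.\<close>

lemma universe_den:
  assumes U: "universe U" and \<rho>: "\<And>x \<tau>. \<rho> x \<tau> \<in> U \<tau>"
  shows "ok sp t \<Longrightarrow> tyof t = \<tau> \<Longrightarrow> den \<rho> t \<in> U \<tau>"
proof (induction t arbitrary: \<tau>)
  case (App s t)
  then have "tyof s = tyof t \<rightarrow> \<tau>" by (auto split: ty.splits)
  then show ?case using App U unfolding universe_def by auto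
next
  case (Con c)
  then have "cls (Con c) \<in> U (tyof (Con c))" using U unfolding universe_def by (metis names_tm.simps(3))
  then show ?case using Con by simp
qed (use \<rho> in auto)

text \<open>In \<open>env0\<close> a variable denotes its own class, which need not be standard.
  Here it denotes a closed term, so that supplying parameters from a universe by \<open>upd\<close>
  never leaves the universe.\<close>

definition envz :: "nat \<Rightarrow> ty \<Rightarrow> tm set" where "envz x \<tau> = cls (zero \<tau>)"

lemma genv_envz [simp]: "genv envz"
  by (simp add: genv_def envz_def)

lemma envz_universe: "universe U \<Longrightarrow> envz x \<tau> \<in> U \<tau>"
  unfolding universe_def envz_def by (metis names_zero ok_zero tyof_zero)

lemma upd_universe: "\<rho> y \<tau> \<in> U \<tau> \<Longrightarrow> v \<in> U \<sigma> \<Longrightarrow> upd \<rho> x \<sigma> v y \<tau> \<in> U \<tau>"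
  by (simp add: upd_def)

section \<open>Reals and continuity relative to a universe\<close>

definition is_realU where "is_realU U x \<longleftrightarrow>
  (\<forall>n\<in>U N. \<forall>i\<in>U N. \<bar>qv (x \<bullet> n) - qv (x \<bullet> (n \<oplus> i))\<bar> < hv n)"
definition real_eqU where "real_eqU U x y \<longleftrightarrow> (\<forall>n\<in>U N. \<bar>qv (x \<bullet> n) - qv (y \<bullet> n)\<bar> \<le> hv n)"
definition real_leU where "real_leU U x y \<longleftrightarrow> (\<forall>n\<in>U N. qv (x \<bullet> n) \<le> qv (y \<bullet> n) + hv n)"
definition nearU where "nearU U x y k \<longleftrightarrow>
  (\<exists>n\<in>U N. \<bar>qv (x \<bullet> sucv n) - qv (y \<bullet> sucv n)\<bar> + hv n < hv k)"

definition ratv where "ratv q = cls (Con (CK N N)) \<bullet> q"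
definition q0v where "q0v = qmkv zerov zerov onev"
definition q1v where "q1v = qmkv onev zerov onev"

definition in_unitU where "in_unitU U x \<longleftrightarrow>
  is_realU U x \<and> real_leU U (ratv q0v) x \<and> real_leU U x (ratv q1v)"
definition real_funU where "real_funU U f \<longleftrightarrow>
  (\<forall>x\<in>U T1. \<forall>y\<in>U T1. is_realU U x \<longrightarrow> is_realU U y \<longrightarrow> real_eqU U x y \<longrightarrow>
    is_realU U (f \<bullet> x) \<and> is_realU U (f \<bullet> y) \<and> real_eqU U (f \<bullet> x) (f \<bullet> y))"
definition in_CbarU where "in_CbarU U f \<longleftrightarrow> real_funU U f \<and>
  (\<forall>x\<in>U T1. in_unitU U x \<longrightarrow> (\<forall>k\<in>U N. \<exists>m\<in>U N. \<forall>y\<in>U T1. in_unitU U y \<longrightarrow>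
    nearU U x y m \<longrightarrow> nearU U (f \<bullet> x) (f \<bullet> y) k)) \<and>
  real_leU U (ratv q0v) (f \<bullet> ratv q0v) \<and> real_leU U (f \<bullet> ratv q1v) (ratv q0v)"

lemma q01_closed [simp]: "q0v \<in> NV" "q1v \<in> NV" "qv q0v = 0" "qv q1v = 1"
  by (simp_all add: q0v_def q1v_def qv_qmkv)

lemma ratv_closed [simp]: "q \<in> NV \<Longrightarrow> ratv q \<in> Val T1" "q \<in> NV \<Longrightarrow> n \<in> NV \<Longrightarrow> ratv q \<bullet> n = q"
  by (simp_all add: ratv_def den_K)

lemma den_real [simp]: "den \<rho> (real_of_rat s) = ratv (den \<rho> s)" "den \<rho> real0 = ratv q0v" "den \<rho> real1 = ratv q1v"
  by (simp_all add: real_of_rat_def ratv_def real0_def real1_def q0v_def q1v_def qmkv_def opv)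

lemma ev_is_real [simp]:
  assumes "ok sp t" "tyof t = T1"
  shows "ev (is_real t) \<longleftrightarrow> is_realU Val (den env0 t)"
    "ev (relst (is_real t)) \<longleftrightarrow> is_realU Std (den env0 t)"
  using assms by (simp_all add: is_real_def is_realU_def Std_ball Val_ball Val_bex opv)

lemma ev_real_eq [simp]:
  assumes "ok sp s" "tyof s = T1" "ok sp t" "tyof t = T1"
  shows "ev (real_eq s t) \<longleftrightarrow> real_eqU Val (den env0 s) (den env0 t)"
    "ev (relst (real_eq s t)) \<longleftrightarrow> real_eqU Std (den env0 s) (den env0 t)"
    "ev (real_le s t) \<longleftrightarrow> real_leU Val (den env0 s) (den env0 t)"
    "ev (relst (real_le s t)) \<longleftrightarrow> real_leU Std (den env0 s) (den env0 t)"
  using assms by (simp_all add: real_eq_def real_eqU_def real_le_def real_leU_def Std_ball Val_ball Val_bex opv)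

lemma ev_near [simp]:
  assumes "ok sp s" "tyof s = T1" "ok sp t" "tyof t = T1" "ok sp k" "tyof k = N"
  shows "ev (real_near s t k) \<longleftrightarrow> nearU Val (den env0 s) (den env0 t) (den env0 k)"
    "ev (relst (real_near s t k)) \<longleftrightarrow> nearU Std (den env0 s) (den env0 t) (den env0 k)"
  using assms by (simp_all add: real_near_def nearU_def Std_bex Val_ball Val_bex opv)

lemma ev_unit [simp]:
  assumes "ok sp t" "tyof t = T1"
  shows "ev (in_unit t) \<longleftrightarrow> in_unitU Val (den env0 t)"
    "ev (relst (in_unit t)) \<longleftrightarrow> in_unitU Std (den env0 t)"
  using assms by (simp_all add: in_unit_def in_unitU_def)

lemma ev_Cbar [simp]:
  assumes "ok sp t" "tyof t = T1 \<rightarrow> T1"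
  shows "ev (in_Cbar t) \<longleftrightarrow> in_CbarU Val (den env0 t)"
    "ev (relst (in_Cbar t)) \<longleftrightarrow> in_CbarU Std (den env0 t)"
  using assms
  by (simp_all add: in_Cbar_def in_C_def real_fun_def in_CbarU_def real_funU_def Std_ball Std_bex Val_ball Val_bex)
    (rule conj_cong refl ball_cong imp_cong bex_cong iffI | blast)+

lemma ev_exists2:
  "ev exists2 \<longleftrightarrow> (\<exists>\<phi>\<in>Val T2. \<forall>g\<in>Val T1. (\<exists>x\<in>NV. g \<bullet> x = zerov) \<longleftrightarrow> \<phi> \<bullet> g = zerov)"
  by (simp add: exists2_def Val_ball Val_bex opv) blast

lemma ev_Pi01:
  "ev Pi01_TRANS \<longleftrightarrow> (\<forall>f\<in>Std T1. (\<forall>n\<in>Std N. f \<bullet> n = zerov) \<longrightarrow> (\<forall>n\<in>NV. f \<bullet> n = zerov))"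
  by (simp add: Pi01_TRANS_def Std_ball Val_ball Val_bex opv)

lemma ev_IVT:
  "ev IVT_star \<longleftrightarrow> (\<forall>f\<in>Std (T1 \<rightarrow> T1). in_CbarU Std f \<longrightarrow>
     (\<exists>x\<in>Std T1. in_unitU Val x \<and> real_eqU Val (f \<bullet> x) (ratv q0v)))"
  by (simp add: IVT_star_def Std_ball Std_bex Val_ball Val_bex)

lemma ev_UIVT:
  "ev UIVT \<longleftrightarrow> (\<exists>\<Phi>\<in>Val ((T1 \<rightarrow> T1) \<rightarrow> T1). \<forall>f\<in>Val (T1 \<rightarrow> T1). in_CbarU Val f \<longrightarrow>
     is_realU Val (\<Phi> \<bullet> f) \<and> real_eqU Val (f \<bullet> (\<Phi> \<bullet> f)) (ratv q0v))"
  by (simp add: UIVT_def Val_ball Val_bex)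

end

lemma RF_cong:
  "(\<And>us. length us = n \<Longrightarrow> list_all lc us \<Longrightarrow> F us = G us) \<Longrightarrow> RF n F = RF n G"
  unfolding RF_def by auto

lemma RT_lc: "RT n f \<Longrightarrow> length us = n \<Longrightarrow> list_all lc us \<Longrightarrow> lc (f us)"
  unfolding RT_def by blast

context embedded_model
begin

section \<open>Transfer and \<open>(\<exists>\<^sup>2)\<close>\<close>

text \<open>Freedom from parameters, when a formula is given as a function on terms, means that its
  instance at the closed term \<open>zero \<tau>\<close> contains no names.\<close>

lemma PF_TP_fbody:
  assumes RF: "RF (Suc 0) (\<lambda>us. B (hd us))" and wf: "\<And>x. wf sp [] (B (Free x \<tau>))"
    and int: "\<And>x. internal (B (Free x \<tau>))" and names: "names (B (zero \<tau>)) = {}"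
    and st: "\<And>t. t \<in> D \<tau> \<Longrightarrow> den env0 t \<in> Std \<tau> \<Longrightarrow> ev (B t)"
    and t: "t \<in> D \<tau>"
  shows "ev (B t)"
proof -
  let ?A = "fbody \<tau> B"
  have A: "internal ?A" "wf sp [\<tau>] ?A" "names ?A = {}"
    using int wf names by (auto simp: wf_fbody names_fbody[OF RF])
  have RFA: "RF (Suc 0) (\<lambda>us. inst ?A [hd us])" using A(2) by (rule RF_inst_hd)
  have "ev (fall_st \<tau> (\<lambda>x. inst ?A [x]) \<^bold>\<longrightarrow> fall \<tau> (\<lambda>x. inst ?A [x]))"
    by (rule ax[OF PF_TP[OF A]]) (use A(2) in \<open>auto simp: wf_inst wt_iff\<close>)
  then have "(\<forall>t\<in>D \<tau>. at (St \<tau> t) \<longrightarrow> ev (inst ?A [t])) \<longrightarrow> (\<forall>t\<in>D \<tau>. ev (inst ?A [t]))"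
    using RFA by (simp only: truth.simps ev_fall ev_fall_st)
  moreover have "ev (inst ?A [t]) \<longleftrightarrow> ev (B t)" if "t \<in> D \<tau>" for t
    using inst_fbody[OF RF, of t \<tau>] that by simp
  ultimately show ?thesis using st t by simp
qed

definition is_exists2 where
  "is_exists2 U \<phi> \<longleftrightarrow> (\<forall>g\<in>U T1. (\<exists>x\<in>U N. g \<bullet> x = zerov) \<longleftrightarrow> \<phi> \<bullet> g = zerov)"

lemma exists2_mu:
  assumes "ev exists2"
  shows "\<exists>\<mu>\<in>Std T2. \<forall>g\<in>Val T1. \<forall>n\<in>NV. g \<bullet> n = zerov \<longrightarrow> g \<bullet> (\<mu> \<bullet> g) = zerov"
proof -
  obtain s where s: "s \<in> D T2" and \<phi>: "is_exists2 Val (den env0 s)"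
    using assms by (auto simp: ev_exists2 is_exists2_def Val_ball Val_bex)
  \<comment> \<open>The value 0 of the functional promises a zero of the sequence, and choice picks
    one whenever the promise is made. The term \<open>s\<close> enters as a parameter.\<close>
  let ?A = "s \<cdot> Bound 0 \<doteq> zro \<^bold>\<longrightarrow> Bound 0 \<cdot> Bound 1 \<doteq> zro"
  have lc [simp]: "lc s" using s by simp
  have inst: "inst ?A [x, y] = (s \<cdot> x \<doteq> zro \<^bold>\<longrightarrow> x \<cdot> y \<doteq> zro)" for x y
    using lc by (simp add: lc_def)
  have "wt sp [T1, N] s T2" "wt sp [T1, N] (Bound 0) T1" "wt sp [T1, N] (Bound 1) N" "wt sp [T1, N] zro N"
    using s wt_weaken[of sp "[]" s T2 "[T1, N]"] wt.intros(2)[of 0 "[T1, N]" sp] wt.intros(2)[of 1 "[T1, N]" sp]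
      wt.intros(3)[of sp CZero "[T1, N]"] by (auto simp: wt_iff)
  then have "wf sp [T1, N] ?A" by (auto intro: wt.intros(4))
  then have "RCA0_omega_ax sp (fall T1 (\<lambda>x. fex N (\<lambda>y. inst ?A [x, y])) \<^bold>\<longrightarrow>
      fex T2 (\<lambda>F. fall T1 (\<lambda>x. inst ?A [x, F \<cdot> x])))"
    by (intro QF_AC) auto
  then have "ev (fall T1 (\<lambda>x. fex N (\<lambda>y. s \<cdot> x \<doteq> zro \<^bold>\<longrightarrow> x \<cdot> y \<doteq> zro)) \<^bold>\<longrightarrow>
      fex T2 (\<lambda>F. fall T1 (\<lambda>x. s \<cdot> x \<doteq> zro \<^bold>\<longrightarrow> x \<cdot> (F \<cdot> x) \<doteq> zro)))"
    unfolding inst by (rule ax_base) (use s in \<open>simp add: wt_iff\<close>)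
  then have "(\<forall>g\<in>Val T1. \<exists>n\<in>NV. den env0 s \<bullet> g = zerov \<longrightarrow> g \<bullet> n = zerov) \<longrightarrow>
      (\<exists>\<mu>\<in>Val T2. \<forall>g\<in>Val T1. den env0 s \<bullet> g = zerov \<longrightarrow> g \<bullet> (\<mu> \<bullet> g) = zerov)"
    using s by (simp add: Val_ball Val_bex opv)
  moreover have "\<forall>g\<in>Val T1. \<exists>n\<in>NV. den env0 s \<bullet> g = zerov \<longrightarrow> g \<bullet> n = zerov"
    using \<phi> NV_closed(1) unfolding is_exists2_def by metis
  ultimately obtain \<mu> where \<mu>: "\<mu> \<in> Val T2" "\<forall>g\<in>Val T1. den env0 s \<bullet> g = zerov \<longrightarrow> g \<bullet> (\<mu> \<bullet> g) = zerov"
    by meson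
  have "g \<bullet> (\<mu> \<bullet> g) = zerov" if "g \<in> Val T1" "n \<in> NV" "g \<bullet> n = zerov" for g n
  proof -
    have "den env0 s \<bullet> g = zerov" using \<phi> that unfolding is_exists2_def by metis
    then show ?thesis using \<mu>(2) that(1) by metis
  qed
  then have mu: "\<exists>\<mu>\<in>Val T2. \<forall>g\<in>Val T1. \<forall>n\<in>NV. g \<bullet> n = zerov \<longrightarrow> g \<bullet> (\<mu> \<bullet> g) = zerov"
    using \<mu>(1) by metis
  \<comment> \<open>Transfer moves universal statements only, so it is applied to the failure to
    find zeros: if every standard functional failed, every functional would, contrary to
    \<open>mu\<close>. The formula no longer mentions \<open>s\<close>.\<close>
  let ?B = "\<lambda>m. \<^bold>\<not> fall T1 (\<lambda>g. fall N (\<lambda>n. g \<cdot> n \<doteq> zro \<^bold>\<longrightarrow> g \<cdot> (m \<cdot> g) \<doteq> zro))"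
  have B: "ev (?B m) \<longleftrightarrow> \<not> (\<forall>g\<in>Val T1. \<forall>n\<in>NV. g \<bullet> n = zerov \<longrightarrow> g \<bullet> (den env0 m \<bullet> g) = zerov)"
    if "m \<in> D T2" for m
    using that by (simp add: Val_ball Val_bex opv)
  show ?thesis
  proof (rule ccontr)
    assume "\<not> ?thesis"
    then have "ev (?B t)" if "t \<in> D T2" "den env0 t \<in> Std T2" for t
      unfolding B[OF that(1)] using that(2) by blast
    then have all: "ev (?B t)" if "t \<in> D T2" for t
      by (rule PF_TP_fbody[where \<tau> = T2, rotated 4]) (use that in \<open>simp_all add: wt_iff\<close>)
    obtain m where "m \<in> D T2"
      "\<forall>g\<in>Val T1. \<forall>n\<in>NV. g \<bullet> n = zerov \<longrightarrow> g \<bullet> (den env0 m \<bullet> g) = zerov"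
      using mu unfolding Val_bex[of T2] by blast
    then show False using all B by blast
  qed
qed

lemma not_zero_value:
  assumes U: "universe U" "f \<in> U T1"
  obtains g where "g \<in> U T1" "\<And>n. n \<in> NV \<Longrightarrow> g \<bullet> n = zerov \<longleftrightarrow> f \<bullet> n \<noteq> zerov"
proof -
  have f: "f \<in> Val T1" using U by (auto simp: universe_def)
  let ?t = "bracket 1 N (tmonus \<cdot> suc zro \<cdot> (Free 0 T1 \<cdot> Free 1 N))"
  define g where "g = den (upd envz 0 T1 f) ?t"
  have "g \<bullet> n = onev \<ominus> (f \<bullet> n)" if "n \<in> NV" for n
    using that f by (simp add: g_def opv del: bracket.simps)
  moreover have "onev \<ominus> a = zerov \<longleftrightarrow> a \<noteq> zerov" if "a \<in> NV" for a
    using that nv_ge_one[of a] by (auto simp: monusv_eq_zero simp del: monusv_suc suc_monusv)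
  ultimately have "g \<bullet> n = zerov \<longleftrightarrow> f \<bullet> n \<noteq> zerov" if "n \<in> NV" for n
    using that f by simp
  moreover have "g \<in> U T1"
    unfolding g_def by (rule universe_den[OF U(1)]) (simp_all add: upd_universe envz_universe U)
  ultimately show ?thesis by (rule that[rotated])
qed

text \<open>A standard functional that finds zeros, applied to a standard sequence, returns a
  standard number; so any counterexample yields a standard one.\<close>

lemma exists2_imp_Pi01:
  assumes "ev exists2" shows "ev Pi01_TRANS"
  unfolding ev_Pi01
proof (intro ballI impI, rule ccontr)
  fix f n
  assume f: "f \<in> Std T1" "\<forall>n\<in>Std N. f \<bullet> n = zerov" and n: "n \<in> NV" "f \<bullet> n \<noteq> zerov"
  obtain \<mu> where \<mu>: "\<mu> \<in> Std T2" "\<forall>g\<in>Val T1. \<forall>n\<in>NV. g \<bullet> n = zerov \<longrightarrow> g \<bullet> (\<mu> \<bullet> g) = zerov"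
    using exists2_mu[OF assms] by blast
  obtain g where g: "g \<in> Std T1" "\<And>n. n \<in> NV \<Longrightarrow> g \<bullet> n = zerov \<longleftrightarrow> f \<bullet> n \<noteq> zerov"
    using not_zero_value[OF universe_Std f(1)] by metis
  have "\<mu> \<bullet> g \<in> Std N" using \<mu>(1) g(1) by (rule Std_ap)
  moreover have "g \<bullet> (\<mu> \<bullet> g) = zerov" using \<mu>(2) g n Std_Val by blast
  ultimately show False using f(2) g(2) Std_Val by blast
qed

lemma Pi01_Std_zero:
  assumes "ev Pi01_TRANS" "g \<in> Std T1" "x \<in> NV" "g \<bullet> x = zerov"
  shows "\<exists>n\<in>Std N. g \<bullet> n = zerov"
proof -
  obtain f where "f \<in> Std T1" "\<And>n. n \<in> NV \<Longrightarrow> f \<bullet> n = zerov \<longleftrightarrow> g \<bullet> n \<noteq> zerov"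
    using not_zero_value[OF universe_Std assms(2)] by metis
  then show ?thesis using assms unfolding ev_Pi01 using Std_Val by metis
qed

text \<open>Transfer and choice bound the search for a zero of a standard function.\<close>

lemma Pi01_bounded_search:
  assumes "ev Pi01_TRANS"
  shows "\<exists>\<Phi>\<in>Std (T1 \<rightarrow> Seq N). \<forall>g\<in>Std T1. \<exists>i\<in>NV. sucv i \<ominus> cls (Con (CLen N)) \<bullet> (\<Phi> \<bullet> g) = zerov \<and>
    (\<forall>x\<in>NV. g \<bullet> x = zerov \<longrightarrow> g \<bullet> (cls (Con (CNth N)) \<bullet> (\<Phi> \<bullet> g) \<bullet> i) = zerov)"
proof -
  \<comment> \<open>If \<open>g\<close> has a zero at all, then \<open>n\<close> is one. Below the
    quantifier, index 1 is \<open>g\<close> and index 2 is \<open>n\<close>.\<close>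
  define A where "A = All N (Bound 1 \<cdot> Bound 0 \<doteq> zro \<^bold>\<longrightarrow> Bound 1 \<cdot> Bound 2 \<doteq> zro)"
  have inst: "inst A [g, n] = fall N (\<lambda>x. g \<cdot> x \<doteq> zro \<^bold>\<longrightarrow> g \<cdot> n \<doteq> zro)" if "lc g" "lc n" for g n
    unfolding fall_def A_def
    by (subst fbody_eq[where A = "g \<cdot> Bound 0 \<doteq> zro \<^bold>\<longrightarrow> g \<cdot> n \<doteq> zro"]) (use that in \<open>auto simp: lc_def\<close>)
  have RF: "RF n (\<lambda>us. inst A [f us, h us])" if "RT n f" "RT n h" for n f h
  proof -
    have "RF n (\<lambda>us. fall N (\<lambda>x. f us \<cdot> x \<doteq> zro \<^bold>\<longrightarrow> f us \<cdot> h us \<doteq> zro))"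
      using that by (simp add: RT_tls)
    then show ?thesis
      by (subst RF_cong) (rule inst[OF RT_lc[OF that(1)] RT_lc[OF that(2)]], assumption+)
  qed
  have "wt sp [N, T1, N] (Bound 0) N" "wt sp [N, T1, N] (Bound 1) T1" "wt sp [N, T1, N] (Bound 2) N"
    "wt sp [N, T1, N] zro N"
    using wt.intros(2)[of 0 "[N, T1, N]" sp] wt.intros(2)[of 1 "[N, T1, N]" sp]
      wt.intros(2)[of 2 "[N, T1, N]" sp] wt.intros(3)[of sp CZero "[N, T1, N]"]
    by (auto simp: eval_nat_numeral)
  then have A: "wf sp [T1, N] A" by (auto simp: A_def intro: wt.intros(4))
  have wfi: "wf sp [] (inst A [s, t])" if "s \<in> D T1" "t \<in> D N" for s t
    by (rule wf_inst[OF A]) (use that in \<open>simp add: wt_iff\<close>)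
  have "ev (fall_st T1 (\<lambda>x. fex_st N (\<lambda>y. inst A [x, y]))
     \<^bold>\<longrightarrow> fex_st (T1 \<rightarrow> Seq N) (\<lambda>F. fall_st T1 (\<lambda>x. fex_in N (F \<cdot> x) (\<lambda>y. inst A [x, y]))))"
    by (rule ax[OF HAC_int[OF _ A]], simp add: A_def)
      (use wfi in \<open>auto simp: fex_in_def fall_in_def\<close>)
  then have "(\<forall>g\<in>D T1. den env0 g \<in> Std T1 \<longrightarrow> (\<exists>n\<in>D N. den env0 n \<in> Std N \<and> ev (inst A [g, n]))) \<longrightarrow>
      (\<exists>F\<in>D (T1 \<rightarrow> Seq N). den env0 F \<in> Std (T1 \<rightarrow> Seq N) \<and> (\<forall>g\<in>D T1. den env0 g \<in> Std T1 \<longrightarrow>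
        (\<exists>i\<in>D N. at (less i (Con (CLen N) \<cdot> (F \<cdot> g))) \<and> ev (inst A [g, Con (CNth N) \<cdot> (F \<cdot> g) \<cdot> i]))))"
    by (simp add: RF fex_in_def fall_in_def RT_tls del: at_Eq)
  moreover have ev: "ev (inst A [g, n]) \<longleftrightarrow>
      (\<forall>x\<in>NV. den env0 g \<bullet> x = zerov \<longrightarrow> den env0 g \<bullet> den env0 n = zerov)" if "g \<in> D T1" "n \<in> D N" for g n
    using that by (simp add: inst Val_ball Val_bex opv)
  moreover have "\<exists>n\<in>D N. den env0 n \<in> Std N \<and> ev (inst A [g, n])"
    if g: "g \<in> D T1" "den env0 g \<in> Std T1" for g
  proof -
    \<comment> \<open>The witness for sequences without zeros, where any number satisfies the
      implication.\<close>
    have "zerov \<in> Std N" using Std_closed[of zro] by (simp add: zerov_def)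
    then have "\<exists>n\<in>Std N. \<forall>x\<in>NV. den env0 g \<bullet> x = zerov \<longrightarrow> den env0 g \<bullet> n = zerov"
      using Pi01_Std_zero[OF assms g(2)] by metis
    then obtain n where "n \<in> D N" "den env0 n \<in> Std N"
      "\<forall>x\<in>NV. den env0 g \<bullet> x = zerov \<longrightarrow> den env0 g \<bullet> den env0 n = zerov"
      by (auto simp: Std_bex Val_bex simp del: Tm_iff)
    then show ?thesis using ev[OF g(1)] by blast
  qed
  ultimately obtain F where F: "F \<in> D (T1 \<rightarrow> Seq N)" "den env0 F \<in> Std (T1 \<rightarrow> Seq N)"
    "\<forall>g\<in>D T1. den env0 g \<in> Std T1 \<longrightarrow>
        (\<exists>i\<in>D N. at (less i (Con (CLen N) \<cdot> (F \<cdot> g))) \<and> ev (inst A [g, Con (CNth N) \<cdot> (F \<cdot> g) \<cdot> i]))"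
    by blast
  show ?thesis
  proof (rule bexI[OF _ F(2)], unfold Std_ball Val_ball, intro ballI impI)
    fix g assume g: "g \<in> D T1" "den env0 g \<in> Std T1"
    then obtain i where i: "i \<in> D N" "at (less i (Con (CLen N) \<cdot> (F \<cdot> g)))"
      "ev (inst A [g, Con (CNth N) \<cdot> (F \<cdot> g) \<cdot> i])"
      using F(3) by blast
    have "Con (CNth N) \<cdot> (F \<cdot> g) \<cdot> i \<in> D N" using F(1) g i(1) by simp
    then have "\<forall>x\<in>NV. den env0 g \<bullet> x = zerov \<longrightarrow>
        den env0 g \<bullet> (cls (Con (CNth N)) \<bullet> (den env0 F \<bullet> den env0 g) \<bullet> den env0 i) = zerov"
      using i(3) ev[OF g(1)] by simp
    moreover have "sucv (den env0 i) \<ominus> cls (Con (CLen N)) \<bullet> (den env0 F \<bullet> den env0 g) = zerov"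
      using i(1,2) F(1) g(1) by (simp add: opv del: monusv_suc)
    ultimately show "\<exists>i\<in>NV. sucv i \<ominus> cls (Con (CLen N)) \<bullet> (den env0 F \<bullet> den env0 g) = zerov \<and>
      (\<forall>t\<in>D N. den env0 g \<bullet> den env0 t = zerov \<longrightarrow>
        den env0 g \<bullet> (cls (Con (CNth N)) \<bullet> (den env0 F \<bullet> den env0 g) \<bullet> i) = zerov)"
      using i(1) by (auto simp: Val_bex Val_ball)
  qed
qed

lemma tmd_recv [intro!]:
  "tmd N f \<Longrightarrow> a \<in> NV \<Longrightarrow> F \<in> Val (N \<rightarrow> N \<rightarrow> N) \<Longrightarrow> tmd N (\<lambda>v. recv (f v) a F)"
  unfolding recv_def
  by (rule tmd_ap[of "N \<rightarrow> N \<rightarrow> N" N], rule tmd_ap[of N], rule tmd_ap[of N]) (auto intro!: tmd_const)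

lemma tmd_apN: "f \<in> Val (N \<rightarrow> \<tau>) \<Longrightarrow> tmd N h \<Longrightarrow> tmd \<tau> (\<lambda>v. f \<bullet> h v)"
  by (rule tmd_ap[of N]) auto

lemma monusv_less: "i \<in> NV \<Longrightarrow> m \<in> NV \<Longrightarrow> sucv i \<ominus> m = zerov \<longleftrightarrow> nv i < nv m"
  using nv_discrete[of i m] by (auto simp: monusv_eq_zero)

text \<open>A product vanishes iff one of its factors does. This turns a bounded search into a
  primitive recursive term.\<close>

lemma recv_product:
  assumes F: "F \<in> Val (N \<rightarrow> N \<rightarrow> N)" and h: "h \<in> Val (N \<rightarrow> N)"
    and rec: "\<And>r i. r \<in> NV \<Longrightarrow> i \<in> NV \<Longrightarrow> F \<bullet> r \<bullet> i = r \<otimes> (h \<bullet> i)" and m: "m \<in> NV"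
  shows "recv m onev F = zerov \<longleftrightarrow> (\<exists>i\<in>NV. nv i < nv m \<and> h \<bullet> i = zerov)"
proof
  assume "\<exists>i\<in>NV. nv i < nv m \<and> h \<bullet> i = zerov"
  then obtain i where i: "i \<in> NV" "nv i < nv m" "h \<bullet> i = zerov" by blast
  have "sucv i \<ominus> m = zerov \<longrightarrow> recv m onev F = zerov" using m
  proof (induction rule: QF_induct)
    case zero
    then show ?case using i by (simp add: monusv_less del: monusv_suc)
  next
    case (suc m)
    show ?case
    proof
      assume "sucv i \<ominus> sucv m = zerov"
      then have "nv i \<le> nv m" using suc i by (simp add: monusv_eq_zero del: monusv_suc suc_monusv)
      then have "i = m \<or> nv i < nv m" using nv_inj[of i m] suc(1) i(1) by (metis order.order_iff_strict)
      then show "recv (sucv m) onev F = zerov"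
      proof
        assume "i = m"
        then show ?thesis using suc(1) i F rec by simp
      next
        assume "nv i < nv m"
        then have "recv m onev F = zerov" using suc i by (simp add: monusv_less del: monusv_suc)
        then show ?thesis using suc(1) h F rec by simp
      qed
    qed
  qed (use i F in auto)
  then show "recv m onev F = zerov" using i m by (simp add: monusv_less del: monusv_suc)
next
  assume z: "recv m onev F = zerov"
  show "\<exists>i\<in>NV. nv i < nv m \<and> h \<bullet> i = zerov"
  proof (rule ccontr)
    assume *: "\<not> ?thesis"
    \<comment> \<open>The factors are known to be nonzero only below \<open>m\<close>, so the
      induction is confined to partial products up to \<open>m\<close>.\<close>
    have "k \<ominus> m = zerov \<longrightarrow> recv k onev F \<noteq> zerov" if "k \<in> NV" for k using that
    proof (induction rule: QF_induct)
      case (suc k)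
      show ?case
      proof
        assume "sucv k \<ominus> m = zerov"
        then have k: "nv k < nv m" using suc m by (simp add: monusv_less)
        then have "h \<bullet> k \<noteq> zerov" "recv k onev F \<noteq> zerov"
          using * suc m by (auto simp: monusv_eq_zero)
        then show "recv (sucv k) onev F \<noteq> zerov"
          using suc F h rec mult_nonzero[of "recv k onev F" "h \<bullet> k"] by simp
      qed
    qed (use m F in auto)
    from this[OF m] show False using z m by simp
  qed
qed

lemma onev_monusv_zero: "a \<in> NV \<Longrightarrow> onev \<ominus> a = zerov \<longleftrightarrow> a \<noteq> zerov"
  using nv_ge_one[of a] by (auto simp: monusv_eq_zero simp del: monusv_suc suc_monusv)

text \<open>\<open>HAC_int\<close> provides a finite list of candidates instead of one; the product
  of \<open>g\<close> over \<Phi>(g) vanishes iff one of them is a zero. For standard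
  \<open>g\<close> the list has standard length, so its entries are standard as well.\<close>

lemma exists2_on_Std:
  assumes "ev Pi01_TRANS"
  shows "\<exists>\<xi>\<in>Std T2. is_exists2 Std \<xi> \<and> (\<forall>g\<in>Std T1. \<xi> \<bullet> g \<ominus> onev = zerov)"
proof -
  obtain \<Phi> where \<Phi>: "\<Phi> \<in> Std (T1 \<rightarrow> Seq N)"
    and bound: "\<forall>g\<in>Std T1. \<exists>i\<in>NV. sucv i \<ominus> cls (Con (CLen N)) \<bullet> (\<Phi> \<bullet> g) = zerov \<and>
      (\<forall>x\<in>NV. g \<bullet> x = zerov \<longrightarrow> g \<bullet> (cls (Con (CNth N)) \<bullet> (\<Phi> \<bullet> g) \<bullet> i) = zerov)"
    using Pi01_bounded_search[OF assms] by blast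
  have \<Phi>V [simp]: "\<Phi> \<in> Val (T1 \<rightarrow> Seq N)" using \<Phi> by (rule Std_Val)
  let ?P = "Free 0 (T1 \<rightarrow> Seq N)" and ?g = "Free 1 T1"
  let ?h = "bracket 3 N (?g \<cdot> (Con (CNth N) \<cdot> (?P \<cdot> ?g) \<cdot> Free 3 N))"
  let ?F = "bracket 2 N (bracket 3 N (tmult \<cdot> Free 2 N \<cdot> (?g \<cdot> (Con (CNth N) \<cdot> (?P \<cdot> ?g) \<cdot> Free 3 N))))"
  \<comment> \<open>Subtracting twice from 1 replaces a nonzero product by 1, because the
    specification of the constant demands values at most 1.\<close>
  let ?t = "bracket 1 T1 (tmonus \<cdot> suc zro \<cdot> (tmonus \<cdot> suc zro \<cdot>
    rec (Con (CLen N) \<cdot> (?P \<cdot> ?g)) (suc zro) ?F))"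
  let ?\<rho> = "upd envz 0 (T1 \<rightarrow> Seq N) \<Phi>"
  define \<xi> where "\<xi> = den ?\<rho> ?t"
  have \<xi>: "\<xi> \<in> Std T2" unfolding \<xi>_def
    by (rule universe_den[OF universe_Std]) (simp_all add: upd_universe envz_universe universe_Std \<Phi>)
  have "(\<exists>x\<in>Std N. g \<bullet> x = zerov) \<longleftrightarrow> \<xi> \<bullet> g = zerov" "\<xi> \<bullet> g \<ominus> onev = zerov" if g: "g \<in> Std T1" for g
  proof -
    have gV [simp]: "g \<in> Val T1" using g by (rule Std_Val)
    define l where "l = cls (Con (CLen N)) \<bullet> (\<Phi> \<bullet> g)"
    define nth where "nth i = cls (Con (CNth N)) \<bullet> (\<Phi> \<bullet> g) \<bullet> i" for i
    define F where "F = den (upd ?\<rho> 1 T1 g) ?F"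
    define h where "h = den (upd ?\<rho> 1 T1 g) ?h"
    have lV [simp]: "l \<in> NV" by (simp add: l_def)
    have h: "h \<bullet> i = g \<bullet> nth i" if "i \<in> NV" for i
      using that by (simp add: h_def nth_def del: bracket.simps)
    have "F \<bullet> r \<bullet> i = r \<otimes> (h \<bullet> i)" if "r \<in> NV" "i \<in> NV" for r i
      using that by (simp add: F_def h opv nth_def del: bracket.simps)
    then have R: "recv l onev F = zerov \<longleftrightarrow> (\<exists>i\<in>NV. nv i < nv l \<and> g \<bullet> nth i = zerov)"
      by (subst recv_product[where h = h]) (simp_all add: F_def h_def nth_def del: bracket.simps)
    have FV: "recv l onev F \<in> NV" by (simp add: F_def del: bracket.simps)
    have \<xi>g: "\<xi> \<bullet> g = onev \<ominus> (onev \<ominus> recv l onev F)"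
      by (simp add: \<xi>_def F_def l_def opv del: bracket.simps monusv_suc)
    show "\<xi> \<bullet> g \<ominus> onev = zerov"
      unfolding \<xi>g using FV by (simp add: monusv_eq_zero nv_monus del: monusv_suc)
    have lS: "l \<in> Std N" "cls (Con (CNth N)) \<bullet> (\<Phi> \<bullet> g) \<in> Std (N \<rightarrow> N)"
      unfolding l_def using \<Phi> g Std_closed[of "Con (CLen N)"] Std_closed[of "Con (CNth N)"]
      by (auto intro: Std_ap)
    have nthS: "nth i \<in> Std N" if "i \<in> NV" "nv i < nv l" for i
      unfolding nth_def using lS that Std_le[of l i] by (auto intro: Std_ap)
    have "(\<exists>x\<in>Std N. g \<bullet> x = zerov) \<longleftrightarrow> (\<exists>i\<in>NV. nv i < nv l \<and> g \<bullet> nth i = zerov)"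
    proof
      assume "\<exists>x\<in>Std N. g \<bullet> x = zerov"
      then obtain x where x: "x \<in> NV" "g \<bullet> x = zerov" using Std_Val by blast
      obtain i where i: "i \<in> NV" "sucv i \<ominus> l = zerov" "\<forall>x\<in>NV. g \<bullet> x = zerov \<longrightarrow> g \<bullet> nth i = zerov"
        using bound g unfolding l_def nth_def by blast
      then have "nv i < nv l" using monusv_less[of i l] lV by blast
      then show "\<exists>i\<in>NV. nv i < nv l \<and> g \<bullet> nth i = zerov" using i x by blast
    qed (use nthS in blast)
    then show "(\<exists>x\<in>Std N. g \<bullet> x = zerov) \<longleftrightarrow> \<xi> \<bullet> g = zerov"
      unfolding \<xi>g using R FV by (simp add: onev_monusv_zero del: monusv_suc)
  qed
  then show ?thesis using \<xi> unfolding is_exists2_def by blast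
qed

text \<open>The constant \<open>\<Xi>\<^sub>0\<close> makes the functional parameter-free, so that transfer applies to it.\<close>

lemma Pi01_imp_standard_exists2:
  assumes adm: "admissible sp" and T: "ev Pi01_TRANS"
  shows "\<exists>\<phi>\<in>Std T2. is_exists2 Val \<phi>"
proof -
  obtain n where n: "sp n = Some (T2, exists2_spec)" using adm by (auto simp: admissible_def)
  let ?X = "Con (CXi n T2)"
  have X [simp]: "ok sp ?X" using n by simp
  let ?B = "\<lambda>\<phi>. fall T1 (\<lambda>g. (fex N (\<lambda>x. g \<cdot> x \<doteq> zro) \<^bold>\<longleftrightarrow> \<phi> \<cdot> g \<doteq> zro) \<^bold>\<and> le (\<phi> \<cdot> g) (suc zro))"
  have RFB: "RF (Suc 0) (\<lambda>us. ?B (hd us))" by simp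
  have wfD: "wf sp [T2] exists2_spec" unfolding exists2_spec_def
    by (rule wf_fbody) (simp add: wt_iff)
  have D: "inst (relst exists2_spec) [t] = relst (?B t)" if "lc t" for t
    unfolding exists2_spec_def by (simp add: inst_fbody[OF RFB that] flip: relst_open)
  let ?E = "\<lambda>\<xi>. inst (relst exists2_spec) [\<xi>] \<^bold>\<longrightarrow> relst (eqf T2 ?X \<xi>)"
  have wfE: "wf sp [] (?E t)" if "t \<in> D T2" for t
    using that n wf_inst[OF wf_relst[OF wfD], of "[t]"] by (simp add: wt_iff)
  have RFE: "RF (Suc 0) (\<lambda>us. ?E (hd us))"
    using RF_inst_hd[of sp T2 "relst exists2_spec" 0] wfD by simp
  have "ev (St T2 ?X \<^bold>\<and> fall_st T2 (\<lambda>\<xi>. inst (relst exists2_spec) [\<xi>] \<^bold>\<longrightarrow> relst (eqf T2 ?X \<xi>)))"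
    by (rule ax, rule RCA0_Omega_ax.Xi[where n = n and \<tau> = T2 and D = exists2_spec])
      (use wfE n in \<open>auto simp: wt_iff\<close>)
  then have XS: "cls ?X \<in> Std T2"
    and E: "\<And>t. t \<in> D T2 \<Longrightarrow> den env0 t \<in> Std T2 \<Longrightarrow> ev (?E t)"
    using RFE X by (simp_all add: ev_fall_st)
  obtain \<xi> where \<xi>: "\<xi> \<in> Std T2" "is_exists2 Std \<xi>" "\<forall>g\<in>Std T1. \<xi> \<bullet> g \<ominus> onev = zerov"
    using exists2_on_Std[OF T] by blast
  then obtain t where t: "t \<in> D T2" "\<xi> = den env0 t" using Std_Val Val_eq by blast
  \<comment> \<open>As \<xi> meets the relativised specification, the axiom for the constant makes
    the two agree on standard sequences.\<close>
  have "ev (relst (?B t))"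
    using \<xi> t by (simp add: is_exists2_def Std_ball Std_bex Val_ball Val_bex opv)
  then have "ev (relst (eqf T2 ?X t))" using E[of t] D[of t] t \<xi>(1) by simp
  then have "\<forall>s\<in>D T1. den env0 s \<in> Std T1 \<longrightarrow> cls ?X \<bullet> den env0 s = \<xi> \<bullet> den env0 s"
    using t n by simp
  then have agree: "cls ?X \<bullet> g = \<xi> \<bullet> g" if "g \<in> Std T1" for g
    using that Std_Val[OF that] unfolding Val_eq by blast
  \<comment> \<open>For standard zeros this is the property of \<xi>; by transfer a standard
    sequence with any zero has a standard one.\<close>
  have std: "(\<exists>x\<in>NV. g \<bullet> x = zerov) \<longleftrightarrow> cls ?X \<bullet> g = zerov" if g: "g \<in> Std T1" for g
    using \<xi>(2) agree[OF g] Pi01_Std_zero[OF T g] g Std_Val unfolding is_exists2_def by metis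
  \<comment> \<open>Beside \<open>g\<close> this formula contains only the constant, which is no
    parameter, so transfer extends it from standard sequences to all.\<close>
  let ?C = "\<lambda>g. fex N (\<lambda>x. g \<cdot> x \<doteq> zro) \<^bold>\<longleftrightarrow> ?X \<cdot> g \<doteq> zro"
  have C: "ev (?C g) \<longleftrightarrow> ((\<exists>x\<in>NV. den env0 g \<bullet> x = zerov) \<longleftrightarrow> cls ?X \<bullet> den env0 g = zerov)" if "g \<in> D T1" for g
    using that n by (auto simp: Val_bex opv)
  have "ev (?C g)" if "g \<in> D T1" for g
    by (rule PF_TP_fbody[where \<tau> = T1 and B = ?C])
      (use that n std C in \<open>simp_all add: wt_iff fex_def del: truth.simps\<close>)
  then have "is_exists2 Val (cls ?X)" using C by (simp add: is_exists2_def Val_ball del: truth.simps)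
  then show ?thesis using XS by blast
qed

lemma Pi01_imp_exists2: "admissible sp \<Longrightarrow> ev Pi01_TRANS \<Longrightarrow> ev exists2"
  using Pi01_imp_standard_exists2 Std_Val unfolding ev_exists2 is_exists2_def by blast

section \<open>Closure properties of universes\<close>

lemma U_ap: "universe U \<Longrightarrow> f \<in> U (\<sigma> \<rightarrow> \<tau>) \<Longrightarrow> x \<in> U \<sigma> \<Longrightarrow> f \<bullet> x \<in> U \<tau>"
  by (simp add: universe_def)

lemma U_cls: "universe U \<Longrightarrow> ok sp t \<Longrightarrow> names_tm t = {} \<Longrightarrow> tyof t = \<tau> \<Longrightarrow> cls t \<in> U \<tau>"
  unfolding universe_def by blast

lemma U_Val: "universe U \<Longrightarrow> v \<in> U \<tau> \<Longrightarrow> v \<in> Val \<tau>"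
  unfolding universe_def by blast

lemma U_le: "universe U \<Longrightarrow> n \<in> U N \<Longrightarrow> m \<in> NV \<Longrightarrow> nv m \<le> nv n \<Longrightarrow> m \<in> U N"
  unfolding universe_def by blast

lemma U_ops:
  assumes "universe U"
  shows "zerov \<in> U N" "a \<in> U N \<Longrightarrow> sucv a \<in> U N" "a \<in> U N \<Longrightarrow> b \<in> U N \<Longrightarrow> a \<oplus> b \<in> U N"
    "a \<in> U N \<Longrightarrow> ratv a \<in> U T1"
  unfolding zerov_def sucv_def addv_def ratv_def
  by (auto intro!: U_ap[OF assms, of _ N] U_ap[OF assms, of "cls tadd" N "T1"] U_cls[OF assms])

lemma U_q:
  assumes U: "universe U"
  shows "a \<in> U N \<Longrightarrow> b \<in> U N \<Longrightarrow> qaddv a b \<in> U N" "a \<in> U N \<Longrightarrow> qminusv a \<in> U N"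
    "a \<in> U N \<Longrightarrow> qabsv a \<in> U N" "a \<in> U N \<Longrightarrow> qhalfv a \<in> U N" "a \<in> U N \<Longrightarrow> qdenv a \<in> U N"
    "q0v \<in> U N" "q1v \<in> U N"
proof -
  have *: "den (upd (upd envz 0 N a) 1 N b) t \<in> U N" if "ok sp t" "tyof t = N" "a \<in> U N" "b \<in> U N" for t a b
    by (rule universe_den[OF U _ that(1,2)]) (simp add: upd_universe envz_universe that U)
  show "a \<in> U N \<Longrightarrow> b \<in> U N \<Longrightarrow> qaddv a b \<in> U N"
    using *[of "qadd (Free 0 N) (Free 1 N)" a b] by simp
  show "a \<in> U N \<Longrightarrow> qminusv a \<in> U N" "a \<in> U N \<Longrightarrow> qabsv a \<in> U N" "a \<in> U N \<Longrightarrow> qhalfv a \<in> U N"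
    "a \<in> U N \<Longrightarrow> qdenv a \<in> U N"
    using *[of "qminus (Free 0 N)" a a] *[of "qabs (Free 0 N)" a a] *[of "qhalf (Free 0 N)" a a]
      *[of "qden (Free 0 N)" a a] by (simp_all add: opv qdenv_def)
  have "zerov \<in> U N" by (rule U_ops[OF U])
  then show "q0v \<in> U N" "q1v \<in> U N"
    using *[of q0 zerov zerov] *[of q1 zerov zerov] by (simp_all add: opv q0v_def q1v_def qmkv_def)
qed

lemma hv_le_one: "n \<in> NV \<Longrightarrow> hv n \<le> 1"
  using expv_pos[of n] by (simp add: hv_def)

section \<open>From the intermediate value theorem to transfer\<close>

text \<open>
  A standard sequence that vanishes on the standard numbers represents the real 0 as far as \<open>st\<close> can
  tell.  Unless it vanishes everywhere, the constant function with this value refutes \<open>IVT\<^sup>*\<close>.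
\<close>

lemma IVT_imp_Pi01:
  assumes "ev IVT_star" shows "ev Pi01_TRANS"
  unfolding ev_Pi01
proof (intro ballI impI)
  fix f n assume f: "f \<in> Std T1" and z: "\<forall>n\<in>Std N. f \<bullet> n = zerov" and n: "n \<in> NV"
  have fV [simp]: "f \<in> Val T1" using f by (rule Std_Val)
  let ?a = "Free 0 T1 \<cdot> Free 1 N"
  \<comment> \<open>The values are doubled: equality of reals tolerates an error of 2^-n, which is 1
    at n = 0 and could not tell the value 1 from 0.\<close>
  let ?t = "bracket 2 T1 (bracket 1 N (qmk (tadd \<cdot> ?a \<cdot> ?a) zro (suc zro)))"
  define F where "F = den (upd envz 0 T1 f) ?t"
  have F: "F \<in> Std (T1 \<rightarrow> T1)" unfolding F_def
    by (rule universe_den[OF universe_Std]) (simp_all add: upd_universe envz_universe universe_Std f)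
  have Fx: "qv (F \<bullet> x \<bullet> n) = 2 * nv (f \<bullet> n)" if "x \<in> Val T1" "n \<in> NV" for x n
  proof -
    have "F \<bullet> x \<bullet> n = qmkv (f \<bullet> n \<oplus> f \<bullet> n) zerov onev"
      using that by (simp add: F_def opv qmkv_def del: bracket.simps)
    then show ?thesis using that by (simp add: qv_qmkv)
  qed
  have F0: "qv (F \<bullet> x \<bullet> n) = 0" if "x \<in> Std T1" "n \<in> Std N" for x n
    using Fx[of x n] z that Std_Val by simp
  note ops = U_ops[OF universe_Std] and V = Std_Val
  have q: "q0v \<in> Std N" "q1v \<in> Std N" by (rule U_q[OF universe_Std])+
  have "in_CbarU Std F"
    unfolding in_CbarU_def
  proof (intro conjI)
    show "real_funU Std F"
      unfolding real_funU_def is_realU_def real_eqU_def by (simp add: F0 ops(3) V less_imp_le)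
    show "real_leU Std (ratv q0v) (F \<bullet> ratv q0v)" "real_leU Std (F \<bullet> ratv q1v) (ratv q0v)"
      unfolding real_leU_def by (simp_all add: F0 ops(4) q V less_imp_le)
    have "nearU Std (F \<bullet> x) (F \<bullet> y) k" if "x \<in> Std T1" "y \<in> Std T1" "k \<in> Std N" for x y k
      unfolding nearU_def
      by (rule bexI[of _ "sucv k"]) (use that in \<open>simp_all add: F0 ops(2) V hv_suc\<close>)
    then show "\<forall>x\<in>Std T1. in_unitU Std x \<longrightarrow> (\<forall>k\<in>Std N. \<exists>m\<in>Std N. \<forall>y\<in>Std T1. in_unitU Std y \<longrightarrow>
        nearU Std x y m \<longrightarrow> nearU Std (F \<bullet> x) (F \<bullet> y) k)"
      using ops(1) by blast
  qed
  then obtain x where "x \<in> Std T1" "real_eqU Val (F \<bullet> x) (ratv q0v)"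
    using assms F unfolding ev_IVT by blast
  then have "2 * nv (f \<bullet> n) \<le> hv n"
    using Fx[of x n] V n unfolding real_eqU_def by (metis q01_closed(1,3) abs_of_nonneg diff_zero mult_2 add_nonneg_nonneg nv_nonneg ap_Val fV ratv_closed(2))
  then have "\<not> 1 \<le> nv (f \<bullet> n)" using hv_le_one[OF n] by linarith
  then show "f \<bullet> n = zerov" using nv_ge_one[of "f \<bullet> n"] n by auto
qed

section \<open>Bisection\<close>

text \<open>\<open>is_realU\<close> only speaks of indices \<open>n \<oplus> i\<close> with
  \<open>i\<close> in the universe. Here \<open>i\<close> is the difference of the two indices,
  which lies below \<open>b\<close> and hence in \<open>U\<close>.\<close>

lemma abs_real_dist:
  assumes U: "universe U" and y: "is_realU U y" and ab: "a \<in> U N" "b \<in> U N" "nv a \<le> nv b"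
  shows "\<bar>qv (y \<bullet> a) - qv (y \<bullet> b)\<bar> < hv a"
proof -
  have V: "a \<in> NV" "b \<in> NV" using ab U_Val[OF U] by auto
  obtain i where i: "i \<in> NV" "b = a \<oplus> i" using le_addE[OF V ab(3)] by blast
  then have "nv i \<le> nv b" using V by simp
  then have "i \<in> U N" using U_le[OF U ab(2)] i by blast
  then show ?thesis using y ab(1) i(2) unfolding is_realU_def by blast
qed

lemma in_unitU_Val: "universe U \<Longrightarrow> in_unitU Val x \<Longrightarrow> in_unitU U x"
  using U_Val unfolding in_unitU_def is_realU_def real_leU_def by blast

lemma in_unitU_ratv: "universe U \<Longrightarrow> c \<in> NV \<Longrightarrow> 0 \<le> qv c \<Longrightarrow> qv c \<le> 1 \<Longrightarrow> in_unitU U (ratv c)"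
proof -
  assume U: "universe U" and c: "c \<in> NV" "0 \<le> qv c" "qv c \<le> 1"
  have "0 < hv n" "0 \<le> qv c + hv n" "qv c \<le> 1 + hv n" if "n \<in> NV" for n
    using hv_pos[OF that] c by linarith+
  then show ?thesis
    using U_Val[OF U] c unfolding in_unitU_def is_realU_def real_leU_def by simp
qed

lemma q01v: "q0v = pairv (pairv zerov zerov) zerov" "q1v = pairv (pairv onev zerov) zerov"
  by (simp_all add: q0v_def q1v_def qmkv_def)

lemma tmd_q [intro!]:
  "tmd N f \<Longrightarrow> tmd N (\<lambda>v. qhalfv (f v))"
  "tmd N f \<Longrightarrow> tmd N g \<Longrightarrow> tmd N (\<lambda>v. qaddv (f v) (g v))"
  "tmd N f \<Longrightarrow> tmd N g \<Longrightarrow> tmd N (\<lambda>v. qlev (f v) (g v))"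
  unfolding qhalfv_def qaddv_def qlev_def qmkv_def qposv_def qnegv_def qdenv_def
  by (auto intro!: tmd_const)

end

lemma sole_fresh: "x \<notin> names_tm t \<Longrightarrow> sole x \<sigma> t"
  by (induction t) auto

lemma sole_q: "sole x \<sigma> (qadd s t) \<longleftrightarrow> sole x \<sigma> s \<and> sole x \<sigma> t" "sole x \<sigma> (qhalf s) \<longleftrightarrow> sole x \<sigma> s"
  "sole x \<sigma> (real_of_rat s) \<longleftrightarrow> sole x \<sigma> s" "sole x \<sigma> (qminus s) \<longleftrightarrow> sole x \<sigma> s"
  by (auto simp: qadd_def qhalf_def real_of_rat_def qminus_def sole_names)

lemma (in embedded_model) sole_tqle: "sole x \<sigma> (tqle s t) \<longleftrightarrow> sole x \<sigma> s \<and> sole x \<sigma> t"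
  by (auto simp: tqle_def sole_names)

definition thalf :: "tm \<Rightarrow> tm" where
  "thalf c = qmk (qpos c) (qneg c) (tadd \<cdot> qden c \<cdot> qden c)"

text \<open>
  With \<open>Free 0\<close> for the functional of \<open>(\<exists>\<^sup>2)\<close> and \<open>Free 1\<close> for the function \<open>f\<close>, the value of
  \<open>sgn_tm\<close> at a code of \<open>q\<close> vanishes iff \<open>f(q) < 0\<close>.  The states of the recursion are pairs of codes
  of the endpoints.  The endpoints themselves are kept, rather than numbers equal to them, so the
  sign conditions are preserved without appeal to the extensionality of \<open>f\<close>.
\<close>

context embedded_model
begin

section \<open>The bisection program\<close>

definition tcond :: "tm \<Rightarrow> tm \<Rightarrow> tm \<Rightarrow> tm" where
  "tcond t a b = rec t a (Con (CK T1 N) \<cdot> (Con (CK N N) \<cdot> b))"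

lemma tcond_ok [simp]:
  "ok sp t \<Longrightarrow> ok sp a \<Longrightarrow> ok sp b \<Longrightarrow> tyof t = N \<Longrightarrow> tyof a = N \<Longrightarrow> tyof b = N \<Longrightarrow> ok sp (tcond t a b)"
  "tyof (tcond t a b) = N"
  by (simp_all add: tcond_def)

lemma den_tcond [simp]:
  assumes "den \<rho> t \<in> NV" "den \<rho> a \<in> NV" "den \<rho> b \<in> NV"
  shows "den \<rho> (tcond t a b) = (if den \<rho> t = zerov then den \<rho> a else den \<rho> b)"
proof -
  let ?K = "cls (Con (CK T1 N)) \<bullet> (cls (Con (CK N N)) \<bullet> den \<rho> b)"
  have K: "?K \<in> Val (N \<rightarrow> N \<rightarrow> N)" using assms by (simp add: ap_Val[of _ T1])
  have "den \<rho> (tcond t a b) = recv (den \<rho> t) (den \<rho> a) ?K" by (simp add: tcond_def opv)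
  moreover have "recv (sucv n) (den \<rho> a) ?K = den \<rho> b" if "n \<in> NV" for n
    using that assms K by (simp add: den_K)
  ultimately show ?thesis
    using assms K NV_cases[of "den \<rho> t"] NV_closed(3)[of "den \<rho> t"] by (metis recv_zero)
qed

definition sgn_tm :: tm where
  "sgn_tm = bracket 3 N (Free 0 T2 \<cdot> bracket 5 N (tmonus \<cdot> suc zro \<cdot>
     tqle q0 (qadd (Free 1 (T1 \<rightarrow> T1) \<cdot> real_of_rat (Free 3 N) \<cdot> Free 5 N) (qhalf (Free 5 N)))))"

definition mid_tm :: tm where
  "mid_tm = thalf (qadd (tfst \<cdot> Free 3 N) (tsnd \<cdot> Free 3 N))"

definition step_tm :: tm where
  "step_tm = bracket 3 N (bracket 4 N (tcond (sgn_tm \<cdot> mid_tm)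
     (tpair \<cdot> (tfst \<cdot> Free 3 N) \<cdot> mid_tm) (tpair \<cdot> mid_tm \<cdot> (tsnd \<cdot> Free 3 N))))"

definition bis_tm :: "tm \<Rightarrow> tm" where
  "bis_tm p = bracket 2 N (p \<cdot> rec (Free 2 N) (tpair \<cdot> q0 \<cdot> q1) step_tm)"

lemma bis_ok [simp]:
  "ok sp sgn_tm" "tyof sgn_tm = N \<rightarrow> N" "ok sp mid_tm" "tyof mid_tm = N" "ok sp step_tm" "tyof step_tm = N \<rightarrow> N \<rightarrow> N"
  "ok sp p \<Longrightarrow> tyof p = T1 \<Longrightarrow> ok sp (bis_tm p)" "tyof p = T1 \<Longrightarrow> tyof (bis_tm p) = T1"
  by (simp_all add: sgn_tm_def mid_tm_def thalf_def step_tm_def bis_tm_def del: bracket.simps)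

lemma names_sgn: "names_tm sgn_tm = {0, 1}"
  by (auto simp: sgn_tm_def names_simps sole_q sole_tqle simp del: bracket.simps)

lemma names_step: "names_tm step_tm \<subseteq> {0, 1}"
proof -
  have "sole x N mid_tm" "names_tm mid_tm = {3}" for x
    by (auto simp: mid_tm_def thalf_def sole_q sole_names)
  moreover have "sole x N sgn_tm" if "x \<noteq> 0" "x \<noteq> 1" for x
    using that names_sgn by (simp add: sole_fresh)
  ultimately show ?thesis
    by (auto simp: step_tm_def tcond_def names_simps names_sgn simp del: bracket.simps)
qed

context
  fixes \<phi> f :: "tm set"
  assumes \<phi>V [simp]: "\<phi> \<in> Val T2" and fV [simp]: "f \<in> Val (T1 \<rightarrow> T1)"
begin

abbreviation "env \<equiv> upd (upd envz 0 T2 \<phi>) 1 (T1 \<rightarrow> T1) f"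
definition "sgnf = den env sgn_tm"
text \<open>The zeros of this sequence are the indices that witness f(c) < 0, namely
  \<open>n\<close> with f(c)_n + 2^-n < 0; \<open>\<phi>\<close> is to decide whether there are
  any.\<close>

definition "testf c = den (upd env 3 N c) (bracket 5 N (tmonus \<cdot> suc zro \<cdot>
     tqle q0 (qadd (Free 1 (T1 \<rightarrow> T1) \<cdot> real_of_rat (Free 3 N) \<cdot> Free 5 N) (qhalf (Free 5 N)))))"
definition "stepf = den env step_tm"
definition "midv s = (let c = qaddv (fstv s) (sndv s) in qmkv (qposv c) (qnegv c) (qdenv c \<oplus> qdenv c))"
definition "state n = recv n (pairv q0v q1v) stepf"
definition "left n = fstv (state n)"
definition "right n = sndv (state n)"

lemma sgnf_Val [simp]: "sgnf \<in> Val (N \<rightarrow> N)" "stepf \<in> Val (N \<rightarrow> N \<rightarrow> N)"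
  by (simp_all add: sgnf_def stepf_def)

lemma sgnf: "c \<in> NV \<Longrightarrow> sgnf \<bullet> c = \<phi> \<bullet> testf c"
  by (simp add: sgnf_def sgn_tm_def testf_def del: bracket.simps)

lemma testf: "c \<in> NV \<Longrightarrow> n \<in> NV \<Longrightarrow> testf c \<bullet> n = zerov \<longleftrightarrow> qv (f \<bullet> ratv c \<bullet> n) + hv n < 0"
  by (simp add: testf_def opv q01v(1)[symmetric] onev_monusv_zero not_le del: bracket.simps monusv_suc)

lemma midv: "s \<in> NV \<Longrightarrow> midv s \<in> NV" "s \<in> NV \<Longrightarrow> qv (midv s) = (qv (fstv s) + qv (sndv s)) / 2"
proof -
  assume s: "s \<in> NV"
  let ?c = "qaddv (fstv s) (sndv s)"
  show "midv s \<in> NV" using s by (simp add: midv_def Let_def)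
  have c: "?c \<in> NV" using s by simp
  have nz: "qdenv ?c \<oplus> qdenv ?c \<noteq> zerov" using addv_eq_zero qdenv_nonzero(1)[OF c] c q_closed(3) by blast
  have "qv (midv s) = qv ?c / 2"
  proof -
    have "qv (midv s) = (nv (qposv ?c) - nv (qnegv ?c)) / (nv (qdenv ?c) + nv (qdenv ?c))"
      using c nz by (simp add: midv_def Let_def qv_qmkv del: mult_2)
    then show ?thesis unfolding qv_def by (simp only: mult_2_right[symmetric] divide_divide_eq_left)
  qed
  then show "qv (midv s) = (qv (fstv s) + qv (sndv s)) / 2" using s by simp
qed

lemma stepf:
  assumes s: "s \<in> NV" "i \<in> NV"
  shows "stepf \<bullet> s \<bullet> i = (if sgnf \<bullet> midv s = zerov then pairv (fstv s) (midv s) else pairv (midv s) (sndv s))"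
proof -
  have mid: "den (upd (upd env 3 N s) 4 N i) mid_tm = midv s"
    by (simp add: mid_tm_def thalf_def midv_def opv Let_def qposv_def qnegv_def qdenv_def qmkv_def)
  have sgn: "den (upd (upd env 3 N s) 4 N i) sgn_tm = sgnf"
    unfolding sgnf_def by (simp add: den_upd_fresh names_sgn)
  show ?thesis
    using s mid sgn midv(1)[OF s(1)] by (simp add: stepf_def step_tm_def opv del: bracket.simps)
qed

lemma state_Val [simp]: "n \<in> NV \<Longrightarrow> state n \<in> NV" "n \<in> NV \<Longrightarrow> left n \<in> NV" "n \<in> NV \<Longrightarrow> right n \<in> NV"
  by (simp_all add: state_def left_def right_def)

lemma state_zero: "left zerov = q0v" "right zerov = q1v"
  by (simp_all add: left_def right_def state_def)

lemma state_suc: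
  assumes n: "n \<in> NV"
  obtains m where "m \<in> NV" "qv m = (qv (left n) + qv (right n)) / 2"
    "(sgnf \<bullet> m = zerov \<and> left (sucv n) = left n \<and> right (sucv n) = m) \<or>
     (sgnf \<bullet> m \<noteq> zerov \<and> left (sucv n) = m \<and> right (sucv n) = right n)"
proof
  show "midv (state n) \<in> NV" using n midv by simp
  show "qv (midv (state n)) = (qv (left n) + qv (right n)) / 2" using n midv by (simp add: left_def right_def)
  have "state (sucv n) = stepf \<bullet> state n \<bullet> n" using n by (simp add: state_def)
  then show "(sgnf \<bullet> midv (state n) = zerov \<and> left (sucv n) = left n \<and> right (sucv n) = midv (state n)) \<or>
     (sgnf \<bullet> midv (state n) \<noteq> zerov \<and> left (sucv n) = midv (state n) \<and> right (sucv n) = right n)"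
    using n midv(1)[of "state n"] by (simp add: left_def right_def stepf)
qed

lemma tmd_state [intro!]: "tmd N h \<Longrightarrow> tmd N (\<lambda>v. left (h v))" "tmd N h \<Longrightarrow> tmd N (\<lambda>v. right (h v))"
  unfolding left_def right_def state_def by auto

lemma bis_left: "n \<in> NV \<Longrightarrow> den env (bis_tm tfst) \<bullet> n = left n"
  and bis_right: "n \<in> NV \<Longrightarrow> den env (bis_tm tsnd) \<bullet> n = right n"
proof -
  have "den (upd env 2 N n) step_tm = stepf"
    unfolding stepf_def by (rule den_upd_fresh) (use names_step in auto)
  then show "n \<in> NV \<Longrightarrow> den env (bis_tm tfst) \<bullet> n = left n" "n \<in> NV \<Longrightarrow> den env (bis_tm tsnd) \<bullet> n = right n"
    by (simp_all add: bis_tm_def left_def right_def state_def opv q01v[symmetric] del: bracket.simps)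
qed

lemma right_left: "n \<in> NV \<Longrightarrow> qv (right n) = qv (left n) + hv n"
proof -
  assume n: "n \<in> NV"
  \<comment> \<open>Equal rationals may have different codes, so the invariant is a pair of
    comparisons.\<close>
  then have "qlev (right n) (qaddv (left n) (qhalfv n)) = zerov \<and> qlev (qaddv (left n) (qhalfv n)) (right n) = zerov"
  proof (induction rule: QF_induct)
    case (suc n)
    then have IH: "qv (right n) = qv (left n) + hv n" by simp
    obtain m where "m \<in> NV" "qv m = (qv (left n) + qv (right n)) / 2"
      "(left (sucv n) = left n \<and> right (sucv n) = m) \<or> (left (sucv n) = m \<and> right (sucv n) = right n)"
      using state_suc[OF suc(1)] by metis
    then show ?case using suc(1) IH by (auto simp: hv_suc field_simps)
  qed (auto simp: state_zero)
  then show ?thesis using n by simp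
qed

lemma nested:
  assumes n: "n \<in> NV" "i \<in> NV"
  shows "qv (left n) \<le> qv (left (n \<oplus> i))" "qv (right (n \<oplus> i)) \<le> qv (right n)"
proof -
  have "qlev (left n) (left (n \<oplus> i)) = zerov \<and> qlev (right (n \<oplus> i)) (right n) = zerov" using n(2)
  proof (induction rule: QF_induct)
    case (suc i)
    let ?k = "n \<oplus> i"
    have k: "?k \<in> NV" using n suc by simp
    have IH: "qv (left n) \<le> qv (left ?k)" "qv (right ?k) \<le> qv (right n)" using suc n by simp_all
    have "qv (left ?k) \<le> qv (left (sucv ?k)) \<and> qv (right (sucv ?k)) \<le> qv (right ?k)"
      using right_left[OF k] hv_pos[OF k] by (rule_tac state_suc[OF k]) (elim disjE conjE; simp)
    then show ?case using suc(1) n IH by (simp add: order_trans[OF IH(1)] order_trans[OF _ IH(2)])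
  qed (use n in auto)
  then show "qv (left n) \<le> qv (left (n \<oplus> i))" "qv (right (n \<oplus> i)) \<le> qv (right n)" using n by auto
qed

lemma bounds: "n \<in> NV \<Longrightarrow> 0 \<le> qv (left n)" "n \<in> NV \<Longrightarrow> qv (left n) \<le> 1" "n \<in> NV \<Longrightarrow> 0 \<le> qv (right n)" "n \<in> NV \<Longrightarrow> qv (right n) \<le> 1"
  using nested[of zerov n] right_left[of n] hv_pos[of n] by (auto simp: state_zero simp del: hv_pos)

text \<open>The assumption f(1) \<le> 0 does not make f(1) < 0, so the right endpoint is recorded as
  being 1 itself until it first moves to a point of negative value.\<close>

lemma signs:
  assumes "sgnf \<bullet> q0v \<noteq> zerov" "n \<in> NV"
  shows "sgnf \<bullet> left n \<noteq> zerov" "right n = q1v \<or> sgnf \<bullet> right n = zerov"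
proof -
  have "sgnf \<bullet> left n \<noteq> zerov \<and> (right n = q1v \<or> sgnf \<bullet> right n = zerov)" using assms(2)
  proof (induction rule: QF_induct)
    case zero
    show ?case using assms(1) by (simp add: state_zero)
  next
    case (suc n)
    obtain m where
      "(sgnf \<bullet> m = zerov \<and> left (sucv n) = left n \<and> right (sucv n) = m) \<or>
       (sgnf \<bullet> m \<noteq> zerov \<and> left (sucv n) = m \<and> right (sucv n) = right n)"
      using state_suc[OF suc(1)] by metis
    then show ?case using suc(2) by metis
  qed (auto intro!: tmd_apN)
  then show "sgnf \<bullet> left n \<noteq> zerov" "right n = q1v \<or> sgnf \<bullet> right n = zerov" by auto
qed

definition "root = den env (bis_tm tfst)"

lemma root_at [simp]: "n \<in> NV \<Longrightarrow> root \<bullet> n = left n"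
  unfolding root_def by (rule bis_left)

text \<open>left(n + i) < right(n + i) \<le> right(n) = left(n) + 2^-n. The argument rests on the
  nesting alone and not on signs, so it covers all indices and not merely the standard ones.\<close>

lemma root_unit: "in_unitU Val root"
  unfolding in_unitU_def is_realU_def real_leU_def
proof (intro conjI ballI)
  fix n i assume ni: "n \<in> NV" "i \<in> NV"
  have "qv (left (n \<oplus> i)) < qv (left n) + hv n"
    using nested[OF ni] right_left[of n] right_left[of "n \<oplus> i"] hv_pos[of "n \<oplus> i"] ni by (auto simp del: hv_pos)
  then show "\<bar>qv (root \<bullet> n) - qv (root \<bullet> (n \<oplus> i))\<bar> < hv n"
    using nested(1)[OF ni] ni by (simp add: abs_if)
next
  fix n assume n: "n \<in> NV"
  show "qv (ratv q0v \<bullet> n) \<le> qv (root \<bullet> n) + hv n" "qv (root \<bullet> n) \<le> qv (ratv q1v \<bullet> n) + hv n"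
    using bounds[OF n] hv_pos[OF n] n by (simp_all del: hv_pos)
qed

end

section \<open>Correctness of bisection in a universe\<close>

lemma sgnf_nonzero:
  assumes U: "universe U" and \<phi>: "\<phi> \<in> U T2" "is_exists2 U \<phi>" and f: "f \<in> U (T1 \<rightarrow> T1)" and c: "c \<in> U N"
  shows "sgnf \<phi> f \<bullet> c = zerov \<longleftrightarrow> (\<exists>n\<in>U N. qv (f \<bullet> ratv c \<bullet> n) + hv n < 0)"
proof -
  note V = U_Val[OF U]
  have "testf \<phi> f c \<in> U T1" unfolding testf_def[OF V[OF \<phi>(1)] V[OF f]]
    by (rule universe_den[OF U]) (simp_all add: upd_universe envz_universe U \<phi> f c)
  then have "sgnf \<phi> f \<bullet> c = zerov \<longleftrightarrow> (\<exists>n\<in>U N. testf \<phi> f c \<bullet> n = zerov)"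
    using \<phi>(2) sgnf[OF V[OF \<phi>(1)] V[OF f] V[OF c]] unfolding is_exists2_def by metis
  also have "\<dots> \<longleftrightarrow> (\<exists>n\<in>U N. qv (f \<bullet> ratv c \<bullet> n) + hv n < 0)"
    using testf[OF V[OF \<phi>(1)] V[OF f] V[OF c]] V by metis
  finally show ?thesis .
qed

lemma root_in_U:
  assumes U: "universe U" and \<phi>: "\<phi> \<in> U T2" and f: "f \<in> U (T1 \<rightarrow> T1)" and n: "n \<in> U N"
  shows "root \<phi> f \<in> U T1" "left \<phi> f n \<in> U N" "right \<phi> f n \<in> U N"
proof -
  note V = U_Val[OF U]
  let ?env = "upd (upd envz 0 T2 \<phi>) 1 (T1 \<rightarrow> T1) f"
  have *: "den ?env (bis_tm p) \<in> U T1" if "ok sp p" "tyof p = T1" for p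
    by (rule universe_den[OF U]) (use that in \<open>simp_all add: upd_universe envz_universe U \<phi> f\<close>)
  then show "root \<phi> f \<in> U T1" unfolding root_def[OF V[OF \<phi>] V[OF f]] by simp
  show "left \<phi> f n \<in> U N" "right \<phi> f n \<in> U N"
    unfolding bis_left[OF V[OF \<phi>] V[OF f] V[OF n], symmetric] bis_right[OF V[OF \<phi>] V[OF f] V[OF n], symmetric]
    using U_ap[OF U *[of tfst] n] U_ap[OF U *[of tsnd] n] by simp_all
qed

text \<open>If f(x) had distance at least 2^-k from 0, continuity would bring the values at both
  endpoints of a late stage closer than 2^-k to f(x). A positive f(x) contradicts f \<le> 0 at the
  right endpoint, a negative one f \<ge> 0 at the left.\<close>

lemma root_zero:
  assumes U: "universe U" and \<phi>: "\<phi> \<in> U T2" "is_exists2 U \<phi>" and f: "f \<in> U (T1 \<rightarrow> T1)"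
    and C: "in_CbarU U f"
  shows "real_eqU U (f \<bullet> root \<phi> f) (ratv q0v)"
proof (rule ccontr)
  note V = U_Val[OF U] and ops = U_ops[OF U] and q = U_q[OF U]
  note V' = V[OF \<phi>(1)] V[OF f]
  let ?x = "root \<phi> f" and ?l = "left \<phi> f" and ?r = "right \<phi> f"
  define y where "y = f \<bullet> ?x"
  have zU: "zerov \<in> U N" by (rule ops)
  have q0U: "q0v \<in> U N" by (rule q)
  have xU: "?x \<in> U T1" using root_in_U[OF U \<phi>(1) f zU] by blast
  have unit: "in_unitU U ?x" using in_unitU_Val[OF U root_unit[OF V']] .
  have refl: "real_eqU U z z" for z unfolding real_eqU_def by (simp add: less_imp_le V)
  have freal: "is_realU U (f \<bullet> z)" if "z \<in> U T1" "is_realU U z" for z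
    using C that refl[of z] unfolding in_CbarU_def real_funU_def by blast
  have yR: "is_realU U y" unfolding y_def using freal xU unit unfolding in_unitU_def by blast
  assume "\<not> real_eqU U (f \<bullet> root \<phi> f) (ratv q0v)"
  then obtain n0 where n0: "n0 \<in> U N" "hv n0 < \<bar>qv (y \<bullet> n0)\<bar>"
    unfolding real_eqU_def y_def[symmetric] by (auto simp: not_le V)
  \<comment> \<open>A code for the excess of |y| at \<open>n0\<close> over 2^-n0, so that
    \<open>hv_qdenv\<close> supplies a precision \<open>k\<close> inside the universe.\<close>
  define d where "d = qaddv (qabsv (y \<bullet> n0)) (qminusv (qhalfv n0))"
  have yn: "y \<bullet> n0 \<in> U N" using U_ap[OF U _ n0(1)] U_ap[OF U f xU] by (simp add: y_def)
  have dU: "d \<in> U N" unfolding d_def by (simp add: q yn n0(1))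
  define k where "k = qdenv d"
  have kU: "k \<in> U N" unfolding k_def by (simp add: q dU)
  have dv: "qv d = \<bar>qv (y \<bullet> n0)\<bar> - hv n0" unfolding d_def using V[OF yn] V[OF n0(1)] by simp
  then have hk: "hv k \<le> \<bar>qv (y \<bullet> n0)\<bar> - hv n0"
    using hv_qdenv[OF V[OF dU]] n0(2) unfolding k_def by simp
  obtain m where m: "m \<in> U N" and
    near: "\<And>z. z \<in> U T1 \<Longrightarrow> in_unitU U z \<Longrightarrow> nearU U ?x z m \<Longrightarrow> nearU U y (f \<bullet> z) k"
    using C xU unit kU unfolding in_CbarU_def y_def by blast
  \<comment> \<open>At this stage the endpoints are within 2^-m / 4 of the approximation to x, and
    nearness tested at index \<open>sucv m\<close> costs a further 2^-m / 2.\<close>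
  define e where "e = sucv (sucv m)"
  have eU: "e \<in> U N" and mV: "m \<in> NV" and eV: "e \<in> NV" unfolding e_def using m by (simp_all add: ops V)
  have he: "hv e = hv m / 4" unfolding e_def using mV by (simp add: hv_suc)
  have "sgnf \<phi> f \<bullet> q0v \<noteq> zerov"
  proof
    assume "sgnf \<phi> f \<bullet> q0v = zerov"
    then obtain n where n: "n \<in> U N" "qv (f \<bullet> ratv q0v \<bullet> n) + hv n < 0"
      using sgnf_nonzero[OF U \<phi> f q0U] by blast
    have "real_leU U (ratv q0v) (f \<bullet> ratv q0v)" using C by (simp add: in_CbarU_def)
    then have "qv (ratv q0v \<bullet> n) \<le> qv (f \<bullet> ratv q0v \<bullet> n) + hv n" using n(1) by (simp add: real_leU_def)
    then show False using n by (simp add: V)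
  qed
  note signs = signs[OF V' this eV]
  have close: "\<exists>j\<in>U N. \<bar>qv (y \<bullet> sucv j) - qv (f \<bullet> ratv c \<bullet> sucv j)\<bar> + hv j < hv k"
    and cR: "is_realU U (f \<bullet> ratv c)" if c: "c = ?l e \<or> c = ?r e" for c
  proof -
    have cU: "c \<in> U N" using c root_in_U[OF U \<phi>(1) f eU] by auto
    have cb: "0 \<le> qv c" "qv c \<le> 1" using c bounds[OF V' eV] by auto
    have cunit: "in_unitU U (ratv c)" using in_unitU_ratv[OF U V[OF cU] cb] .
    have rU: "ratv c \<in> U T1" using ops cU by blast
    show "is_realU U (f \<bullet> ratv c)" using freal rU cunit unfolding in_unitU_def by blast
    have "\<bar>qv (?l e) - qv c\<bar> \<le> hv e" using c right_left[OF V' eV] hv_pos[OF eV] by (auto simp: abs_if)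
    then have "\<bar>qv (?x \<bullet> e) - qv (ratv c \<bullet> e)\<bar> + hv (sucv m) < hv m"
      using root_at[OF V' eV] V[OF cU] eV he mV hv_pos[OF mV] by (simp add: hv_suc del: hv_pos)
    then have "nearU U ?x (ratv c) m" unfolding nearU_def e_def using ops m by blast
    then have "nearU U y (f \<bullet> ratv c) k" using near rU cunit by blast
    then show "\<exists>j\<in>U N. \<bar>qv (y \<bullet> sucv j) - qv (f \<bullet> ratv c \<bullet> sucv j)\<bar> + hv j < hv k"
      unfolding nearU_def .
  qed
  \<comment> \<open>Fast convergence bounds the distance by the term for the smaller index, and
    either index may be the smaller.\<close>
  have dist: "\<bar>qv (y \<bullet> n0) - qv (y \<bullet> sucv j)\<bar> < hv n0 \<or> \<bar>qv (y \<bullet> n0) - qv (y \<bullet> sucv j)\<bar> < hv (sucv j)"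
    if j: "j \<in> U N" for j
  proof -
    have jU: "sucv j \<in> U N" using ops j by blast
    show ?thesis
      using abs_real_dist[OF U yR n0(1) jU] abs_real_dist[OF U yR jU n0(1)]
        linear[of "nv n0" "nv (sucv j)"] by (auto simp: abs_minus_commute)
  qed
  show False
  proof (cases "0 < qv (y \<bullet> n0)")
    case True
    let ?c = "?r e"
    have cU: "?c \<in> U N" using root_in_U[OF U \<phi>(1) f eU] by auto
    obtain j where j: "j \<in> U N" "\<bar>qv (y \<bullet> sucv j) - qv (f \<bullet> ratv ?c \<bullet> sucv j)\<bar> + hv j < hv k"
      using close[of ?c] by blast
    have jU: "sucv j \<in> U N" using ops j(1) by blast
    have jV: "j \<in> NV" using V[OF j(1)] .
    \<comment> \<open>Read at index j + 1, f(c) \<le> 0 leaves an error of 2^-(j+1). Half of the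
      2^-j in \<open>j(2)\<close> pays for it; the other half and the 2^-n0 in \<open>hk\<close>
      together beat \<open>dist\<close>.\<close>
    have "qv (f \<bullet> ratv ?c \<bullet> sucv j) \<le> hv (sucv j)" using signs(2)
    proof
      assume c1: "?c = q1v"
      have "real_leU U (f \<bullet> ratv q1v) (ratv q0v)" using C by (simp add: in_CbarU_def)
      then show ?thesis using jU V[OF jU] unfolding real_leU_def c1 by force
    next
      assume "sgnf \<phi> f \<bullet> ?c = zerov"
      then obtain n where n: "n \<in> U N" "qv (f \<bullet> ratv ?c \<bullet> n) + hv n < 0"
        using sgnf_nonzero[OF U \<phi> f cU] by blast
      have cr: "is_realU U (f \<bullet> ratv ?c)" using cR[of ?c] by blast
      have "\<bar>qv (f \<bullet> ratv ?c \<bullet> n) - qv (f \<bullet> ratv ?c \<bullet> sucv j)\<bar> < hv n \<or>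
          \<bar>qv (f \<bullet> ratv ?c \<bullet> n) - qv (f \<bullet> ratv ?c \<bullet> sucv j)\<bar> < hv (sucv j)"
        using abs_real_dist[OF U cr n(1) jU] abs_real_dist[OF U cr jU n(1)]
          linear[of "nv n" "nv (sucv j)"] by (auto simp: abs_minus_commute)
      then show ?thesis using n(2) hv_pos[OF V[OF n(1)]] hv_pos[OF V[OF jU]] by linarith
    qed
    then have "qv (y \<bullet> sucv j) < hv k - hv (sucv j)" using j(2) hv_suc[OF jV] by linarith
    then show False using dist[OF j(1)] hk True hv_pos[OF V[OF n0(1)]] hv_pos[OF V[OF jU]] by linarith
  next
    case False
    let ?c = "?l e"
    have cU: "?c \<in> U N" using root_in_U[OF U \<phi>(1) f eU] by auto
    obtain j where j: "j \<in> U N" "\<bar>qv (y \<bullet> sucv j) - qv (f \<bullet> ratv ?c \<bullet> sucv j)\<bar> + hv j < hv k"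
      using close[of ?c] by blast
    have jU: "sucv j \<in> U N" using ops j(1) by blast
    have jV: "j \<in> NV" using V[OF j(1)] .
    have "- hv (sucv j) \<le> qv (f \<bullet> ratv ?c \<bullet> sucv j)"
      using sgnf_nonzero[OF U \<phi> f cU] signs(1) jU by (force simp: not_less)
    then have "hv (sucv j) - hv k < qv (y \<bullet> sucv j)" using j(2) hv_suc[OF jV] by linarith
    then show False
      using dist[OF j(1)] hk False n0(2) hv_pos[OF V[OF n0(1)]] hv_pos[OF V[OF jU]] by linarith
  qed
qed

section \<open>The uniform intermediate value theorem\<close>

lemma exists2_imp_UIVT:
  assumes "ev exists2" shows "ev UIVT"
proof -
  obtain \<phi> where \<phi>: "\<phi> \<in> Val T2" "is_exists2 Val \<phi>" using assms unfolding ev_exists2 is_exists2_def by blast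
  define \<Phi> where "\<Phi> = den (upd envz 0 T2 \<phi>) (bracket 1 (T1 \<rightarrow> T1) (bis_tm tfst))"
  have \<Phi>: "\<Phi> \<in> Val ((T1 \<rightarrow> T1) \<rightarrow> T1)" using \<phi> by (simp add: \<Phi>_def)
  have "\<Phi> \<bullet> f = root \<phi> f" if "f \<in> Val (T1 \<rightarrow> T1)" for f
    using that \<phi> by (simp add: \<Phi>_def root_def)
  then show ?thesis
    unfolding ev_UIVT
    using \<Phi> root_unit[OF \<phi>(1)] root_zero[OF universe_Val \<phi>] unfolding in_unitU_def by metis
qed

text \<open>Continuity is given relative to the standard objects only, so the bisection is verified
  there. The value is then 0 as far as standard indices show; transfer for the sequence that tests
  |y_n| \<le> 2^-n extends this to all indices.\<close>

lemma Pi01_imp_IVT: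
  assumes adm: "admissible sp" and T: "ev Pi01_TRANS" shows "ev IVT_star"
  unfolding ev_IVT
proof (intro ballI impI)
  obtain \<phi> where \<phi>: "\<phi> \<in> Std T2" "is_exists2 Val \<phi>" using Pi01_imp_standard_exists2[OF assms] by blast
  \<comment> \<open>Correctness among all objects passes to the standard ones because a standard
    sequence with a zero has a standard zero.\<close>
  have \<phi>S: "is_exists2 Std \<phi>"
    using \<phi>(2) Pi01_Std_zero[OF T] Std_Val unfolding is_exists2_def by metis
  fix f assume f: "f \<in> Std (T1 \<rightarrow> T1)" "in_CbarU Std f"
  note z = U_ops(1)[OF universe_Std]
  let ?x = "root \<phi> f"
  have x: "?x \<in> Std T1" using root_in_U[OF universe_Std \<phi>(1) f(1) z] by blast
  have eq: "real_eqU Std (f \<bullet> ?x) (ratv q0v)" by (rule root_zero[OF universe_Std \<phi>(1) \<phi>S f])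
  define y where "y = f \<bullet> ?x"
  have y: "y \<in> Std T1" unfolding y_def using f(1) x by (rule Std_ap)
  let ?t = "bracket 1 N (tqle (qabs (Free 0 T1 \<cdot> Free 1 N)) (qhalf (Free 1 N)))"
  define g where "g = den (upd envz 0 T1 y) ?t"
  have g: "g \<in> Std T1" unfolding g_def
    by (rule universe_den[OF universe_Std]) (simp_all add: upd_universe envz_universe universe_Std y)
  have gz: "g \<bullet> n = zerov \<longleftrightarrow> \<bar>qv (y \<bullet> n)\<bar> \<le> hv n" if "n \<in> NV" for n
    using that Std_Val[OF y] by (simp add: g_def del: bracket.simps)
  have "\<forall>n\<in>Std N. g \<bullet> n = zerov"
    using eq unfolding real_eqU_def y_def[symmetric] by (simp add: gz Std_Val)
  then have "\<forall>n\<in>NV. g \<bullet> n = zerov" using T g unfolding ev_Pi01 by blast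
  then have "real_eqU Val y (ratv q0v)" unfolding real_eqU_def using gz by simp
  moreover have "in_unitU Val ?x" using root_unit Std_Val \<phi>(1) f(1) by blast
  ultimately show "\<exists>x\<in>Std T1. in_unitU Val x \<and> real_eqU Val (f \<bullet> x) (ratv q0v)"
    using x unfolding y_def by blast
qed

text \<open>At \<open>n\<close> the value is j + 1 for the first zero j < n of the sequence, and 0
  while there is none; the shift by one keeps 0 free for this.\<close>

definition first_tm :: tm where
  "first_tm = bracket 2 N (rec (Free 2 N) zro (bracket 3 N (bracket 4 N
     (tcond (Free 3 N) (tcond (Free 0 T1 \<cdot> Free 4 N) (suc (Free 4 N)) zro) (Free 3 N)))))"

text \<open>
  The function \<open>x \<mapsto> max (-\<epsilon>) (min \<epsilon> (a - x))\<close>, where \<open>a\<close> is \<open>Free 1\<close>, and \<open>\<epsilon>\<close> is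
  \<open>2\<^sup>-\<^sup>(\<^sup>j\<^sup>+\<^sup>1\<^sup>)\<close> for the first zero \<open>j\<close> of the sequence \<open>Free 0\<close>, or 0 if there is none.  In the former case
  \<open>a\<close> is its only root; in the latter case the function does not depend on \<open>a\<close> at all.
\<close>

definition ramp_tm :: tm where
  "ramp_tm = (let j = first_tm \<cdot> Free 6 N; e = qhalf j; d = qadd (Free 1 N) (qminus (Free 5 T1 \<cdot> Free 6 N))
     in bracket 5 T1 (bracket 6 N (tcond j q0
          (tcond (tqle e d) e (tcond (tqle d (qminus e)) (qminus e) d)))))"

lemma ramp_ok [simp]: "ok sp first_tm" "tyof first_tm = T1" "ok sp ramp_tm" "tyof ramp_tm = T1 \<rightarrow> T1"
  by (simp_all add: first_tm_def ramp_tm_def Let_def del: bracket.simps)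

lemma names_first: "names_tm first_tm \<subseteq> {0}"
  by (auto simp: first_tm_def tcond_def names_simps simp del: bracket.simps)

lemma names_ramp: "names_tm ramp_tm \<subseteq> {0, 1}"
proof -
  have first: "sole x \<sigma> first_tm" if "x \<noteq> 0" for x \<sigma> using names_first that by (auto intro!: sole_fresh)
  show ?thesis using names_first
    by (auto simp: ramp_tm_def Let_def tcond_def names_simps sole_q sole_tqle first simp del: bracket.simps)
qed

definition clamp :: "'k \<Rightarrow> 'k \<Rightarrow> 'k" where "clamp e d = max (- e) (min e d)"

text \<open>Maximum, minimum and negation are nonexpansive in the maximum norm, so the values of the
  ramp converge as fast as the approximations of \<epsilon> and x, without reindexing.\<close>

lemma clamp_dist: "\<bar>e - e'\<bar> < h \<Longrightarrow> \<bar>d - d'\<bar> < h \<Longrightarrow> \<bar>clamp e d - clamp e' d'\<bar> < h"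
  unfolding clamp_def abs_less_iff by (auto simp: max_def min_def)

lemma clamp_dist_le: "0 \<le> e \<Longrightarrow> \<bar>clamp e d - clamp e d'\<bar> \<le> \<bar>d - d'\<bar>"
  unfolding clamp_def by (auto simp: max_def min_def abs_if)

context
  fixes g a :: "tm set"
  assumes gV [simp]: "g \<in> Val T1" and aV [simp]: "a \<in> NV"
begin

abbreviation "renv \<equiv> upd (upd envz 0 T1 g) 1 N a"
definition "firstv n = den renv first_tm \<bullet> n"
definition "ramp = den renv ramp_tm"
definition "eps n = (if firstv n = zerov then 0 else hv (firstv n))"

lemma firstv_closed [simp]: "n \<in> NV \<Longrightarrow> firstv n \<in> NV"
  by (simp add: firstv_def)

lemma firstv_zero: "firstv zerov = zerov"
  and firstv_suc: "n \<in> NV \<Longrightarrow> firstv (sucv n) =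
    (if firstv n = zerov then if g \<bullet> n = zerov then sucv n else zerov else firstv n)"
proof -
  let ?S = "bracket 3 N (bracket 4 N
     (tcond (Free 3 N) (tcond (Free 0 T1 \<cdot> Free 4 N) (suc (Free 4 N)) zro) (Free 3 N)))"
  have S: "den (upd renv 2 N n) ?S = den renv ?S" for n
    by (rule den_upd_fresh) (simp add: names_simps tcond_def del: bracket.simps)
  have F: "firstv n = recv n zerov (den renv ?S)" if "n \<in> NV" for n
    using that S[of n] by (simp add: firstv_def first_tm_def opv del: bracket.simps)
  have SV: "den renv ?S \<in> Val (N \<rightarrow> N \<rightarrow> N)" by (simp del: bracket.simps)
  show "firstv zerov = zerov" using F[of zerov] SV by simp
  show "firstv (sucv n) = (if firstv n = zerov then if g \<bullet> n = zerov then sucv n else zerov else firstv n)"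
    if n: "n \<in> NV"
  proof -
    have "den renv ?S \<bullet> r \<bullet> n = (if r = zerov then if g \<bullet> n = zerov then sucv n else zerov else r)" if "r \<in> NV" for r
      using that n by (simp add: opv del: bracket.simps)
    then show ?thesis using F[of "sucv n"] F[of n] n SV firstv_closed[OF n] by simp
  qed
qed

lemma tmd_firstv [intro!]: "tmd N h \<Longrightarrow> tmd N (\<lambda>v. firstv (h v))"
  unfolding firstv_def by (rule tmd_apN) simp

lemma firstv_stable:
  assumes "n \<in> NV" "firstv n \<noteq> zerov" "i \<in> NV" shows "firstv (n \<oplus> i) = firstv n"
  using assms(3)
proof (induction rule: QF_induct)
  case (suc i)
  then show ?case using assms firstv_suc[of "n \<oplus> i"] by simp
qed (use assms in auto)

lemma firstv_late:
  assumes "n \<in> NV" "firstv n = zerov" "i \<in> NV" shows "firstv (n \<oplus> i) = zerov \<or> nv n + 1 \<le> nv (firstv (n \<oplus> i))"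
proof -
  have "firstv (n \<oplus> i) = zerov \<or> sucv n \<ominus> firstv (n \<oplus> i) = zerov" using assms(3)
  proof (induction rule: QF_induct)
    case (suc i)
    have "sucv n \<ominus> sucv (n \<oplus> i) = zerov"
      using assms suc by (simp add: monusv_eq_zero del: monusv_suc suc_monusv)
    then show ?case using assms suc firstv_suc[of "n \<oplus> i"]
      by (cases "firstv (n \<oplus> i) = zerov") (simp_all del: monusv_suc suc_monusv)
  qed (use assms in auto)
  then show ?thesis using assms by (auto simp: monusv_eq_zero simp del: monusv_suc)
qed

lemma eps_nonneg [simp]: "n \<in> NV \<Longrightarrow> 0 \<le> eps n"
  by (simp add: eps_def less_imp_le)

text \<open>While no zero has appeared below \<open>n\<close> the approximation is 0, and a zero
  that appears later is at least \<open>n\<close>, so it changes the value by at most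
  2^-(n+1).\<close>

lemma eps_dist: assumes "n \<in> NV" "i \<in> NV" shows "\<bar>eps n - eps (n \<oplus> i)\<bar> < hv n"
proof (cases "firstv n = zerov")
  case False
  then show ?thesis using assms by (simp add: eps_def firstv_stable)
next
  case True
  have "hv (firstv (n \<oplus> i)) < hv n" if "firstv (n \<oplus> i) \<noteq> zerov"
  proof -
    have "nv (sucv n) \<le> nv (firstv (n \<oplus> i))" using firstv_late[OF assms(1) True assms(2)] that assms by simp
    then have "hv (firstv (n \<oplus> i)) \<le> hv (sucv n)" using assms by (intro hv_mono) auto
    then show ?thesis using assms hv_pos[of n] by (simp add: hv_suc del: hv_pos)
  qed
  then show ?thesis using True assms by (simp add: eps_def less_imp_le)
qed

lemma ramp_Val [simp]: "ramp \<in> Val (T1 \<rightarrow> T1)"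
  by (simp add: ramp_def)

text \<open>The first part gives the code itself and not merely its rational value; this is what
  identifies the ramp with a constant functional when there is no zero.\<close>

lemma ramp_value:
  assumes "x \<in> Val T1" "n \<in> NV"
  shows "firstv n = zerov \<Longrightarrow> ramp \<bullet> x \<bullet> n = q0v"
    and "qv (ramp \<bullet> x \<bullet> n) = clamp (eps n) (qv a - qv (x \<bullet> n))"
proof -
  let ?\<rho> = "upd (upd renv 5 T1 x) 6 N n"
  have "x \<notin> names_tm first_tm" if "x \<noteq> 0" for x using names_first that by auto
  then have first: "den ?\<rho> first_tm = den renv first_tm" by (simp add: den_upd_fresh)
  then have j: "den ?\<rho> first_tm \<bullet> n = firstv n" by (simp add: firstv_def)
  define d where "d = qaddv a (qminusv (x \<bullet> n))"
  have d: "d \<in> NV" "qv d = qv a - qv (x \<bullet> n)" using assms by (simp_all add: d_def)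
  have R: "ramp \<bullet> x \<bullet> n = (if firstv n = zerov then q0v else
    if hv (firstv n) \<le> qv d then qhalfv (firstv n) else
    if qv d \<le> - hv (firstv n) then qminusv (qhalfv (firstv n)) else d)"
    using assms j firstv_closed[of n]
    by (simp add: ramp_def ramp_tm_def Let_def opv q01v[symmetric] d_def[symmetric] d(1) del: bracket.simps)
  then show "firstv n = zerov \<Longrightarrow> ramp \<bullet> x \<bullet> n = q0v" by simp
  show "qv (ramp \<bullet> x \<bullet> n) = clamp (eps n) (qv a - qv (x \<bullet> n))"
    unfolding R d(2)[symmetric] using assms hv_pos[of "firstv n"]
    by (auto simp: clamp_def eps_def max_def min_def simp del: hv_pos)
qed

lemma ramp_real: "x \<in> Val T1 \<Longrightarrow> is_realU Val x \<Longrightarrow> is_realU Val (ramp \<bullet> x)"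
  unfolding is_realU_def
proof (intro ballI)
  fix n i assume x: "x \<in> Val T1" "\<forall>n\<in>NV. \<forall>i\<in>NV. \<bar>qv (x \<bullet> n) - qv (x \<bullet> (n \<oplus> i))\<bar> < hv n" and ni: "n \<in> NV" "i \<in> NV"
  have "\<bar>(qv a - qv (x \<bullet> n)) - (qv a - qv (x \<bullet> (n \<oplus> i)))\<bar> < hv n"
    using x(2) ni by (simp add: abs_minus_commute)
  then show "\<bar>qv (ramp \<bullet> x \<bullet> n) - qv (ramp \<bullet> x \<bullet> (n \<oplus> i))\<bar> < hv n"
    using eps_dist[OF ni] x(1) ni by (simp add: ramp_value clamp_dist)
qed

lemma ramp_dist:
  "x \<in> Val T1 \<Longrightarrow> y \<in> Val T1 \<Longrightarrow> n \<in> NV \<Longrightarrow>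
    \<bar>qv (ramp \<bullet> x \<bullet> n) - qv (ramp \<bullet> y \<bullet> n)\<bar> \<le> \<bar>qv (x \<bullet> n) - qv (y \<bullet> n)\<bar>"
  using clamp_dist_le[of "eps n" "qv a - qv (x \<bullet> n)" "qv a - qv (y \<bullet> n)"]
  by (simp add: ramp_value abs_minus_commute)

lemma ramp_Cbar:
  assumes "0 \<le> qv a" "qv a \<le> 1" shows "in_CbarU Val ramp"
  unfolding in_CbarU_def
proof (intro conjI)
  show "real_funU Val ramp"
    unfolding real_funU_def
  proof (intro ballI impI conjI)
    fix x y assume x: "x \<in> Val T1" "is_realU Val x" and y: "y \<in> Val T1" "is_realU Val y"
      and eq: "real_eqU Val x y"
    show "is_realU Val (ramp \<bullet> x)" "is_realU Val (ramp \<bullet> y)" using ramp_real x y by blast+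
    show "real_eqU Val (ramp \<bullet> x) (ramp \<bullet> y)"
      unfolding real_eqU_def
    proof
      fix n assume n: "n \<in> NV"
      then have "\<bar>qv (x \<bullet> n) - qv (y \<bullet> n)\<bar> \<le> hv n" using eq by (simp add: real_eqU_def)
      with ramp_dist[OF x(1) y(1) n] show "\<bar>qv (ramp \<bullet> x \<bullet> n) - qv (ramp \<bullet> y \<bullet> n)\<bar> \<le> hv n"
        by (rule order_trans)
    qed
  qed
  have "nearU Val (ramp \<bullet> x) (ramp \<bullet> y) k" if xy: "x \<in> Val T1" "y \<in> Val T1" "nearU Val x y k" for x y k
  proof -
    obtain n where n: "n \<in> NV" "\<bar>qv (x \<bullet> sucv n) - qv (y \<bullet> sucv n)\<bar> + hv n < hv k"
      using xy(3) unfolding nearU_def by blast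
    then show ?thesis unfolding nearU_def using ramp_dist[OF xy(1,2), of "sucv n"]
      by (intro bexI[of _ n]) auto
  qed
  then show "\<forall>x\<in>Val T1. in_unitU Val x \<longrightarrow> (\<forall>k\<in>NV. \<exists>m\<in>NV. \<forall>y\<in>Val T1. in_unitU Val y \<longrightarrow>
      nearU Val x y m \<longrightarrow> nearU Val (ramp \<bullet> x) (ramp \<bullet> y) k)" by blast
  have "0 \<le> clamp (eps n) (qv a)" "clamp (eps n) (qv a - 1) \<le> 0" if "n \<in> NV" for n
    using assms eps_nonneg[OF that] by (auto simp: clamp_def max_def min_def simp del: eps_nonneg)
  then show "real_leU Val (ratv q0v) (ramp \<bullet> ratv q0v)" "real_leU Val (ramp \<bullet> ratv q1v) (ratv q0v)"
    unfolding real_leU_def by (simp_all add: ramp_value(2) less_imp_le add_nonneg_nonneg order_trans[of _ 0])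
qed

lemma ramp_root:
  assumes p: "p \<in> NV" "g \<bullet> p = zerov" and z: "z \<in> Val T1" "is_realU Val z" "real_eqU Val (ramp \<bullet> z) (ratv q0v)"
  shows "\<bar>qv (z \<bullet> sucv onev) - qv a\<bar> < 1 / 2"
proof -
  define j where "j = firstv (sucv p)"
  have j: "j \<in> NV" "j \<noteq> zerov" using p by (auto simp: j_def firstv_suc)
  \<comment> \<open>The index \<open>n\<close> lies past \<open>p\<close>, so the search has ended;
    past \<open>j\<close>, so 2^-n < \<epsilon> and the ramp is not cut off at the root; and past 2,
    where the root is compared with its approximation.\<close>
  define i where "i = sucv j \<oplus> sucv onev"
  define n where "n = sucv p \<oplus> i"
  have iV: "i \<in> NV" "n \<in> NV" using j p by (auto simp: i_def n_def simp del: addv_suc suc_addv)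
  have "firstv n = j" unfolding n_def using firstv_stable[of "sucv p" i] p iV j by (simp add: j_def del: addv_suc suc_addv)
  then have eps: "eps n = hv j" using j by (simp add: eps_def)
  have n: "nv n = nv p + 1 + (nv j + 1 + 2)" using p j iV by (simp add: n_def i_def del: addv_suc suc_addv)
  have "hv n \<le> hv (sucv j)" using n p j iV by (intro hv_mono) auto
  then have "hv n < hv j" using j hv_pos[of j] by (simp add: hv_suc del: hv_pos)
  moreover have "\<bar>clamp (eps n) (qv a - qv (z \<bullet> n))\<bar> \<le> hv n"
    using z(1,3) iV unfolding real_eqU_def by (force simp: ramp_value)
  ultimately have "\<bar>qv a - qv (z \<bullet> n)\<bar> \<le> hv n"
    using hv_pos[OF j(1)] unfolding eps clamp_def by (auto simp: max_def min_def abs_if simp del: hv_pos split: if_splits)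
  moreover have 2: "sucv onev \<in> NV" by simp
  have le2: "nv (sucv onev) \<le> nv n" using n p j by simp
  then have "\<bar>qv (z \<bullet> sucv onev) - qv (z \<bullet> n)\<bar> < hv (sucv onev)"
    by (intro abs_real_dist[OF universe_Val z(2)]) (simp_all add: iV)
  moreover have "hv n \<le> hv (sucv onev)" using hv_mono[OF 2 iV(2) le2] .
  moreover have "hv (sucv onev) = 1 / 4" by (simp add: hv_suc)
  ultimately show ?thesis by (simp add: abs_if split: if_splits)
qed

text \<open>An equation of functionals, as a solution operator for \<open>UIVT\<close> respects
  extensional equality but not necessarily equality of reals. The right-hand side mentions neither
  \<open>g\<close> nor \<open>a\<close>, so the operator has one fixed value on all these
  ramps.\<close>

lemma ramp_no_root:
  assumes "\<And>n. n \<in> NV \<Longrightarrow> g \<bullet> n \<noteq> zerov"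
  shows "ramp = cls (Con (CK T1 T1)) \<bullet> ratv q0v"
proof -
  have 0: "firstv n = zerov" if "n \<in> NV" for n using that
    by (induction rule: QF_induct) (auto simp: firstv_zero firstv_suc assms)
  show ?thesis
  proof (rule Val_ext[of _ T1 T1])
    fix x assume x: "x \<in> Val T1"
    have K: "cls (Con (CK T1 T1)) \<bullet> ratv q0v \<bullet> x = ratv q0v" using x by (simp add: den_K)
    show "ramp \<bullet> x = cls (Con (CK T1 T1)) \<bullet> ratv q0v \<bullet> x"
      unfolding K by (rule Val_ext[of _ N N]) (use x 0 in \<open>simp_all add: ramp_value(1)\<close>)
  qed simp_all
qed

end

lemma UIVT_imp_exists2:
  assumes "ev UIVT" shows "ev exists2"
proof -
  obtain \<Phi> where \<Phi> [simp]: "\<Phi> \<in> Val ((T1 \<rightarrow> T1) \<rightarrow> T1)"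
    and root: "\<And>f. f \<in> Val (T1 \<rightarrow> T1) \<Longrightarrow> in_CbarU Val f \<Longrightarrow>
      is_realU Val (\<Phi> \<bullet> f) \<and> real_eqU Val (f \<bullet> (\<Phi> \<bullet> f)) (ratv q0v)"
    using assms unfolding ev_UIVT by blast
  note [simp] = ap_Val[of _ "T1 \<rightarrow> T1" T1]
  let ?two = "sucv onev"
  \<comment> \<open>The approximation at index 2 of the value of \<Phi> at the zero function; of the
    points 0 and 1, one at distance at least 1/2 from it is taken as \<open>a\<close>.\<close>
  define z where "z = qv (\<Phi> \<bullet> (cls (Con (CK T1 T1)) \<bullet> ratv q0v) \<bullet> ?two)"
  define a where "a = (if 1 / 2 \<le> z then q0v else q1v)"
  have a [simp]: "a \<in> NV" and a01: "0 \<le> qv a" "qv a \<le> 1" and za: "1 / 2 \<le> \<bar>z - qv a\<bar>"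
    by (auto simp: a_def abs_if)
  let ?P = "Free 7 ((T1 \<rightarrow> T1) \<rightarrow> T1)"
  \<comment> \<open>Only rational codes are compared: the result is 0 iff the approximation at index
    2 of the root of the ramp is closer than 1/2 to \<open>a\<close>. The name 7 for \<Phi> is not
    among the names in \<open>ramp_tm\<close>.\<close>
  define \<phi> where "\<phi> = den (upd (upd envz 7 ((T1 \<rightarrow> T1) \<rightarrow> T1) \<Phi>) 1 N a) (bracket 0 T1
    (tmonus \<cdot> suc zro \<cdot> tqle (qhalf (suc zro)) (qdist (?P \<cdot> ramp_tm \<cdot> suc (suc zro)) (Free 1 N))))"
  have \<phi>: "\<phi> \<in> Val T2" by (simp add: \<phi>_def del: bracket.simps)
  have "(\<exists>x\<in>NV. g \<bullet> x = zerov) \<longleftrightarrow> \<phi> \<bullet> g = zerov" if g: "g \<in> Val T1" for g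
  proof -
    let ?r = "ramp g a" and ?\<rho> = "upd (upd (upd envz 7 ((T1 \<rightarrow> T1) \<rightarrow> T1) \<Phi>) 1 N a) 0 T1 g"
    have r [simp]: "?r \<in> Val (T1 \<rightarrow> T1)" using g by simp
    have "den ?\<rho> ramp_tm = den (upd (upd envz 0 T1 g) 1 N a) ramp_tm"
    proof -
      have "den (upd \<rho> 7 \<sigma> v) ramp_tm = den \<rho> ramp_tm" for \<rho> \<sigma> v
        by (rule den_upd_fresh) (use names_ramp in auto)
      moreover have "?\<rho> = upd (upd (upd envz 0 T1 g) 1 N a) 7 ((T1 \<rightarrow> T1) \<rightarrow> T1) \<Phi>"
        by (auto simp: upd_def fun_eq_iff)
      ultimately show ?thesis by metis
    qed
    then have "den ?\<rho> ramp_tm = ?r" using ramp_def[OF g a] by simp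
    then have "\<phi> \<bullet> g = zerov \<longleftrightarrow> \<bar>qv (\<Phi> \<bullet> ?r \<bullet> ?two) - qv a\<bar> < 1 / 2"
      using g by (simp add: \<phi>_def opv onev_monusv_zero hv_suc not_le del: bracket.simps monusv_suc)
    moreover have "\<bar>qv (\<Phi> \<bullet> ?r \<bullet> ?two) - qv a\<bar> < 1 / 2" if "x \<in> NV" "g \<bullet> x = zerov" for x
      using root[OF r ramp_Cbar[OF g a a01]] ramp_root[OF g a that] by simp
    moreover have "\<not> \<bar>qv (\<Phi> \<bullet> ?r \<bullet> ?two) - qv a\<bar> < 1 / 2" if "\<not> (\<exists>x\<in>NV. g \<bullet> x = zerov)"
      using that za ramp_no_root[OF g a] unfolding z_def by (metis not_less)
    ultimately show ?thesis by blast
  qed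
  then show ?thesis unfolding ev_exists2 using \<phi> by blast
qed

end

section \<open>From truth in models to provability\<close>

theorem corollary3p11:
  fixes sp :: spec
  assumes "admissible sp"
  shows "RCA0_Omega_proves sp (exists2 \<^bold>\<longleftrightarrow> Pi01_TRANS) \<and>
         RCA0_Omega_proves sp (Pi01_TRANS \<^bold>\<longleftrightarrow> IVT_star) \<and>
         RCA0_Omega_proves sp (IVT_star \<^bold>\<longleftrightarrow> UIVT)"
proof -
  have "RCA0_Omega_proves sp A" if A: "A \<in> set equivalences" for A
    unfolding RCA0_Omega_proves_def
  proof (rule proof_system.completeness)
    show "wf sp [] A" using A wf_principles by (auto simp: equivalences_def)
    fix at assume ax: "\<And>B. B \<in> {B. RCA0_Omega_ax sp B} \<Longrightarrow> wf sp [] B \<Longrightarrow> truth sp at B"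
    show "truth sp at A"
    proof (rule ccontr)
      assume "\<not> truth sp at A"
      then have "countermodel (sp, at)" using assms A ax by (auto simp: countermodel_def model_def)
      then have ex: "Ex countermodel" by blast
      \<comment> \<open>The field belongs to the chosen countermodel, which may differ from the one
        at hand even in its specification; this is why \<open>countermodel\<close> includes
        admissibility.\<close>
      obtain sp' at' where M: "the_countermodel = (sp', at')" by fastforce
      interpret embedded_model sp' at' "\<lambda>X. frac_of (Abs_number X)"
        using ex M by (rule embedded_the_countermodel)
      have "countermodel (sp', at')"
        unfolding M[symmetric] the_countermodel_def using ex by (rule someI_ex)
      then have adm: "admissible sp'" and false: "\<exists>A\<in>set equivalences. \<not> truth sp' at' A"
        by (simp_all add: countermodel_def)
      have "truth sp' at' exists2 = truth sp' at' Pi01_TRANS"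
        using exists2_imp_Pi01 Pi01_imp_exists2[OF adm] by blast
      moreover have "truth sp' at' IVT_star = truth sp' at' Pi01_TRANS"
        using IVT_imp_Pi01 Pi01_imp_IVT[OF adm] by blast
      moreover have "truth sp' at' UIVT = truth sp' at' exists2"
        using exists2_imp_UIVT UIVT_imp_exists2 by blast
      ultimately show False using false by (auto simp: equivalences_def)
    qed
  qed
  then show ?thesis by (simp add: equivalences_def)
qed

end
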